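(* Let $N^n\subset(M^m,c)$ be a conformal submanifold, with $m>n\ge2$. For a Weyl structure $\nabla$ on $M$, define for $X,Y\in TN$ and $l\in C^\infty(L_N)$ $$\overline{\mathrm{Hess}}^\nabla(X,Y)l=\nabla_X\nabla_Yl-\nabla_{(\nabla_XY)^N}l,\qquad P(X,Y)l=\overline{\mathrm{Hess}}^\nabla(X,Y)l+h^\nabla(X,Y)l,$$ and let $P_0(X,Y)l=P(X,Y)l-\frac1nc(X,Y)\,\mathrm{tr}_{TN}(Pl)$ be the trace-free part of $P$. The second order operator $\mathcal M^{ind}:C^\infty(L_N)\to C^\infty(T^*N\otimes T^*N\otimes L_N)$ defined by $$\mathcal M^{ind}(X,Y)l=P_0(X,Y)l+H^\nabla(B_0(X,Y))l,$$ or, equivalently, by $$\mathcal M^{ind}_{X,Y}l=\big(\mathrm{Hess}^\nabla_{0,N}(X,Y)l+\nabla_{B_0(X,Y)}l\big)+h^\nabla_{0,N}(X,Y)l+H^\nabla(B_0(X,Y))l$$ (where the double subscript $0,N$ means the trace-free part along $TN$, and in this second formula $l$ is extended to a section of $L$ on $M$ near $N$) does not depend on the choice of the Weyl structure $\nabla$, and defines a M\"obius structure on $N$ (called the induced M\"obius structure on $N$). Moreover, if $n\ge3$ (with $\mathcal M^N$ the canonical M\"obius structure of $(N,c)$), or if $n=2$ and $N$ has a M\"obius structure $\mathcal M^N$ compatible with $c$, then $$\mathcal M^{ind}-\mathcal M^N=\rho_0,$$ where $\rho$ is the relative Schouten-Weyl tensor of the embedding and $\rho_0$ its trace-free part.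
   Context: All objects are smooth. On an $m$-manifold $M$, for $k\in\mathbb R$, $L^k$ is the oriented real line bundle associated with the frame bundle and the representation $|\det|^{k/m}$. A conformal structure $c$ is a positive-definite section of $S^2T^*M\otimes L^2$, normalized by $|\det c|=1$; equivalently it is the conformal class of metrics $l^{-2}c$, for $l$ a positive section of $L$. Via $c$, $T^*M\cong TM\otimes L^{-2}$; inner products and traces $\mathrm{tr}_c$ are taken with these weights. A Weyl structure $\nabla$ is a torsion-free connection on $TM$ with $\nabla c=0$ (with the induced connection on $L$). $F^\nabla\in\Lambda^2T^*M$ (Faraday form) is the curvature of the connection induced by $\nabla$ on $L$. Put $R^\nabla_{X,Y}Z=\nabla_X\nabla_YZ-\nabla_Y\nabla_XZ-\nabla_{[X,Y]}Z$, $\mathrm{Ric}^\nabla(X,Y)=\mathrm{tr}(Z\mapsto R^\nabla_{Z,X}Y)$, $\mathrm{Scal}^\nabla=\mathrm{tr}_c\mathrm{Ric}^\nabla$, and $\sigma^\nabla=\frac{1}{2(m-1)}\mathrm{Scal}^\nabla$ for $m\ge2$. Schouten-Weyl tensor $h^\nabla\in T^*M\otimes T^*M$. For $m\ge3$: $h^\nabla=\frac1{m-2}\mathrm{Ric}^{\nabla,s}_0+\frac1m\sigma^\nabla c-\frac12F^\nabla$, where $\mathrm{Ric}^{\nabla,s}_0$ is the symmetric trace-free part of $\mathrm{Ric}^\nabla$. For sections $l$ of $L$, $\mathrm{Hess}^\nabla(X,Y)l=\nabla_X\nabla_Yl-\nabla_{\nabla_XY}l$, and $\mathrm{Hess}^\nabla_0$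 is its symmetric trace-free part. A M\"obius structure on $(M,c)$, $m\ge2$, is a linear second order differential operator $\mathcal M:C^\infty(L)\to C^\infty(S^2_0T^*M\otimes L)$ such that $\mathcal M-\mathrm{Hess}_0^\nabla$ is of order zero for some (hence every) Weyl structure $\nabla$. For $m\ge3$ the canonical M\"obius structure is $\mathrm{Hess}_0^\nabla+h_0^{\nabla,s}$ ($h_0^{\nabla,s}$ the symmetric trace-free part of $h^\nabla$), which is independent of $\nabla$. On a M\"obius surface ($m=2$ with a fixed $\mathcal M$): $h^\nabla=h_0^{\mathcal M,\nabla}+\frac12\sigma^\nabla c-\frac12F^\nabla$ with $h_0^{\mathcal M,\nabla}:=\mathcal M-\mathrm{Hess}^\nabla_0$. The same definitions apply to $N$. Submanifolds. $N^n\subset M^m$ carries the induced conformal structure $c$, and $L_N=L_M|_N$ is its weight bundle; $\nu$ is its normal bundle, $TM|_N=TN\oplus\nu$, with components denoted by $(\cdot)^N,(\cdot)^\perp$. For a Weyl structure $\nabla$ on $M$: $\nabla^N_XY=(\nabla_XY)^N$ is the induced Weyl structure on $N$; $B^\nabla(X,Y)=(\nabla_XY)^\perp$ ($X,Y\in TN$) is the fundamental form; $H^\nabla\in\nu^*\cong\nu\otimes L^{-2}$, $H^\nabla(\xi)=-\frac1n\mathrm{tr}(X\mapsto(\nabla_X\xi)^N)$, is the mean curvature; $B^\nabla=H^\nabla\cdot c+B_0$ with $B_0\in S^2_0T^*N\otimes\nu$ trace-free, independent of $\nabla$. Relative Schouten-Weyl tensor ($n\ge3$, or $N$ a M\"obius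 surface compatible with the induced conformal structure): for $X,Y\in TN$, $$\rho(X,Y)=h^\nabla(X,Y)-h^{\nabla^N}(X,Y)+\tfrac12c(H^\nabla,H^\nabla)c(X,Y)+H^\nabla(B_0(X,Y)),$$ with $h^{\nabla^N}$ the Schouten-Weyl tensor of $\nabla^N$ on $N$; it is independent of $\nabla$. *)

theory Defs
  imports "HOL-Analysis.Analysis"
begin

section \<open>Smooth maps between open subsets of normed spaces\<close>

abbreviation deriv_along ::
    "('e::real_normed_vector \<Rightarrow> 'f::real_normed_vector) \<Rightarrow> 'e \<Rightarrow> 'e \<Rightarrow> 'f" where
  "deriv_along f x v \<equiv> frechet_derivative f (at x) v"

primrec Ck_on ::
    "nat \<Rightarrow> 'e::real_normed_vector set \<Rightarrow> ('e \<Rightarrow> 'f::real_normed_vector) \<Rightarrow> bool" where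
  "Ck_on 0 S f = continuous_on S f"
| "Ck_on (Suc k) S f = ((\<forall>x\<in>S. f differentiable (at x)) \<and>
     (\<forall>v. Ck_on k S (\<lambda>x. deriv_along f x v)))"

definition smooth_on :: "'e::real_normed_vector set \<Rightarrow> ('e \<Rightarrow> 'f::real_normed_vector) \<Rightarrow> bool" where
  "smooth_on S f \<longleftrightarrow> (\<forall>k. Ck_on k S f)"


section \<open>Smooth manifolds\<close>

text \<open>
  An atlas is a family of charts indexed by a set of labels; the dimension is the cardinality of
  the index type of the model space.  Only the values of \<open>cmap \<A> i\<close> on \<open>cdom \<A> i\<close> matter.
\<close>

record ('i, 'a, 'm) atlas =
  labels :: "'i set"
  cdom :: "'i \<Rightarrow> 'a set"
  cmap :: "'i \<Rightarrow> 'a \<Rightarrow> real ^ 'm"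

definition cimg :: "('i, 'a, 'm::finite) atlas \<Rightarrow> 'i \<Rightarrow> (real ^ 'm) set" where
  "cimg \<A> i = cmap \<A> i ` cdom \<A> i"

definition overlap :: "('i, 'a, 'm::finite) atlas \<Rightarrow> 'i \<Rightarrow> 'i \<Rightarrow> (real ^ 'm) set" where
  "overlap \<A> i j = cmap \<A> i ` (cdom \<A> i \<inter> cdom \<A> j)"

definition transition :: "('i, 'a, 'm::finite) atlas \<Rightarrow> 'i \<Rightarrow> 'i \<Rightarrow> real ^ 'm \<Rightarrow> real ^ 'm" where
  "transition \<A> i j = cmap \<A> j \<circ> inv_into (cdom \<A> i) (cmap \<A> i)"

definition is_chart :: "'a topology \<Rightarrow> 'a set \<Rightarrow> ('a \<Rightarrow> real ^ 'm::finite) \<Rightarrow> bool" where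
  "is_chart X U \<phi> \<longleftrightarrow> openin X U \<and> open (\<phi> ` U) \<and>
     homeomorphic_map (subtopology X U) (top_of_set (\<phi> ` U)) \<phi>"

definition compatible ::
    "'a set \<Rightarrow> ('a \<Rightarrow> real ^ 'm::finite) \<Rightarrow> 'a set \<Rightarrow> ('a \<Rightarrow> real ^ 'm) \<Rightarrow> bool" where
  "compatible U \<phi> V \<psi> \<longleftrightarrow>
     smooth_on (\<phi> ` (U \<inter> V)) (\<psi> \<circ> inv_into U \<phi>) \<and>
     smooth_on (\<psi> ` (U \<inter> V)) (\<phi> \<circ> inv_into V \<psi>)"

definition smooth_atlas :: "'a topology \<Rightarrow> ('i, 'a, 'm::finite) atlas \<Rightarrow> bool" where
  "smooth_atlas X \<A> \<longleftrightarrow>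
     (\<forall>i\<in>labels \<A>. is_chart X (cdom \<A> i) (cmap \<A> i)) \<and>
     (\<Union>i\<in>labels \<A>. cdom \<A> i) = topspace X \<and>
     (\<forall>i\<in>labels \<A>. \<forall>j\<in>labels \<A>.
        compatible (cdom \<A> i) (cmap \<A> i) (cdom \<A> j) (cmap \<A> j))"

definition maximal_atlas :: "'a topology \<Rightarrow> ('i, 'a, 'm::finite) atlas \<Rightarrow> bool" where
  "maximal_atlas X \<A> \<longleftrightarrow>
     (\<forall>U \<phi>. is_chart X U \<phi> \<and> (\<forall>i\<in>labels \<A>. compatible U \<phi> (cdom \<A> i) (cmap \<A> i)) \<longrightarrow>
        (\<exists>i\<in>labels \<A>. cdom \<A> i = U \<and> (\<forall>p\<in>U. cmap \<A> i p = \<phi> p)))"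

definition smooth_manifold :: "'a topology \<Rightarrow> ('i, 'a, 'm::finite) atlas \<Rightarrow> bool" where
  "smooth_manifold X \<A> \<longleftrightarrow>
     Hausdorff_space X \<and> second_countable X \<and> smooth_atlas X \<A> \<and> maximal_atlas X \<A>"


section \<open>Sections of natural bundles\<close>

text \<open>
  A section of a bundle associated with the frame bundle is given by its components with respect
  to the coordinate frames of all charts of an atlas, subject to the transformation law of the
  bundle: \<open>s i x\<close> is the component at the point with coordinates \<open>x\<close> in the chart \<open>i\<close>, and only
  the values for \<open>x\<close> in the image of the chart matter.

  For \<open>L\<^sup>k\<close>, the representation \<open>\<bar>det\<bar>\<close> to the power \<open>k / m\<close> gives the law below.
  \<open>dens_section \<A> W k l\<close> says that \<open>l\<close> is a smooth section of \<open>L\<^sup>k\<close> over \<open>W\<close>; \<open>W = UNIV\<close> yields the global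
  sections.
\<close>

definition dens_section ::
    "('i, 'a, 'm::finite) atlas \<Rightarrow> 'a set \<Rightarrow> real \<Rightarrow> ('i \<Rightarrow> real ^ 'm \<Rightarrow> real) \<Rightarrow> bool" where
  "dens_section \<A> W k l \<longleftrightarrow>
     (\<forall>i\<in>labels \<A>. smooth_on (cmap \<A> i ` (cdom \<A> i \<inter> W)) (l i)) \<and>
     (\<forall>i\<in>labels \<A>. \<forall>j\<in>labels \<A>. \<forall>x\<in>cmap \<A> i ` (cdom \<A> i \<inter> cdom \<A> j \<inter> W).
        let \<tau> = transition \<A> i j; J = frechet_derivative \<tau> (at x) in
        l j (\<tau> x) = \<bar>det (matrix J)\<bar> powr (k / real CARD('m)) * l i x)"

text \<open>Smooth sections of \<open>T\<^sup>*M \<otimes> T\<^sup>*M \<otimes> L\<^sup>k\<close>.\<close>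

definition tensor2 ::
    "('i, 'a, 'm::finite) atlas \<Rightarrow> real \<Rightarrow> ('i \<Rightarrow> real ^ 'm \<Rightarrow> real ^ 'm \<Rightarrow> real ^ 'm \<Rightarrow> real) \<Rightarrow> bool"
  where
  "tensor2 \<A> k b \<longleftrightarrow>
     (\<forall>i\<in>labels \<A>. (\<forall>x\<in>cimg \<A> i. bilinear (b i x)) \<and>
        (\<forall>u v. smooth_on (cimg \<A> i) (\<lambda>x. b i x u v))) \<and>
     (\<forall>i\<in>labels \<A>. \<forall>j\<in>labels \<A>. \<forall>x\<in>overlap \<A> i j. \<forall>u v.
        let \<tau> = transition \<A> i j; J = frechet_derivative \<tau> (at x) in
        b j (\<tau> x) (J u) (J v) = \<bar>det (matrix J)\<bar> powr (k / real CARD('m)) * b i x u v)"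

text \<open>Gram matrix in the coordinate basis, trace of an endomorphism, trace and trace-free part of
  a bilinear form \<open>q\<close> with respect to an inner product \<open>b\<close>.\<close>

definition gram :: "(real ^ 'm::finite \<Rightarrow> real ^ 'm \<Rightarrow> real) \<Rightarrow> real ^ 'm ^ 'm" where
  "gram b = (\<chi> p q. b (axis p 1) (axis q 1))"

definition tr_end :: "(real ^ 'm::finite \<Rightarrow> real ^ 'm) \<Rightarrow> real" where
  "tr_end T = trace (matrix T)"

definition tr_form ::
    "(real ^ 'm::finite \<Rightarrow> real ^ 'm \<Rightarrow> real) \<Rightarrow> (real ^ 'm \<Rightarrow> real ^ 'm \<Rightarrow> real) \<Rightarrow> real" where
  "tr_form b q =
     (\<Sum>r\<in>UNIV. \<Sum>s\<in>UNIV. matrix_inv (gram b) $ r $ s * q (axis r 1) (axis s 1))"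

definition tracefree ::
    "(real ^ 'm::finite \<Rightarrow> real ^ 'm \<Rightarrow> real) \<Rightarrow> (real ^ 'm \<Rightarrow> real ^ 'm \<Rightarrow> real)
       \<Rightarrow> real ^ 'm \<Rightarrow> real ^ 'm \<Rightarrow> real" where
  "tracefree b q u v = q u v - (1 / real CARD('m)) * b u v * tr_form b q"

definition symm :: "('v \<Rightarrow> 'v \<Rightarrow> real) \<Rightarrow> 'v \<Rightarrow> 'v \<Rightarrow> real" where
  "symm q u v = (q u v + q v u) / 2"

definition sym_tracefree_section ::
    "('i, 'a, 'm::finite) atlas \<Rightarrow> ('i \<Rightarrow> real ^ 'm \<Rightarrow> real ^ 'm \<Rightarrow> real ^ 'm \<Rightarrow> real)
       \<Rightarrow> real \<Rightarrow> ('i \<Rightarrow> real ^ 'm \<Rightarrow> real ^ 'm \<Rightarrow> real ^ 'm \<Rightarrow> real) \<Rightarrow> bool" where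
  "sym_tracefree_section \<A> c k b \<longleftrightarrow> tensor2 \<A> k b \<and>
     (\<forall>i\<in>labels \<A>. \<forall>x\<in>cimg \<A> i. (\<forall>u v. b i x u v = b i x v u) \<and> tr_form (c i x) (b i x) = 0)"

definition conformal_structure ::
    "('i, 'a, 'm::finite) atlas \<Rightarrow> ('i \<Rightarrow> real ^ 'm \<Rightarrow> real ^ 'm \<Rightarrow> real ^ 'm \<Rightarrow> real) \<Rightarrow> bool" where
  "conformal_structure \<A> c \<longleftrightarrow> tensor2 \<A> 2 c \<and>
     (\<forall>i\<in>labels \<A>. \<forall>x\<in>cimg \<A> i.
        (\<forall>u v. c i x u v = c i x v u) \<and> (\<forall>u. u \<noteq> 0 \<longrightarrow> c i x u u > 0) \<and>
        \<bar>det (gram (c i x))\<bar> = 1)"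


section \<open>Connections and their curvature in a chart\<close>

text \<open>
  Here \<open>G\<close> is the Christoffel symbol of a connection in a chart, \<open>g\<close> a conformal structure in the
  same chart (in the trivialisation of \<open>L\<^sup>2\<close> given by the coordinate frame), and \<open>X, Y, Z\<close> are
  component functions of vector fields.  The connection on \<open>L\<^sup>k\<close> is the one associated with the
  representation \<open>\<bar>det\<bar>\<close> to the power \<open>k / m\<close>, whose differential is \<open>(k / m) tr\<close>.

  Tensors defined by means of vector fields or sections are evaluated at vectors by
  extending the vectors constantly, i.e.\ by coordinate vector fields.
\<close>

context
  fixes G :: "real ^ 'm::finite \<Rightarrow> real ^ 'm \<Rightarrow> real ^ 'm \<Rightarrow> real ^ 'm"
begin

definition cov_vec :: "(real ^ 'm \<Rightarrow> real ^ 'm) \<Rightarrow> (real ^ 'm \<Rightarrow> real ^ 'm) \<Rightarrow> real ^ 'm \<Rightarrow> real ^ 'm"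
  where
  "cov_vec X Y x = deriv_along Y x (X x) + G x (X x) (Y x)"

definition cov_dens ::
    "real \<Rightarrow> (real ^ 'm \<Rightarrow> real ^ 'm) \<Rightarrow> (real ^ 'm \<Rightarrow> real) \<Rightarrow> real ^ 'm \<Rightarrow> real" where
  "cov_dens k X l x =
     deriv_along l x (X x) + (k / real CARD('m)) * tr_end (G x (X x)) * l x"

definition lie_bracket ::
    "(real ^ 'm \<Rightarrow> real ^ 'm) \<Rightarrow> (real ^ 'm \<Rightarrow> real ^ 'm) \<Rightarrow> real ^ 'm \<Rightarrow> real ^ 'm" where
  "lie_bracket X Y x = deriv_along Y x (X x) - deriv_along X x (Y x)"

definition curv ::
    "(real ^ 'm \<Rightarrow> real ^ 'm) \<Rightarrow> (real ^ 'm \<Rightarrow> real ^ 'm) \<Rightarrow> (real ^ 'm \<Rightarrow> real ^ 'm)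
       \<Rightarrow> real ^ 'm \<Rightarrow> real ^ 'm" where
  "curv X Y Z x = cov_vec X (cov_vec Y Z) x - cov_vec Y (cov_vec X Z) x
     - cov_vec (lie_bracket X Y) Z x"

definition curv_dens ::
    "(real ^ 'm \<Rightarrow> real ^ 'm) \<Rightarrow> (real ^ 'm \<Rightarrow> real ^ 'm) \<Rightarrow> (real ^ 'm \<Rightarrow> real)
       \<Rightarrow> real ^ 'm \<Rightarrow> real" where
  "curv_dens X Y l x = cov_dens 1 X (cov_dens 1 Y l) x - cov_dens 1 Y (cov_dens 1 X l) x
     - cov_dens 1 (lie_bracket X Y) l x"

definition ricci :: "real ^ 'm \<Rightarrow> real ^ 'm \<Rightarrow> real ^ 'm \<Rightarrow> real" where
  "ricci x u v = tr_end (\<lambda>w. curv (\<lambda>_. w) (\<lambda>_. u) (\<lambda>_. v) x)"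

text \<open>The constant section \<open>1\<close> is the trivialising section of \<open>L\<close> in the chart.\<close>

definition faraday :: "real ^ 'm \<Rightarrow> real ^ 'm \<Rightarrow> real ^ 'm \<Rightarrow> real" where
  "faraday x u v = curv_dens (\<lambda>_. u) (\<lambda>_. v) (\<lambda>_. 1) x"

definition hess ::
    "(real ^ 'm \<Rightarrow> real ^ 'm) \<Rightarrow> (real ^ 'm \<Rightarrow> real ^ 'm) \<Rightarrow> (real ^ 'm \<Rightarrow> real)
       \<Rightarrow> real ^ 'm \<Rightarrow> real" where
  "hess X Y l x = cov_dens 1 X (cov_dens 1 Y l) x - cov_dens 1 (cov_vec X Y) l x"

definition hess_form :: "(real ^ 'm \<Rightarrow> real) \<Rightarrow> real ^ 'm \<Rightarrow> real ^ 'm \<Rightarrow> real ^ 'm \<Rightarrow> real" where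
  "hess_form l x u v = hess (\<lambda>_. u) (\<lambda>_. v) l x"

context
  fixes g :: "real ^ 'm \<Rightarrow> real ^ 'm \<Rightarrow> real ^ 'm \<Rightarrow> real"
begin

definition cov_conf ::
    "(real ^ 'm \<Rightarrow> real ^ 'm) \<Rightarrow> (real ^ 'm \<Rightarrow> real ^ 'm) \<Rightarrow> (real ^ 'm \<Rightarrow> real ^ 'm)
       \<Rightarrow> real ^ 'm \<Rightarrow> real" where
  "cov_conf X Y Z x = cov_dens 2 X (\<lambda>z. g z (Y z) (Z z)) x
     - g x (cov_vec X Y x) (Z x) - g x (Y x) (cov_vec X Z x)"

definition hess0 :: "(real ^ 'm \<Rightarrow> real) \<Rightarrow> real ^ 'm \<Rightarrow> real ^ 'm \<Rightarrow> real ^ 'm \<Rightarrow> real" where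
  "hess0 l x = tracefree (g x) (symm (hess_form l x))"

definition sigma :: "real ^ 'm \<Rightarrow> real" where
  "sigma x = tr_form (g x) (ricci x) / (2 * (real CARD('m) - 1))"

definition schouten_weyl :: "real ^ 'm \<Rightarrow> real ^ 'm \<Rightarrow> real ^ 'm \<Rightarrow> real" where
  "schouten_weyl x u v =
     (1 / (real CARD('m) - 2)) * tracefree (g x) (symm (ricci x)) u v
     + (1 / real CARD('m)) * sigma x * g x u v - (1 / 2) * faraday x u v"

end

end


section \<open>Weyl structures and Moebius structures\<close>

definition torsion_free_connection ::
    "('i, 'a, 'm::finite) atlas \<Rightarrow> ('i \<Rightarrow> real ^ 'm \<Rightarrow> real ^ 'm \<Rightarrow> real ^ 'm \<Rightarrow> real ^ 'm) \<Rightarrow> bool"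
  where
  "torsion_free_connection \<A> \<Gamma> \<longleftrightarrow>
     (\<forall>i\<in>labels \<A>. (\<forall>x\<in>cimg \<A> i. bilinear (\<Gamma> i x) \<and> (\<forall>u v. \<Gamma> i x u v = \<Gamma> i x v u)) \<and>
        (\<forall>u v. smooth_on (cimg \<A> i) (\<lambda>x. \<Gamma> i x u v))) \<and>
     (\<forall>i\<in>labels \<A>. \<forall>j\<in>labels \<A>. \<forall>x\<in>overlap \<A> i j. \<forall>u v.
        let \<tau> = transition \<A> i j; J = frechet_derivative \<tau> (at x) in
        \<Gamma> j (\<tau> x) (J u) (J v) =
          J (\<Gamma> i x u v) - deriv_along (\<lambda>z. deriv_along \<tau> z v) x u)"

definition weyl_structure ::
    "('i, 'a, 'm::finite) atlas \<Rightarrow> ('i \<Rightarrow> real ^ 'm \<Rightarrow> real ^ 'm \<Rightarrow> real ^ 'm \<Rightarrow> real)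
       \<Rightarrow> ('i \<Rightarrow> real ^ 'm \<Rightarrow> real ^ 'm \<Rightarrow> real ^ 'm \<Rightarrow> real ^ 'm) \<Rightarrow> bool" where
  "weyl_structure \<A> c \<Gamma> \<longleftrightarrow> torsion_free_connection \<A> \<Gamma> \<and>
     (\<forall>i\<in>labels \<A>. \<forall>x\<in>cimg \<A> i. \<forall>w u v.
        cov_conf (\<Gamma> i) (c i) (\<lambda>_. w) (\<lambda>_. u) (\<lambda>_. v) x = 0)"

type_synonym ('i, 'm) dens_op =
  "('i \<Rightarrow> real ^ 'm \<Rightarrow> real) \<Rightarrow> 'i \<Rightarrow> real ^ 'm \<Rightarrow> real ^ 'm \<Rightarrow> real ^ 'm \<Rightarrow> real"

text \<open>Linear differential operators of order at most two from \<open>L\<close> to \<open>T\<^sup>*M \<otimes> T\<^sup>*M \<otimes> L\<close>.\<close>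

definition second_order_op :: "('i, 'a, 'm::finite) atlas \<Rightarrow> ('i, 'm) dens_op \<Rightarrow> bool" where
  "second_order_op \<A> D \<longleftrightarrow>
     (\<forall>l. dens_section \<A> UNIV 1 l \<longrightarrow> tensor2 \<A> 1 (D l)) \<and>
     (\<forall>i\<in>labels \<A>. \<exists>a b e.
        (\<forall>p q u v. smooth_on (cimg \<A> i) (\<lambda>x. a p q x u v)) \<and>
        (\<forall>p u v. smooth_on (cimg \<A> i) (\<lambda>x. b p x u v)) \<and>
        (\<forall>u v. smooth_on (cimg \<A> i) (\<lambda>x. e x u v)) \<and>
        (\<forall>l. dens_section \<A> UNIV 1 l \<longrightarrow> (\<forall>x\<in>cimg \<A> i. \<forall>u v.
           D l i x u v =
             (\<Sum>p\<in>UNIV. \<Sum>q\<in>UNIV. (a p q x u v :: real) *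
                deriv_along (\<lambda>z. deriv_along (l i) z (axis q 1)) x (axis p 1))
             + (\<Sum>p\<in>UNIV. (b p x u v :: real) * deriv_along (l i) x (axis p 1))
             + (e x u v :: real) * l i x)))"

text \<open>
  \<open>D - Hess\<^sub>0\<close> is of order zero, i.e.\ it is the multiplication with the section \<open>A\<close> of the bundle
  \<open>Hom(L, S\<^sup>2\<^sub>0 T\<^sup>*M \<otimes> L) = S\<^sup>2\<^sub>0 T\<^sup>*M\<close>.
\<close>

definition zero_order_part ::
    "('i, 'a, 'm::finite) atlas \<Rightarrow> ('i \<Rightarrow> real ^ 'm \<Rightarrow> real ^ 'm \<Rightarrow> real ^ 'm \<Rightarrow> real)
       \<Rightarrow> ('i, 'm) dens_op \<Rightarrow> ('i \<Rightarrow> real ^ 'm \<Rightarrow> real ^ 'm \<Rightarrow> real ^ 'm \<Rightarrow> real ^ 'm)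
       \<Rightarrow> ('i \<Rightarrow> real ^ 'm \<Rightarrow> real ^ 'm \<Rightarrow> real ^ 'm \<Rightarrow> real) \<Rightarrow> bool" where
  "zero_order_part \<A> c D \<Gamma> A \<longleftrightarrow> sym_tracefree_section \<A> c 0 A \<and>
     (\<forall>l. dens_section \<A> UNIV 1 l \<longrightarrow> (\<forall>i\<in>labels \<A>. \<forall>x\<in>cimg \<A> i. \<forall>u v.
        D l i x u v - hess0 (\<Gamma> i) (c i) (l i) x u v = A i x u v * l i x))"

definition moebius_structure ::
    "('i, 'a, 'm::finite) atlas \<Rightarrow> ('i \<Rightarrow> real ^ 'm \<Rightarrow> real ^ 'm \<Rightarrow> real ^ 'm \<Rightarrow> real)
       \<Rightarrow> ('i, 'm) dens_op \<Rightarrow> bool" where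
  "moebius_structure \<A> c D \<longleftrightarrow> second_order_op \<A> D \<and>
     (\<forall>l. dens_section \<A> UNIV 1 l \<longrightarrow> sym_tracefree_section \<A> c 1 (D l)) \<and>
     (\<exists>\<Gamma>. weyl_structure \<A> c \<Gamma> \<and> (\<exists>A. zero_order_part \<A> c D \<Gamma> A))"

text \<open>In dimension at least three.\<close>

definition canonical_moebius ::
    "('i \<Rightarrow> real ^ 'm::finite \<Rightarrow> real ^ 'm \<Rightarrow> real ^ 'm \<Rightarrow> real)
       \<Rightarrow> ('i \<Rightarrow> real ^ 'm \<Rightarrow> real ^ 'm \<Rightarrow> real ^ 'm \<Rightarrow> real ^ 'm) \<Rightarrow> ('i, 'm) dens_op" where
  "canonical_moebius c \<Gamma> l i x u v = hess0 (\<Gamma> i) (c i) (l i) x u v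
     + tracefree (c i x) (symm (schouten_weyl (\<Gamma> i) (c i) x)) u v * l i x"

text \<open>
  In dimension two, on a Moebius surface.  On the chart images the section \<open>A\<close> with
  \<open>zero_order_part \<A> c D \<Gamma> A\<close> is unique, so the choice is the tensor \<open>D - Hess\<^sub>0\<close>.
\<close>

definition schouten_weyl_surface ::
    "('i, 'a, 'm::finite) atlas \<Rightarrow> ('i \<Rightarrow> real ^ 'm \<Rightarrow> real ^ 'm \<Rightarrow> real ^ 'm \<Rightarrow> real)
       \<Rightarrow> ('i, 'm) dens_op \<Rightarrow> ('i \<Rightarrow> real ^ 'm \<Rightarrow> real ^ 'm \<Rightarrow> real ^ 'm \<Rightarrow> real ^ 'm)
       \<Rightarrow> 'i \<Rightarrow> real ^ 'm \<Rightarrow> real ^ 'm \<Rightarrow> real ^ 'm \<Rightarrow> real" where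
  "schouten_weyl_surface \<A> c D \<Gamma> i x u v =
     (SOME A. zero_order_part \<A> c D \<Gamma> A) i x u v
     + (1 / 2) * sigma (\<Gamma> i) (c i) x * c i x u v - (1 / 2) * faraday (\<Gamma> i) x u v"


section \<open>Submanifolds\<close>

text \<open>
  A submanifold of dimension \<open>n\<close> and codimension \<open>k > 0\<close>: the model space of the ambient manifold is
  indexed by the sum of the two index types, and around each point of \<open>N\<close> there is a slice chart,
  in which \<open>N\<close> is the zero set of the last \<open>k\<close> coordinates.  The first \<open>n\<close> coordinates of the
  slice charts form an atlas of \<open>N\<close>, labelled by the slice charts of the ambient manifold.
\<close>

definition incl :: "real ^ 'n::finite \<Rightarrow> real ^ ('n + 'k::finite)" where
  "incl y = (\<chi> a. case a of Inl i \<Rightarrow> y $ i | Inr _ \<Rightarrow> 0)"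

definition slice_labels :: "('i, 'a, 'n::finite + 'k::finite) atlas \<Rightarrow> 'a set \<Rightarrow> 'i set" where
  "slice_labels \<A> N = {i \<in> labels \<A>.
     cmap \<A> i ` (cdom \<A> i \<inter> N) = cimg \<A> i \<inter> range (incl :: real ^ 'n \<Rightarrow> real ^ ('n + 'k))}"

definition submanifold ::
    "'a topology \<Rightarrow> ('i, 'a, 'n::finite + 'k::finite) atlas \<Rightarrow> 'a set \<Rightarrow> bool" where
  "submanifold X \<A> N \<longleftrightarrow>
     N \<subseteq> topspace X \<and> (\<forall>p\<in>N. \<exists>i\<in>slice_labels \<A> N. p \<in> cdom \<A> i)"

definition sub_atlas ::
    "('i, 'a, 'n::finite + 'k::finite) atlas \<Rightarrow> 'a set \<Rightarrow> ('i, 'a, 'n) atlas" where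
  "sub_atlas \<A> N = \<lparr>labels = slice_labels \<A> N, cdom = (\<lambda>i. cdom \<A> i \<inter> N),
     cmap = (\<lambda>i p. \<chi> a. cmap \<A> i p $ Inl a)\<rparr>"

text \<open>
  The following definitions take place in one slice chart; \<open>g\<close> and \<open>G\<close> are the components of the
  conformal structure and of the Weyl structure of the ambient manifold, \<open>y\<close> are the coordinates of
  a point of \<open>N\<close>.  Everything is expressed in the trivialisation of \<open>L\<^sub>M\<close> given by the chart.
\<close>

context
  fixes g :: "real ^ ('n::finite + 'k::finite) \<Rightarrow> real ^ ('n + 'k) \<Rightarrow> real ^ ('n + 'k) \<Rightarrow> real"
begin

definition tan_form :: "real ^ 'n \<Rightarrow> real ^ 'n \<Rightarrow> real ^ 'n \<Rightarrow> real" where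
  "tan_form y u v = g (incl y) (incl u) (incl v)"

text \<open>
  The isomorphism \<open>L\<^sub>N = L\<^sub>M|\<^sub>N\<close> is the positive one whose square carries the normalised conformal
  structure of \<open>N\<close> to the restriction of the one of \<open>M\<close>.  With respect to the trivialisations
  by the coordinate frames of \<open>N\<close> and of \<open>M\<close> it is the multiplication with \<open>weight_factor\<close>, and
  the normalisation of the determinant on \<open>N\<close> determines this factor.
\<close>

definition weight_factor :: "real ^ 'n \<Rightarrow> real" where
  "weight_factor y = det (gram (tan_form y)) powr (1 / (2 * real CARD('n)))"

definition normal_vec :: "real ^ 'n \<Rightarrow> real ^ ('n + 'k) \<Rightarrow> bool" where
  "normal_vec y w \<longleftrightarrow> (\<forall>v. g (incl y) w (incl v) = 0)"

definition tan_part :: "real ^ 'n \<Rightarrow> real ^ ('n + 'k) \<Rightarrow> real ^ 'n" where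
  "tan_part y w = (THE u. normal_vec y (w - incl u))"

definition nor_part :: "real ^ 'n \<Rightarrow> real ^ ('n + 'k) \<Rightarrow> real ^ ('n + 'k)" where
  "nor_part y w = w - incl (tan_part y w)"

context
  fixes G :: "real ^ ('n + 'k) \<Rightarrow> real ^ ('n + 'k) \<Rightarrow> real ^ ('n + 'k) \<Rightarrow> real ^ ('n + 'k)"
begin

text \<open>The connections on \<open>TM|\<^sub>N\<close> and \<open>L\<^sub>M|\<^sub>N\<close>.\<close>

definition along_vec ::
    "(real ^ 'n \<Rightarrow> real ^ 'n) \<Rightarrow> (real ^ 'n \<Rightarrow> real ^ ('n + 'k)) \<Rightarrow> real ^ 'n \<Rightarrow> real ^ ('n + 'k)"
  where
  "along_vec X Y y = deriv_along Y y (X y) + G (incl y) (incl (X y)) (Y y)"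

definition along_dens ::
    "(real ^ 'n \<Rightarrow> real ^ 'n) \<Rightarrow> (real ^ 'n \<Rightarrow> real) \<Rightarrow> real ^ 'n \<Rightarrow> real" where
  "along_dens X l y = deriv_along l y (X y)
     + (1 / real CARD('n + 'k)) * tr_end (G (incl y) (incl (X y))) * l y"

definition nabla_N :: "(real ^ 'n \<Rightarrow> real ^ 'n) \<Rightarrow> (real ^ 'n \<Rightarrow> real ^ 'n) \<Rightarrow> real ^ 'n \<Rightarrow> real ^ 'n"
  where
  "nabla_N X Y y = tan_part y (along_vec X (\<lambda>z. incl (Y z)) y)"

definition christoffel_N :: "real ^ 'n \<Rightarrow> real ^ 'n \<Rightarrow> real ^ 'n \<Rightarrow> real ^ 'n" where
  "christoffel_N y u v = nabla_N (\<lambda>_. u) (\<lambda>_. v) y"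

definition fund_form :: "real ^ 'n \<Rightarrow> real ^ 'n \<Rightarrow> real ^ 'n \<Rightarrow> real ^ ('n + 'k)" where
  "fund_form y u v = nor_part y (along_vec (\<lambda>_. u) (\<lambda>_. incl v) y)"

text \<open>A normal vector is extended to a section of the normal bundle by the normal part of its
  constant extension.\<close>

definition mean_curv :: "real ^ 'n \<Rightarrow> real ^ ('n + 'k) \<Rightarrow> real" where
  "mean_curv y \<xi> = - (1 / real CARD('n)) *
     tr_end (\<lambda>u. tan_part y (along_vec (\<lambda>_. u) (\<lambda>z. nor_part z \<xi>) y))"

text \<open>The mean curvature as an element of \<open>\<nu> \<otimes> L\<^sup>-\<^sup>2\<close>.\<close>

definition mean_curv_vec :: "real ^ 'n \<Rightarrow> real ^ ('n + 'k)" where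
  "mean_curv_vec y = (THE w. normal_vec y w \<and>
     (\<forall>\<xi>. normal_vec y \<xi> \<longrightarrow> g (incl y) w \<xi> = mean_curv y \<xi>))"

definition fund_form0 :: "real ^ 'n \<Rightarrow> real ^ 'n \<Rightarrow> real ^ 'n \<Rightarrow> real ^ ('n + 'k)" where
  "fund_form0 y u v = fund_form y u v - tan_form y u v *\<^sub>R mean_curv_vec y"

definition schouten_weyl_tan :: "real ^ 'n \<Rightarrow> real ^ 'n \<Rightarrow> real ^ 'n \<Rightarrow> real" where
  "schouten_weyl_tan y u v = schouten_weyl G g (incl y) (incl u) (incl v)"

definition hess_bar ::
    "(real ^ 'n \<Rightarrow> real ^ 'n) \<Rightarrow> (real ^ 'n \<Rightarrow> real ^ 'n) \<Rightarrow> (real ^ 'n \<Rightarrow> real)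
       \<Rightarrow> real ^ 'n \<Rightarrow> real" where
  "hess_bar X Y l y = along_dens X (along_dens Y l) y - along_dens (nabla_N X Y) l y"

definition P_form :: "(real ^ 'n \<Rightarrow> real) \<Rightarrow> real ^ 'n \<Rightarrow> real ^ 'n \<Rightarrow> real ^ 'n \<Rightarrow> real" where
  "P_form l y u v = hess_bar (\<lambda>_. u) (\<lambda>_. v) l y + schouten_weyl_tan y u v * l y"

definition ind_moebius_local ::
    "(real ^ 'n \<Rightarrow> real) \<Rightarrow> real ^ 'n \<Rightarrow> real ^ 'n \<Rightarrow> real ^ 'n \<Rightarrow> real" where
  "ind_moebius_local l y u v = tracefree (tan_form y) (P_form l y) u v
     + mean_curv y (fund_form0 y u v) * l y"

text \<open>The second expression for the operator, for a section \<open>l\<close> of \<open>L\<^sub>M\<close> on a neighbourhood.\<close>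

definition ind_moebius_ext ::
    "(real ^ ('n + 'k) \<Rightarrow> real) \<Rightarrow> real ^ 'n \<Rightarrow> real ^ 'n \<Rightarrow> real ^ 'n \<Rightarrow> real" where
  "ind_moebius_ext l y u v =
     (tracefree (tan_form y) (\<lambda>u' v'. hess_form G l (incl y) (incl u') (incl v')) u v
        + cov_dens G 1 (\<lambda>_. fund_form0 y u v) l (incl y))
     + tracefree (tan_form y) (schouten_weyl_tan y) u v * l (incl y)
     + mean_curv y (fund_form0 y u v) * l (incl y)"

definition rel_schouten_weyl ::
    "(real ^ 'n \<Rightarrow> real ^ 'n \<Rightarrow> real ^ 'n \<Rightarrow> real) \<Rightarrow> real ^ 'n \<Rightarrow> real ^ 'n \<Rightarrow> real ^ 'n \<Rightarrow> real"
  where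
  "rel_schouten_weyl hN y u v = schouten_weyl_tan y u v - hN y u v
     + (1 / 2) * g (incl y) (mean_curv_vec y) (mean_curv_vec y) * tan_form y u v
     + mean_curv y (fund_form0 y u v)"

end

end


section \<open>Induced structures on a submanifold\<close>

text \<open>As families over the labels of \<open>sub_atlas\<close>, in the trivialisations of \<open>L\<^sub>N\<close>.\<close>

definition conf_N ::
    "('i \<Rightarrow> real ^ ('n::finite + 'k::finite) \<Rightarrow> real ^ ('n + 'k) \<Rightarrow> real ^ ('n + 'k) \<Rightarrow> real)
       \<Rightarrow> 'i \<Rightarrow> real ^ 'n \<Rightarrow> real ^ 'n \<Rightarrow> real ^ 'n \<Rightarrow> real" where
  "conf_N c i y u v = tan_form (c i) y u v / (weight_factor (c i) y)\<^sup>2"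

definition weyl_N ::
    "('i \<Rightarrow> real ^ ('n::finite + 'k::finite) \<Rightarrow> real ^ ('n + 'k) \<Rightarrow> real ^ ('n + 'k) \<Rightarrow> real)
       \<Rightarrow> ('i \<Rightarrow> real ^ ('n + 'k) \<Rightarrow> real ^ ('n + 'k) \<Rightarrow> real ^ ('n + 'k) \<Rightarrow> real ^ ('n + 'k))
       \<Rightarrow> 'i \<Rightarrow> real ^ 'n \<Rightarrow> real ^ 'n \<Rightarrow> real ^ 'n \<Rightarrow> real ^ 'n" where
  "weyl_N c \<Gamma> i = christoffel_N (c i) (\<Gamma> i)"

text \<open>The section of \<open>L\<^sub>M|\<^sub>N\<close> corresponding to a section of \<open>L\<^sub>N\<close>.\<close>

definition dens_on_N ::
    "('i \<Rightarrow> real ^ ('n::finite + 'k::finite) \<Rightarrow> real ^ ('n + 'k) \<Rightarrow> real ^ ('n + 'k) \<Rightarrow> real)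
       \<Rightarrow> ('i \<Rightarrow> real ^ 'n \<Rightarrow> real) \<Rightarrow> 'i \<Rightarrow> real ^ 'n \<Rightarrow> real" where
  "dens_on_N c l i y = weight_factor (c i) y * l i y"

definition ind_moebius ::
    "('i \<Rightarrow> real ^ ('n::finite + 'k::finite) \<Rightarrow> real ^ ('n + 'k) \<Rightarrow> real ^ ('n + 'k) \<Rightarrow> real)
       \<Rightarrow> ('i \<Rightarrow> real ^ ('n + 'k) \<Rightarrow> real ^ ('n + 'k) \<Rightarrow> real ^ ('n + 'k) \<Rightarrow> real ^ ('n + 'k))
       \<Rightarrow> ('i, 'n) dens_op" where
  "ind_moebius c \<Gamma> l i y u v =
     ind_moebius_local (c i) (\<Gamma> i) (dens_on_N c l i) y u v / weight_factor (c i) y"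

text \<open>\<open>l'\<close> is a section of \<open>L\<^sub>M\<close> over the open set \<open>W\<close> and extends the section \<open>l\<close> of \<open>L\<^sub>N\<close>.\<close>

definition extends_on ::
    "'a topology \<Rightarrow> ('i, 'a, 'n::finite + 'k::finite) atlas \<Rightarrow> 'a set
       \<Rightarrow> ('i \<Rightarrow> real ^ ('n + 'k) \<Rightarrow> real ^ ('n + 'k) \<Rightarrow> real ^ ('n + 'k) \<Rightarrow> real)
       \<Rightarrow> ('i \<Rightarrow> real ^ 'n \<Rightarrow> real) \<Rightarrow> 'a set \<Rightarrow> ('i \<Rightarrow> real ^ ('n + 'k) \<Rightarrow> real) \<Rightarrow> bool" where
  "extends_on X \<A> N c l W l' \<longleftrightarrow> openin X W \<and> dens_section \<A> W 1 l' \<and>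
     (\<forall>i\<in>slice_labels \<A> N. \<forall>y. incl y \<in> cmap \<A> i ` (cdom \<A> i \<inter> W) \<longrightarrow>
        l' i (incl y) = dens_on_N c l i y)"

text \<open>The relative Schouten-Weyl tensor for \<open>n \<ge> 3\<close>, and for \<open>n = 2\<close> and a Moebius structure \<open>D\<close>
  on \<open>N\<close>.\<close>

definition rho ::
    "('i \<Rightarrow> real ^ ('n::finite + 'k::finite) \<Rightarrow> real ^ ('n + 'k) \<Rightarrow> real ^ ('n + 'k) \<Rightarrow> real)
       \<Rightarrow> ('i \<Rightarrow> real ^ ('n + 'k) \<Rightarrow> real ^ ('n + 'k) \<Rightarrow> real ^ ('n + 'k) \<Rightarrow> real ^ ('n + 'k))
       \<Rightarrow> 'i \<Rightarrow> real ^ 'n \<Rightarrow> real ^ 'n \<Rightarrow> real ^ 'n \<Rightarrow> real" where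
  "rho c \<Gamma> i = rel_schouten_weyl (c i) (\<Gamma> i) (schouten_weyl (weyl_N c \<Gamma> i) (conf_N c i))"

definition rho_surface ::
    "('i, 'a, 'n::finite + 'k::finite) atlas \<Rightarrow> 'a set
       \<Rightarrow> ('i \<Rightarrow> real ^ ('n + 'k) \<Rightarrow> real ^ ('n + 'k) \<Rightarrow> real ^ ('n + 'k) \<Rightarrow> real)
       \<Rightarrow> ('i, 'n) dens_op
       \<Rightarrow> ('i \<Rightarrow> real ^ ('n + 'k) \<Rightarrow> real ^ ('n + 'k) \<Rightarrow> real ^ ('n + 'k) \<Rightarrow> real ^ ('n + 'k))
       \<Rightarrow> 'i \<Rightarrow> real ^ 'n \<Rightarrow> real ^ 'n \<Rightarrow> real ^ 'n \<Rightarrow> real" where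
  "rho_surface \<A> N c D \<Gamma> i = rel_schouten_weyl (c i) (\<Gamma> i)
     (schouten_weyl_surface (sub_atlas \<A> N) (conf_N c) D (weyl_N c \<Gamma>) i)"

end

theory Submission
  imports Defs
begin

text \<open>
  In a slice chart, the identification of \<open>L\<^sub>N\<close> with \<open>L\<^sub>M|\<^sub>N\<close> turns the operator
  \<open>\<nabla>\<^sub>X \<nabla>\<^sub>Y l - \<nabla>\<^bsub>(\<nabla>\<^sub>X Y)\<^sup>N\<^esub> l\<close> into the Hessian of the induced Weyl structure
  (by Jacobi's formula for the derivative of a determinant), and the Faraday form of the induced
  Weyl structure is the restriction of the ambient one, so that the antisymmetric parts of the
  Hessian and of \<open>h\<close> cancel.  The induced operator is therefore
  the trace-free Hessian of \<open>\<nabla>\<^sup>N\<close> plus multiplication with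
  \<open>A = tracefree (Ric\<^sup>s|\<^sub>N) / (m - 2) + H (B\<^sub>0)\<close>.

  If \<open>\<gamma>\<close> is the change of the connection form on \<open>L\<close>, then, up to multiples of the metric, the
  Hessian changes by \<open>\<nabla>\<gamma> - \<gamma> \<otimes> \<gamma>\<close> and the symmetrised Ricci tensor in dimension \<open>d\<close> by
  \<open>-(d - 2) (sym \<nabla>\<gamma> - \<gamma> \<otimes> \<gamma>)\<close>.  The restriction to \<open>N\<close> of the ambient \<open>\<nabla>\<gamma>\<close> differs from the
  intrinsic one by \<open>\<gamma> (B)\<close>, whose trace-free part is compensated by the change of \<open>H (B\<^sub>0)\<close>.  Multiples
  of the metric never matter, because only trace-free parts are compared; for the same reason the
  comparison with \<open>\<rho>\<^sub>0\<close> needs no Gauss equation.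
\<close>


section \<open>Smooth maps\<close>

text \<open>A section is a family of components, so being a tensor is a statement about every pair
  of charts. Independence of the Weyl structure and the comparison with \<rho> are decided inside
  one slice chart. That the result is a tensor on \<open>N\<close> rests on how all the ingredients
  (Christoffel symbols, Ricci form, fundamental form, weight factor) behave under transition maps,
  and the transition maps of \<open>N\<close> are restrictions of those of \<open>M\<close>. The
  factor 1 / (m - 2) makes sense because m > n >= 2, and it cancels the factor m - 2 in the change
  of the Ricci tensor. On a surface \<open>N\<close> the corresponding factor n - 2 is zero: the
  intrinsic Ricci tensor cannot compensate the change of the Hessian. A Moebius structure on a
  surface is therefore additional data, and the zero-order part of a given one has to be carried
  from the Weyl structure with which it comes to the induced one.\<close>

lemma frechet_derivative_cong_open:
  assumes "open S" "x \<in> S" "\<And>z. z \<in> S \<Longrightarrow> f z = g z"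
  shows "frechet_derivative f (at x) = frechet_derivative g (at x)"
proof -
  have "(f has_derivative D) (at x) \<longleftrightarrow> (g has_derivative D) (at x)" for D
    using has_derivative_transform_within_open[OF _ assms(1,2), of f D UNIV g]
      has_derivative_transform_within_open[OF _ assms(1,2), of g D UNIV f] assms(3) by auto
  \<comment> \<open>\<open>frechet_derivative\<close> is a choice among all derivatives, so equal
    predicates give equal values even at points where no derivative exists.\<close>
  then show ?thesis by (simp add: frechet_derivative_def)
qed

lemma differentiable_cong_open:
  assumes "open S" "x \<in> S" "\<And>z. z \<in> S \<Longrightarrow> f z = g z" "f differentiable at x"
  shows "g differentiable at x"
  using assms has_derivative_transform_within_open[of f _ x UNIV S g]
  unfolding differentiable_def by blast

lemma has_derivative_deriv_along:
  "f differentiable at x \<Longrightarrow> (f has_derivative deriv_along f x) (at x)"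
  by (simp add: frechet_derivative_works)

lemma deriv_along_eqI: "(f has_derivative D) (at x) \<Longrightarrow> deriv_along f x = D"
  using frechet_derivative_at by metis

lemma Ck_on_subset: "Ck_on k S f \<Longrightarrow> T \<subseteq> S \<Longrightarrow> Ck_on k T f"
  by (induction k arbitrary: f) (auto intro: continuous_on_subset)

lemma Ck_on_cong:
  assumes "open S" "\<And>x. x \<in> S \<Longrightarrow> f x = g x" "Ck_on k S f"
  shows "Ck_on k S g"
  using assms(2,3)
proof (induction k arbitrary: f g)
  case 0
  then show ?case using continuous_on_cong[of S S f g] by simp
next
  case (Suc k)
  have "Ck_on k S (\<lambda>x. deriv_along g x v)" for v
  proof (rule Suc.IH)
    show "Ck_on k S (\<lambda>x. deriv_along f x v)" using Suc.prems by simp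
    show "deriv_along f x v = deriv_along g x v" if "x \<in> S" for x
      using frechet_derivative_cong_open[OF assms(1) that, of f g] Suc.prems by simp
  qed
  moreover have "g differentiable at x" if "x \<in> S" for x
    using differentiable_cong_open[OF assms(1) that, of f g] Suc.prems that by simp
  ultimately show ?case by simp
qed

lemma Ck_on_imp_differentiable: "Ck_on (Suc k) S f \<Longrightarrow> x \<in> S \<Longrightarrow> f differentiable at x"
  by simp

lemma Ck_on_Suc_imp: "Ck_on (Suc k) S f \<Longrightarrow> Ck_on k S f"
proof (induction k arbitrary: f)
  case 0
  then show ?case
    by (auto intro!: continuous_at_imp_continuous_on differentiable_imp_continuous_within)
next
  case (Suc k)
  then show ?case using Ck_on.simps(2) by blast
qed

lemma Ck_on_const: "Ck_on k S (\<lambda>x. a)"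
  by (induction k arbitrary: a) auto

text \<open>Replaces the chosen derivative in the recursion by an explicit candidate
  \<open>D\<close>; the closure properties below run their induction steps through it.\<close>

lemma Ck_on_SucI:
  assumes "open S" "\<And>x. x \<in> S \<Longrightarrow> (f has_derivative D x) (at x)" "\<And>v. Ck_on k S (\<lambda>x. D x v)"
  shows "Ck_on (Suc k) S f"
proof -
  have "Ck_on k S (\<lambda>x. deriv_along f x v)" for v
    using assms deriv_along_eqI by (intro Ck_on_cong[OF assms(1) _ assms(3)]) fastforce
  then show ?thesis using assms(2) by (auto simp: differentiable_def)
qed

lemma Ck_on_SucD: "Ck_on (Suc k) S f \<Longrightarrow> x \<in> S \<Longrightarrow> (f has_derivative deriv_along f x) (at x)"
  by (simp add: frechet_derivative_works)

lemma Ck_on_bounded_linear: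
  assumes "open S" "bounded_linear h" "Ck_on k S f"
  shows "Ck_on k S (\<lambda>x. h (f x))"
  using assms(3)
proof (induction k arbitrary: f)
  case 0
  then show ?case using assms(2) by (auto intro: bounded_linear.continuous_on)
next
  case (Suc k)
  show ?case
  proof (rule Ck_on_SucI[OF assms(1), where D="\<lambda>x v. h (deriv_along f x v)"])
    show "((\<lambda>x. h (f x)) has_derivative (\<lambda>v. h (deriv_along f x v))) (at x)" if "x \<in> S" for x
      by (rule bounded_linear.has_derivative[OF assms(2) Ck_on_SucD[OF Suc.prems that]])
    show "Ck_on k S (\<lambda>x. h (deriv_along f x v))" for v
      using Suc by simp
  qed
qed

lemma Ck_on_add:
  assumes "open S" "Ck_on k S f" "Ck_on k S g"
  shows "Ck_on k S (\<lambda>x. f x + g x)"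
  using assms(2,3)
proof (induction k arbitrary: f g)
  case 0
  then show ?case by (auto intro: continuous_on_add)
next
  case (Suc k)
  show ?case
  proof (rule Ck_on_SucI[OF assms(1), where D="\<lambda>x v. deriv_along f x v + deriv_along g x v"])
    show "((\<lambda>x. f x + g x) has_derivative (\<lambda>v. deriv_along f x v + deriv_along g x v)) (at x)"
      if "x \<in> S" for x
      by (rule has_derivative_add[OF Ck_on_SucD[OF Suc.prems(1) that] Ck_on_SucD[OF Suc.prems(2) that]])
    show "Ck_on k S (\<lambda>x. deriv_along f x v + deriv_along g x v)" for v
      using Suc by simp
  qed
qed

lemma Ck_on_bounded_bilinear:
  assumes "open S" "bounded_bilinear h" "Ck_on k S f" "Ck_on k S g"
  shows "Ck_on k S (\<lambda>x. h (f x) (g x))"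
  using assms(3,4)
proof (induction k arbitrary: f g)
  case 0
  then show ?case using assms(2) by (auto intro: bounded_bilinear.continuous_on)
next
  case (Suc k)
  note H = Suc.IH Ck_on_Suc_imp[OF Suc.prems(1)] Ck_on_Suc_imp[OF Suc.prems(2)]
  show ?case
  proof (rule Ck_on_SucI[OF assms(1),
        where D="\<lambda>x v. h (f x) (deriv_along g x v) + h (deriv_along f x v) (g x)"])
    show "((\<lambda>x. h (f x) (g x)) has_derivative
        (\<lambda>v. h (f x) (deriv_along g x v) + h (deriv_along f x v) (g x))) (at x)" if "x \<in> S" for x
      by (rule bounded_bilinear.FDERIV[OF assms(2) Ck_on_SucD[OF Suc.prems(1) that]
            Ck_on_SucD[OF Suc.prems(2) that]])
    show "Ck_on k S (\<lambda>x. h (f x) (deriv_along g x v) + h (deriv_along f x v) (g x))" for v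
      using Suc.prems H by (intro Ck_on_add[OF assms(1)]) auto
  qed
qed

lemma Ck_on_sum:
  assumes "open S" "\<And>i. i \<in> I \<Longrightarrow> Ck_on k S (f i)"
  shows "Ck_on k S (\<lambda>x. \<Sum>i\<in>I. f i x)"
  using assms(2)
  by (induction I rule: infinite_finite_induct) (auto intro!: Ck_on_const Ck_on_add[OF assms(1)])

text \<open>\<open>Ck_on\<close> only sees derivatives along fixed vectors, whereas the chain rule
  evaluates the derivative of \<open>g\<close> at a varying one. Expanding over a basis of the
  middle space turns it into products of coordinates of the derivative of \<open>f\<close> with
  composites of directional derivatives of \<open>g\<close>, to which the induction hypothesis
  applies.\<close>

lemma Ck_on_compose:
  fixes f :: "'e::real_normed_vector \<Rightarrow> 'b::euclidean_space"
    and g :: "'b \<Rightarrow> 'c::real_normed_vector"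
  assumes "open S" "open T" "Ck_on k S f" "Ck_on k T g" "f ` S \<subseteq> T"
  shows "Ck_on k S (\<lambda>x. g (f x))"
  using assms(3,4)
proof (induction k arbitrary: g)
  case 0
  then show ?case using assms(5) continuous_on_compose2[of T g S f] by simp
next
  case (Suc k)
  show ?case
  proof (rule Ck_on_SucI[OF assms(1)])
    show "((\<lambda>x. g (f x)) has_derivative
       (\<lambda>v. \<Sum>b\<in>Basis. (deriv_along f x v \<bullet> b) *\<^sub>R deriv_along g (f x) b)) (at x)" if "x \<in> S" for x
    proof -
      have g: "(g has_derivative deriv_along g (f x)) (at (f x))"
        using Suc.prems(2) that assms(5) by (intro Ck_on_SucD) auto
      have f: "(f has_derivative deriv_along f x) (at x)"
        using Suc.prems(1) that by (intro Ck_on_SucD)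
      have lin: "linear (deriv_along g (f x))" using g has_derivative_linear by blast
      have "deriv_along g (f x) w = (\<Sum>b\<in>Basis. (w \<bullet> b) *\<^sub>R deriv_along g (f x) b)" for w
      proof -
        have "deriv_along g (f x) w = deriv_along g (f x) (\<Sum>b\<in>Basis. (w \<bullet> b) *\<^sub>R b)"
          by (simp only: euclidean_representation)
        then show ?thesis by (simp only: linear_sum[OF lin] linear_scale[OF lin])
      qed
      then show ?thesis
        by (intro has_derivative_eq_rhs[OF has_derivative_compose[OF f g]] ext)
    qed
    show "Ck_on k S (\<lambda>x. \<Sum>b\<in>Basis. (deriv_along f x v \<bullet> b) *\<^sub>R deriv_along g (f x) b)" for v
    proof (intro Ck_on_sum[OF assms(1)] Ck_on_bounded_bilinear[OF assms(1) bounded_bilinear_scaleR])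
      show "Ck_on k S (\<lambda>x. deriv_along f x v \<bullet> b)" for b
        using Suc.prems(1) by (intro Ck_on_bounded_linear[OF assms(1) bounded_linear_inner_left]) simp
      show "Ck_on k S (\<lambda>x. deriv_along g (f x) b)" for b
        using Suc.prems Ck_on_Suc_imp by (intro Suc.IH) auto
    qed
  qed
qed

text \<open>The derivative is a polynomial in \<open>inverse\<close> itself, so the induction
  closes.\<close>

lemma Ck_on_inverse: "Ck_on k {x::real. x \<noteq> 0} inverse"
proof (induction k)
  case 0
  then show ?case by (auto intro!: continuous_intros)
next
  case (Suc k)
  have o: "open {x::real. x \<noteq> 0}" by (simp add: open_Collect_neq)
  show ?case
    by (rule Ck_on_SucI[OF o, where D="\<lambda>x v. - v * (inverse x * inverse x)"])
      (rule has_derivative_eq_rhs[OF has_derivative_inverse'], simp, simp add: fun_eq_iff,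
        intro Ck_on_bounded_bilinear[OF o bounded_bilinear_mult] Ck_on_const Suc)
qed

lemma Ck_on_powr: "Ck_on k {0<..} (\<lambda>x::real. x powr a)"
\<comment> \<open>The exponent is generalised because differentiation lowers it by one.\<close>
proof (induction k arbitrary: a)
  case 0
  then show ?case by (auto intro!: continuous_intros)
next
  case (Suc k)
  have o: "open {0::real<..}" by simp
  show ?case
  proof (rule Ck_on_SucI[OF o, where D="\<lambda>x v. v * (a * x powr (a - 1))"])
    fix x :: real assume "x \<in> {0<..}"
    then have "((\<lambda>x. x powr a) has_real_derivative a * x powr (a - 1)) (at x)"
      by (intro has_real_derivative_powr) auto
    then show "((\<lambda>x. x powr a) has_derivative (\<lambda>v. v * (a * x powr (a - 1)))) (at x)"
      by (simp only: has_field_derivative_def mult.commute[of _ "a * x powr (a - 1)"])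
  qed (intro Ck_on_bounded_bilinear[OF o bounded_bilinear_mult] Ck_on_const Suc)
qed

lemma smooth_on_imp_differentiable: "smooth_on S f \<Longrightarrow> x \<in> S \<Longrightarrow> f differentiable at x"
  unfolding smooth_on_def by (meson Ck_on_imp_differentiable)

lemma smooth_on_has_derivative:
  "smooth_on S f \<Longrightarrow> x \<in> S \<Longrightarrow> (f has_derivative deriv_along f x) (at x)"
  by (simp add: smooth_on_imp_differentiable has_derivative_deriv_along)

lemma smooth_on_deriv_along: "smooth_on S f \<Longrightarrow> smooth_on S (\<lambda>x. deriv_along f x v)"
  unfolding smooth_on_def using Ck_on.simps(2) by blast

lemma smooth_on_imp_continuous_on: "smooth_on S f \<Longrightarrow> continuous_on S f"
  unfolding smooth_on_def by (metis Ck_on.simps(1))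

lemma smooth_on_subset: "smooth_on S f \<Longrightarrow> T \<subseteq> S \<Longrightarrow> smooth_on T f"
  unfolding smooth_on_def by (meson Ck_on_subset)

lemma smooth_on_cong:
  "smooth_on S f \<Longrightarrow> open S \<Longrightarrow> (\<And>x. x \<in> S \<Longrightarrow> f x = g x) \<Longrightarrow> smooth_on S g"
  unfolding smooth_on_def by (meson Ck_on_cong)

lemma smooth_on_const: "smooth_on S (\<lambda>x. a)"
  unfolding smooth_on_def by (simp add: Ck_on_const)

lemma smooth_on_bounded_linear:
  "smooth_on S f \<Longrightarrow> open S \<Longrightarrow> bounded_linear h \<Longrightarrow> smooth_on S (\<lambda>x. h (f x))"
  unfolding smooth_on_def by (simp add: Ck_on_bounded_linear)

lemma smooth_on_bounded_linear_id:
  assumes "bounded_linear h" shows "smooth_on S h"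
  unfolding smooth_on_def
proof
  fix k show "Ck_on k S h"
  proof (cases k)
    case 0 then show ?thesis using assms by (simp add: linear_continuous_on)
  next
    case (Suc k)
    have "deriv_along h x = h" for x
      using assms by (intro deriv_along_eqI bounded_linear_imp_has_derivative)
    then show ?thesis using assms Suc Ck_on_const
      by (auto simp: bounded_linear_imp_differentiable)
  qed
qed

lemma smooth_on_add:
  "smooth_on S f \<Longrightarrow> smooth_on S g \<Longrightarrow> open S \<Longrightarrow> smooth_on S (\<lambda>x. f x + g x)"
  unfolding smooth_on_def by (simp add: Ck_on_add)

lemma smooth_on_bounded_bilinear:
  "smooth_on S f \<Longrightarrow> smooth_on S g \<Longrightarrow> open S \<Longrightarrow> bounded_bilinear h
    \<Longrightarrow> smooth_on S (\<lambda>x. h (f x) (g x))"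
  unfolding smooth_on_def by (simp add: Ck_on_bounded_bilinear)

lemmas smooth_on_mult = smooth_on_bounded_bilinear[OF _ _ _ bounded_bilinear_mult]
lemmas smooth_on_scaleR = smooth_on_bounded_bilinear[OF _ _ _ bounded_bilinear_scaleR]

lemma smooth_on_sum:
  "(\<And>i. i \<in> I \<Longrightarrow> smooth_on S (f i)) \<Longrightarrow> open S \<Longrightarrow> smooth_on S (\<lambda>x. \<Sum>i\<in>I. f i x)"
  unfolding smooth_on_def by (simp add: Ck_on_sum)

lemma smooth_on_minus: "smooth_on S f \<Longrightarrow> open S \<Longrightarrow> smooth_on S (\<lambda>x. - f x)"
  by (rule smooth_on_bounded_linear[of S f uminus]) (auto simp: bounded_linear_minus bounded_linear_ident)

lemma smooth_on_diff:
  "smooth_on S f \<Longrightarrow> smooth_on S g \<Longrightarrow> open S \<Longrightarrow> smooth_on S (\<lambda>x. f x - g x)"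
  using smooth_on_add[of S f "\<lambda>x. - g x"] smooth_on_minus[of S g] by simp

lemma smooth_on_prod:
  fixes f :: "'i \<Rightarrow> 'e::real_normed_vector \<Rightarrow> real"
  assumes "\<And>i. i \<in> I \<Longrightarrow> smooth_on S (f i)" "open S"
  shows "smooth_on S (\<lambda>x. \<Prod>i\<in>I. f i x)"
  using assms
  by (induction I rule: infinite_finite_induct) (auto intro: smooth_on_const smooth_on_mult)

lemma smooth_on_compose:
  fixes f :: "'e::real_normed_vector \<Rightarrow> 'b::euclidean_space"
    and g :: "'b \<Rightarrow> 'c::real_normed_vector"
  shows "smooth_on T g \<Longrightarrow> smooth_on S f \<Longrightarrow> open S \<Longrightarrow> open T \<Longrightarrow> (\<And>x. x \<in> S \<Longrightarrow> f x \<in> T)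
    \<Longrightarrow> smooth_on S (\<lambda>x. g (f x))"
  unfolding smooth_on_def by (simp add: Ck_on_compose image_subset_iff)

lemma smooth_on_inverse:
  assumes "smooth_on S f" "open S" "\<And>x. x \<in> S \<Longrightarrow> f x \<noteq> (0::real)"
  shows "smooth_on S (\<lambda>x. inverse (f x))"
  by (rule smooth_on_compose[of "{x. x \<noteq> 0}" inverse])
    (use assms Ck_on_inverse in \<open>auto simp: smooth_on_def open_Collect_neq\<close>)

lemma smooth_on_divide:
  assumes "smooth_on S g" "smooth_on S f" "open S" "\<And>x. x \<in> S \<Longrightarrow> f x \<noteq> (0::real)"
  shows "smooth_on S (\<lambda>x. g x / f x)"
  unfolding divide_inverse using assms by (intro smooth_on_mult smooth_on_inverse)

lemma smooth_on_powr:
  assumes "smooth_on S f" "open S" "\<And>x. x \<in> S \<Longrightarrow> f x > (0::real)"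
  shows "smooth_on S (\<lambda>x. f x powr a)"
  by (rule smooth_on_compose[of "{0<..}" "\<lambda>x. x powr a"])
    (use assms Ck_on_powr in \<open>auto simp: smooth_on_def\<close>)

text \<open>Trades the absolute value in the transformation law of densities for a square, which is
  visibly smooth and can be differentiated.\<close>

lemma abs_powr_eq_square_powr: "\<bar>d\<bar> powr a = (d * d) powr (a / 2)" for d :: real
proof (cases "d = 0")
  case False
  then have "ln (d * d) = ln \<bar>d\<bar> + ln \<bar>d\<bar>" using ln_mult[of "\<bar>d\<bar>" "\<bar>d\<bar>"] by simp
  then show ?thesis using False by (simp add: powr_def)
qed simp

lemma smooth_on_abs_powr:
  assumes "smooth_on S f" "open S" "\<And>x. x \<in> S \<Longrightarrow> f x \<noteq> (0::real)"
  shows "smooth_on S (\<lambda>x. \<bar>f x\<bar> powr a)"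
  unfolding abs_powr_eq_square_powr
  by (intro smooth_on_powr smooth_on_mult assms) (metis assms(3) not_square_less_zero linorder_neqE_linordered_idom mult_eq_0_iff)

lemma smooth_on_det:
  fixes A :: "'e::real_normed_vector \<Rightarrow> real ^ 'm ^ 'm"
  assumes "\<And>p q. smooth_on S (\<lambda>x. A x $ p $ q)" "open S"
  shows "smooth_on S (\<lambda>x. det (A x))"
  unfolding det_def by (intro smooth_on_sum smooth_on_mult smooth_on_const smooth_on_prod assms)

lemma smooth_on_vec_lambda:
  fixes f :: "'e::real_normed_vector \<Rightarrow> real ^ 'm"
  assumes "\<And>p. smooth_on S (\<lambda>x. f x $ p)" "open S"
  shows "smooth_on S f"
proof -
  have "f = (\<lambda>x. \<Sum>p\<in>UNIV. (f x $ p) *\<^sub>R axis p 1)"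
    by (simp add: fun_eq_iff vec_eq_iff axis_def if_distrib cong: if_cong)
  then show ?thesis using assms
    by (subst \<open>f = _\<close>) (intro smooth_on_sum smooth_on_scaleR smooth_on_const assms)
qed

lemma smooth_on_vec_nth: "smooth_on S f \<Longrightarrow> open S \<Longrightarrow> smooth_on S (\<lambda>x. f x $ p)"
  for f :: "'e::real_normed_vector \<Rightarrow> real ^ 'm"
  by (rule smooth_on_bounded_linear[of _ _ "\<lambda>v. v $ p"]) (auto simp: bounded_linear_vec_nth)

lemma matrix_inv_works:
  fixes A :: "real ^ 'm ^ 'm"
  assumes "det A \<noteq> 0"
  shows "A ** matrix_inv A = mat 1" "matrix_inv A ** A = mat 1"
proof -
  have "\<exists>B. A ** B = mat 1 \<and> B ** A = mat 1"
    using assms by (simp add: invertible_def[symmetric] invertible_det_nz)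
  then have "A ** matrix_inv A = mat 1 \<and> matrix_inv A ** A = mat 1"
    unfolding matrix_inv_def by (rule someI_ex)
  then show "A ** matrix_inv A = mat 1" "matrix_inv A ** A = mat 1" by auto
qed

text \<open>Shows the entries of the inverse as quotients of determinants, from which their smooth
  dependence on the matrix is read off.\<close>

lemma matrix_inv_cramer:
  fixes A :: "real ^ 'm ^ 'm"
  assumes "det A \<noteq> 0"
  shows "matrix_inv A $ r $ s = det (\<chi> i j. if j = r then axis s 1 $ i else A $ i $ j) / det A"
proof -
  have "A *v (matrix_inv A *v axis s 1) = axis s 1"
    using assms by (simp add: matrix_vector_mul_assoc matrix_inv_works)
  then have "matrix_inv A *v axis s 1 = (\<chi> k. det (\<chi> i j. if j=k then axis s 1 $ i else A $ i $ j) / det A)"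
    using cramer[OF assms] by blast
  then show ?thesis
    by (simp add: vec_eq_iff matrix_vector_mult_basis column_def)
qed

lemma smooth_on_matrix_inv:
  fixes A :: "'e::real_normed_vector \<Rightarrow> real ^ 'm ^ 'm"
  assumes "\<And>p q. smooth_on S (\<lambda>x. A x $ p $ q)" "open S" "\<And>x. x \<in> S \<Longrightarrow> det (A x) \<noteq> 0"
  shows "smooth_on S (\<lambda>x. matrix_inv (A x) $ r $ s)"
proof (rule smooth_on_cong[OF _ assms(2) matrix_inv_cramer[symmetric]])
  show "smooth_on S (\<lambda>x. det (\<chi> i j. if j = r then axis s 1 $ i else A x $ i $ j) / det (A x))"
  proof (intro smooth_on_divide smooth_on_det assms)
    show "smooth_on S (\<lambda>x. (\<chi> i j. if j = r then axis s 1 $ i else A x $ i $ j) $ p $ q)" for p q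
      by (cases "q = r") (auto intro: smooth_on_const assms)
  qed auto
qed (rule assms(3))

section \<open>Symmetry of second derivatives\<close>

lemma has_real_derivative_along_line:
  fixes f :: "'e::real_normed_vector \<Rightarrow> real"
  assumes "f differentiable at (p + s *\<^sub>R u)"
  shows "((\<lambda>s. f (p + s *\<^sub>R u)) has_real_derivative deriv_along f (p + s *\<^sub>R u) u) (at s)"
proof -
  have l: "((\<lambda>s. p + s *\<^sub>R u) has_derivative (\<lambda>t. t *\<^sub>R u)) (at s)"
    by (auto intro!: derivative_eq_intros)
  have f: "(f has_derivative deriv_along f (p + s *\<^sub>R u)) (at (p + s *\<^sub>R u))"
    using assms by (rule has_derivative_deriv_along)
  have "deriv_along f (p + s *\<^sub>R u) (t *\<^sub>R u) = deriv_along f (p + s *\<^sub>R u) u * t" for t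
    using linear_scale[OF has_derivative_linear[OF f]] by (simp add: mult.commute)
  then show ?thesis using has_derivative_compose[OF l f] by (simp add: has_field_derivative_def)
qed

text \<open>Schwarz's argument: the mean value theorem in direction \<open>u\<close>, then in
  direction \<open>v\<close>, turns the second difference into h^2 times the mixed derivative at a
  nearby point, and the mixed derivative is continuous.\<close>

lemma second_difference_estimate:
  fixes f :: "'e::real_normed_vector \<Rightarrow> real"
  assumes "open S" "smooth_on S f" "x \<in> S" "e > 0"
  shows "\<exists>d>0. \<forall>h. 0 < h \<and> h < d \<longrightarrow>
    \<bar>(f (x + h *\<^sub>R u + h *\<^sub>R v) - f (x + h *\<^sub>R u) - (f (x + h *\<^sub>R v) - f x))
      - h * h * deriv_along (\<lambda>z. deriv_along f z u) x v\<bar> \<le> e * (h * h)"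
proof -
  define F where "F = (\<lambda>z. deriv_along (\<lambda>z. deriv_along f z u) z v)"
  have s1: "smooth_on S (\<lambda>z. deriv_along f z u)" using assms(2) by (rule smooth_on_deriv_along)
  have "continuous_on S F"
    unfolding F_def by (intro smooth_on_imp_continuous_on smooth_on_deriv_along assms)
  then have "isCont F x" using assms continuous_on_eq_continuous_at by blast
  then obtain r1 where r1: "r1 > 0" "\<And>z. dist z x < r1 \<Longrightarrow> \<bar>F z - F x\<bar> < e"
    using assms(4) unfolding continuous_at_eps_delta by (metis dist_real_def)
  obtain r2 where r2: "r2 > 0" "ball x r2 \<subseteq> S" using assms openE by blast
  define r where "r = min r1 r2"
  \<comment> \<open>For h < d the whole parallelogram spanned by h u and h v stays in the ball of
    radius \<open>r\<close>. The summand 1 keeps the denominator positive when both vectors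
    vanish.\<close>
  define d where "d = r / (norm u + norm v + 1)"
  have nz: "norm u + norm v + 1 > 0" by (smt (verit) norm_ge_zero)
  have r: "r > 0" using r1 r2 by (simp add: r_def)
  have d: "d > 0" using r nz by (simp add: d_def)
  have B: "dist (x + s *\<^sub>R u + t *\<^sub>R v) x < r" if "0 \<le> s" "s \<le> h" "0 \<le> t" "t \<le> h" "h < d" for s t h
  proof -
    have "dist (x + s *\<^sub>R u + t *\<^sub>R v) x = norm (s *\<^sub>R u + t *\<^sub>R v)" by (simp add: dist_norm)
    also have "\<dots> \<le> s * norm u + t * norm v"
      using norm_triangle_ineq[of "s *\<^sub>R u" "t *\<^sub>R v"] that by simp
    also have "\<dots> \<le> h * norm u + h * norm v" using that by (intro add_mono mult_right_mono) auto
    also have "\<dots> \<le> h * (norm u + norm v + 1)" using that by (simp add: algebra_simps)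
    also have "\<dots> < d * (norm u + norm v + 1)" using that nz by simp
    also have "\<dots> = r" using nz by (simp add: d_def)
    finally show ?thesis .
  qed
  have BS: "x + s *\<^sub>R u + t *\<^sub>R v \<in> S" if "0 \<le> s" "s \<le> h" "0 \<le> t" "t \<le> h" "h < d" for s t h
    using B[OF that] r2(2) by (auto simp: r_def dist_commute)
  have "\<bar>(f (x + h *\<^sub>R u + h *\<^sub>R v) - f (x + h *\<^sub>R u) - (f (x + h *\<^sub>R v) - f x)) - h * h * F x\<bar> \<le> e * (h * h)"
    if h: "0 < h" "h < d" for h
  proof -
    \<comment> \<open>The second difference is the increment of \<phi> over [0, h]; the derivative
      of \<phi> is in turn the increment of a first derivative in direction
      \<open>v\<close>.\<close>
    define \<phi> where "\<phi> = (\<lambda>s. f (x + h *\<^sub>R v + s *\<^sub>R u) - f (x + s *\<^sub>R u))"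
    have "(\<phi> has_real_derivative
        (deriv_along f (x + h *\<^sub>R v + s *\<^sub>R u) u - deriv_along f (x + s *\<^sub>R u) u)) (at s)"
      if "0 \<le> s" "s \<le> h" for s
      unfolding \<phi>_def
    proof (intro DERIV_diff has_real_derivative_along_line smooth_on_imp_differentiable[OF assms(2)])
      show "x + h *\<^sub>R v + s *\<^sub>R u \<in> S" using BS[of s h h] that h by (simp add: algebra_simps)
      show "x + s *\<^sub>R u \<in> S" using BS[of s h 0] that h by simp
    qed
    from MVT2[OF h(1) this] obtain s where s: "0 < s" "s < h" "\<phi> h - \<phi> 0
        = (h - 0) * (deriv_along f (x + h *\<^sub>R v + s *\<^sub>R u) u - deriv_along f (x + s *\<^sub>R u) u)"
      by blast
    define \<psi> where "\<psi> = (\<lambda>t. deriv_along f (x + s *\<^sub>R u + t *\<^sub>R v) u)"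
    have "(\<psi> has_real_derivative F (x + s *\<^sub>R u + t *\<^sub>R v)) (at t)"
      if "0 \<le> t" "t \<le> h" for t
      unfolding \<psi>_def F_def
      using BS[of s h t] that s h
      by (intro has_real_derivative_along_line smooth_on_imp_differentiable[OF s1]) auto
    from MVT2[OF h(1) this] obtain t where t: "0 < t" "t < h"
      "\<psi> h - \<psi> 0 = (h - 0) * F (x + s *\<^sub>R u + t *\<^sub>R v)" by blast
    have "\<phi> h - \<phi> 0 = h * (h * F (x + s *\<^sub>R u + t *\<^sub>R v))"
      using s(3) t(3) by (simp add: \<psi>_def add.commute add.left_commute)
    then have "f (x + h *\<^sub>R u + h *\<^sub>R v) - f (x + h *\<^sub>R u) - (f (x + h *\<^sub>R v) - f x)
        = h * (h * F (x + s *\<^sub>R u + t *\<^sub>R v))"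
      by (simp add: \<phi>_def add.commute add.left_commute)
    moreover have "\<bar>F (x + s *\<^sub>R u + t *\<^sub>R v) - F x\<bar> < e"
      using B[of s h t] s t h by (intro r1) (auto simp: r_def)
    moreover have "h * (h * F (x + s *\<^sub>R u + t *\<^sub>R v)) - h * h * F x
        = (h * h) * (F (x + s *\<^sub>R u + t *\<^sub>R v) - F x)" by (simp add: algebra_simps)
    moreover have "\<bar>(h * h) * D\<bar> \<le> e * (h * h)" if "\<bar>D\<bar> < e" for D
      using mult_left_mono[of "\<bar>D\<bar>" e "h * h"] that by (simp add: abs_mult mult.commute)
    ultimately show ?thesis by presburger
  qed
  then show ?thesis using d unfolding F_def by blast
qed

text \<open>The second difference is symmetric in \<open>u\<close> and \<open>v\<close>, so one and
  the same number approximates both mixed derivatives.\<close>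

lemma deriv_along_commute_real:
  fixes f :: "'e::real_normed_vector \<Rightarrow> real"
  assumes "open S" "smooth_on S f" "x \<in> S"
  shows "deriv_along (\<lambda>z. deriv_along f z u) x v = deriv_along (\<lambda>z. deriv_along f z v) x u"
    (is "?A = ?B")
proof (rule ccontr)
  assume ne: "?A \<noteq> ?B"
  \<comment> \<open>A quarter of the gap: two errors of relative size \<open>e\<close> would have to
    add up to 4 e.\<close>
  define e where "e = \<bar>?A - ?B\<bar> / 4"
  have e: "e > 0" using ne by (simp add: e_def)
  obtain d1 where d1: "d1 > 0" "\<And>h. 0 < h \<Longrightarrow> h < d1 \<Longrightarrow>
    \<bar>(f (x + h *\<^sub>R u + h *\<^sub>R v) - f (x + h *\<^sub>R u) - (f (x + h *\<^sub>R v) - f x)) - h * h * ?A\<bar> \<le> e * (h * h)"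
    using second_difference_estimate[OF assms e, of u v] by blast
  obtain d2 where d2: "d2 > 0" "\<And>h. 0 < h \<Longrightarrow> h < d2 \<Longrightarrow>
    \<bar>(f (x + h *\<^sub>R v + h *\<^sub>R u) - f (x + h *\<^sub>R v) - (f (x + h *\<^sub>R u) - f x)) - h * h * ?B\<bar> \<le> e * (h * h)"
    using second_difference_estimate[OF assms e, of v u] by blast
  define h where "h = min d1 d2 / 2"
  have h: "0 < h" "h < d1" "h < d2" using d1 d2 by (auto simp: h_def)
  define a where "a = f (x + h *\<^sub>R u + h *\<^sub>R v) - f (x + h *\<^sub>R u) - (f (x + h *\<^sub>R v) - f x)"
  have "f (x + h *\<^sub>R v + h *\<^sub>R u) - f (x + h *\<^sub>R v) - (f (x + h *\<^sub>R u) - f x) = a"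
    by (simp add: a_def algebra_simps)
  then have "\<bar>a - h * h * ?A\<bar> \<le> e * (h * h)" "\<bar>a - h * h * ?B\<bar> \<le> e * (h * h)"
    using d1(2)[OF h(1,2)] d2(2)[OF h(1,3)] by (simp_all only: a_def)
  then have "\<bar>h * h * ?A - h * h * ?B\<bar> \<le> 2 * (e * (h * h))" by linarith
  moreover have "\<bar>h * h * ?A - h * h * ?B\<bar> = (h * h) * \<bar>?A - ?B\<bar>"
    unfolding right_diff_distrib[symmetric] by (simp add: abs_mult)
  moreover have "\<bar>?A - ?B\<bar> = 4 * e" by (simp add: e_def)
  ultimately have "(h * h) * (4 * e) \<le> 2 * (e * (h * h))" by metis
  moreover have "h * h * e > 0" using h e by simp
  ultimately show False by (simp add: mult_ac)
qed

lemma deriv_along_bounded_linear: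
  assumes "bounded_linear h" "f differentiable at x"
  shows "deriv_along (\<lambda>z. h (f z)) x v = h (deriv_along f x v)"
  using deriv_along_eqI[OF bounded_linear.has_derivative[OF assms(1) has_derivative_deriv_along[OF assms(2)]]]
  by simp

lemma deriv_along_commute:
  fixes f :: "'e::real_normed_vector \<Rightarrow> 'b::euclidean_space"
  assumes "open S" "smooth_on S f" "x \<in> S"
  shows "deriv_along (\<lambda>z. deriv_along f z u) x v = deriv_along (\<lambda>z. deriv_along f z v) x u"
proof (rule euclidean_eqI)
  fix b :: 'b
  have *: "deriv_along (\<lambda>z. deriv_along f z u) x v \<bullet> b
      = deriv_along (\<lambda>z. deriv_along (\<lambda>z. f z \<bullet> b) z u) x v" for u v
  proof -
    have "deriv_along (\<lambda>z. deriv_along f z u) x v \<bullet> b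
        = deriv_along (\<lambda>z. deriv_along f z u \<bullet> b) x v"
      using assms by (intro deriv_along_bounded_linear[symmetric] bounded_linear_inner_left
          smooth_on_imp_differentiable[OF smooth_on_deriv_along])
    also have "deriv_along (\<lambda>z. deriv_along f z u \<bullet> b) x
        = deriv_along (\<lambda>z. deriv_along (\<lambda>z. f z \<bullet> b) z u) x"
      by (rule frechet_derivative_cong_open[OF assms(1,3)],
          rule deriv_along_bounded_linear[OF bounded_linear_inner_left, symmetric],
          rule smooth_on_imp_differentiable[OF assms(2)])
    finally show ?thesis .
  qed
  show "deriv_along (\<lambda>z. deriv_along f z u) x v \<bullet> b = deriv_along (\<lambda>z. deriv_along f z v) x u \<bullet> b"
    unfolding *
    by (rule deriv_along_commute_real[OF assms(1) _ assms(3)],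
        rule smooth_on_bounded_linear[OF assms(2,1) bounded_linear_inner_left])
qed

lemma linear_deriv_along: "f differentiable at x \<Longrightarrow> linear (deriv_along f x)"
  by (rule linear_frechet_derivative)

section \<open>Families of linear and bilinear maps\<close>

lemma linear_expand_Basis:
  fixes L :: "'a::euclidean_space \<Rightarrow> 'c::real_vector"
  assumes "linear L" shows "L v = (\<Sum>b\<in>Basis. (v \<bullet> b) *\<^sub>R L b)"
proof -
  have "L v = L (\<Sum>b\<in>Basis. (v \<bullet> b) *\<^sub>R b)" by (simp only: euclidean_representation)
  then show ?thesis by (simp only: linear_sum[OF assms] linear_scale[OF assms])
qed

text \<open>Smoothness of tensors is only given for fixed arguments; linearity extends it to
  arguments that vary with the point.\<close>

lemma smooth_on_linear_family:
  fixes L :: "'e::real_normed_vector \<Rightarrow> 'a::euclidean_space \<Rightarrow> 'c::real_normed_vector"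
  assumes "open S" "\<And>z. z \<in> S \<Longrightarrow> linear (L z)" "\<And>u. smooth_on S (\<lambda>z. L z u)" "smooth_on S X"
  shows "smooth_on S (\<lambda>z. L z (X z))"
proof (rule smooth_on_cong[OF _ assms(1) linear_expand_Basis[OF assms(2), symmetric]])
  show "smooth_on S (\<lambda>z. \<Sum>b\<in>Basis. (X z \<bullet> b) *\<^sub>R L z b)"
    by (intro smooth_on_sum smooth_on_scaleR assms smooth_on_bounded_linear[OF assms(4,1) bounded_linear_inner_left])
qed

lemma linear_deriv_along_param:
  fixes L :: "'e::real_normed_vector \<Rightarrow> 'a::euclidean_space \<Rightarrow> 'c::real_normed_vector"
  assumes "open S" "x \<in> S" "\<And>z. z \<in> S \<Longrightarrow> linear (L z)" "\<And>u. (\<lambda>z. L z u) differentiable at x"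
  shows "linear (\<lambda>u. deriv_along (\<lambda>z. L z u) x w)"
proof
  fix u v
  have "deriv_along (\<lambda>z. L z (u + v)) x = deriv_along (\<lambda>z. L z u + L z v) x"
    using assms by (intro frechet_derivative_cong_open[of S]) (auto simp: linear_add)
  also have "\<dots> = (\<lambda>w. deriv_along (\<lambda>z. L z u) x w + deriv_along (\<lambda>z. L z v) x w)"
    using assms by (intro deriv_along_eqI has_derivative_add has_derivative_deriv_along) auto
  finally show "deriv_along (\<lambda>z. L z (u + v)) x w
      = deriv_along (\<lambda>z. L z u) x w + deriv_along (\<lambda>z. L z v) x w" by simp
next
  fix c :: real and u
  have "deriv_along (\<lambda>z. L z (c *\<^sub>R u)) x = deriv_along (\<lambda>z. c *\<^sub>R L z u) x"
    using assms by (intro frechet_derivative_cong_open[of S]) (auto simp: linear_scale)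
  also have "\<dots> = (\<lambda>w. c *\<^sub>R deriv_along (\<lambda>z. L z u) x w)"
    using assms by (intro deriv_along_eqI has_derivative_scaleR_right has_derivative_deriv_along) auto
  finally show "deriv_along (\<lambda>z. L z (c *\<^sub>R u)) x w = c *\<^sub>R deriv_along (\<lambda>z. L z u) x w" by simp
qed

text \<open>Leibniz rule for a vector field inserted into a tensor; in the first term the argument
  is frozen at \<open>x\<close>.\<close>

lemma has_derivative_linear_family:
  fixes L :: "'e::real_normed_vector \<Rightarrow> 'a::euclidean_space \<Rightarrow> 'c::real_normed_vector"
  assumes "open S" "x \<in> S" "\<And>z. z \<in> S \<Longrightarrow> linear (L z)" "\<And>u. (\<lambda>z. L z u) differentiable at x"
    "(X has_derivative X') (at x)"
  shows "((\<lambda>z. L z (X z)) has_derivative (\<lambda>w. deriv_along (\<lambda>z. L z (X x)) x w + L x (X' w))) (at x)"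
proof -
  have "((\<lambda>z. \<Sum>b\<in>Basis. (X z \<bullet> b) *\<^sub>R L z b) has_derivative
      (\<lambda>w. \<Sum>b\<in>Basis. (X x \<bullet> b) *\<^sub>R deriv_along (\<lambda>z. L z b) x w + (X' w \<bullet> b) *\<^sub>R L x b)) (at x)"
    using assms by (intro has_derivative_sum has_derivative_scaleR has_derivative_deriv_along
        has_derivative_inner_left) auto
  moreover have "(\<Sum>b\<in>Basis. (X x \<bullet> b) *\<^sub>R deriv_along (\<lambda>z. L z b) x w + (X' w \<bullet> b) *\<^sub>R L x b)
      = deriv_along (\<lambda>z. L z (X x)) x w + L x (X' w)" for w
    unfolding sum.distrib
    using linear_expand_Basis[OF linear_deriv_along_param[OF assms(1-4)], of "X x" w]
      linear_expand_Basis[OF assms(3)[OF assms(2)], of "X' w"] by simp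
  ultimately have "((\<lambda>z. \<Sum>b\<in>Basis. (X z \<bullet> b) *\<^sub>R L z b) has_derivative
      (\<lambda>w. deriv_along (\<lambda>z. L z (X x)) x w + L x (X' w))) (at x)" by simp
  then show ?thesis
    using linear_expand_Basis[OF assms(3)]
    by (elim has_derivative_transform_within_open[OF _ assms(1,2)]) metis
qed

lemma has_derivative_bilinear_family:
  fixes B :: "'e::real_normed_vector \<Rightarrow> 'a::euclidean_space \<Rightarrow> 'b::euclidean_space \<Rightarrow> 'c::real_normed_vector"
  assumes "open S" "x \<in> S" "\<And>z. z \<in> S \<Longrightarrow> bilinear (B z)" "\<And>u v. (\<lambda>z. B z u v) differentiable at x"
    "(X has_derivative X') (at x)" "(Y has_derivative Y') (at x)"
  shows "((\<lambda>z. B z (X z) (Y z)) has_derivative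
    (\<lambda>w. deriv_along (\<lambda>z. B z (X x) (Y x)) x w + B x (X' w) (Y x) + B x (X x) (Y' w))) (at x)"
proof -
  have 1: "((\<lambda>z. B z (X z) v) has_derivative
    (\<lambda>w. deriv_along (\<lambda>z. B z (X x) v) x w + B x (X' w) v)) (at x)" for v
    using assms by (intro has_derivative_linear_family[of S x "\<lambda>z u. B z u v"]) (auto simp: bilinear_def)
  have "((\<lambda>z. B z (X z) (Y z)) has_derivative
    (\<lambda>w. deriv_along (\<lambda>z. B z (X z) (Y x)) x w + B x (X x) (Y' w))) (at x)"
    using assms differentiableI[OF 1]
    by (intro has_derivative_linear_family[of S x "\<lambda>z v. B z (X z) v"]) (auto simp: bilinear_def)
  then show ?thesis using deriv_along_eqI[OF 1] by simp
qed

section \<open>Traces and determinants\<close>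

lemma tr_end_eq_sum: "tr_end T = (\<Sum>p\<in>UNIV. T (axis p 1) $ p)"
  by (simp add: tr_end_def trace_def matrix_def)

lemma tr_end_add: "tr_end (\<lambda>w. T w + U w) = tr_end T + tr_end U"
  by (simp add: tr_end_eq_sum sum.distrib)

lemma tr_end_diff: "tr_end (\<lambda>w. T w - U w) = tr_end T - tr_end U"
  by (simp add: tr_end_eq_sum sum_subtractf)

lemma tr_end_scaleR: "tr_end (\<lambda>w. a *\<^sub>R T w) = a * tr_end T"
  by (simp add: tr_end_eq_sum sum_distrib_left)

lemma tr_end_id: "tr_end (\<lambda>w. w :: real ^ 'm) = real CARD('m)"
  by (simp add: tr_end_eq_sum axis_def)

lemma linear_expand_axis:
  fixes L :: "real ^ 'm \<Rightarrow> 'c::real_vector"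
  assumes "linear L" shows "L v = (\<Sum>p\<in>UNIV. (v $ p) *\<^sub>R L (axis p 1))"
proof -
  have "L v = L (\<Sum>p\<in>UNIV. (v $ p) *\<^sub>R axis p 1)"
    using basis_expansion[of v] by (simp add: scalar_mult_eq_scaleR)
  then show ?thesis by (simp only: linear_sum[OF assms] linear_scale[OF assms])
qed

lemma tr_end_rank_one:
  assumes "linear \<phi>" shows "tr_end (\<lambda>w. \<phi> w *\<^sub>R z) = \<phi> z"
  using linear_expand_axis[OF assms, of z] by (simp add: tr_end_eq_sum mult.commute)

lemma tr_end_commute:
  fixes T :: "real ^ 'm \<Rightarrow> real ^ 'p" and U :: "real ^ 'p \<Rightarrow> real ^ 'm"
  assumes "linear T" "linear U" shows "tr_end (\<lambda>w. T (U w)) = tr_end (\<lambda>w. U (T w))"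
proof -
  have "tr_end (\<lambda>w. T (U w)) = trace (matrix T ** matrix U)"
    using matrix_compose[OF assms(2,1)] by (simp add: tr_end_def o_def)
  also have "\<dots> = trace (matrix U ** matrix T)" by (rule trace_mul_sym)
  also have "\<dots> = tr_end (\<lambda>w. U (T w))"
    using matrix_compose[OF assms] by (simp add: tr_end_def o_def)
  finally show ?thesis .
qed

lemma tr_end_cong: "(\<And>w. T w = U w) \<Longrightarrow> tr_end T = tr_end U"
  by (simp add: tr_end_eq_sum)

lemma smooth_on_tr_end:
  assumes "\<And>w. smooth_on S (\<lambda>x. T x w)" "open S"
  shows "smooth_on S (\<lambda>x. tr_end (T x))"
  unfolding tr_end_eq_sum by (intro smooth_on_sum smooth_on_vec_nth assms)

text \<open>A permutation other than the identity moves at least two indices. After one factor of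
  its product is differentiated, an off-diagonal entry of the identity matrix is still left, so only
  the identity permutation contributes.\<close>

lemma has_derivative_det_mat_1:
  fixes A :: "'e::real_normed_vector \<Rightarrow> real ^ 'm ^ 'm"
  assumes "(A has_derivative A') (at x)" "A x = mat 1"
  shows "((\<lambda>z. det (A z)) has_derivative (\<lambda>w. trace (A' w))) (at x)"
proof -
  have e: "((\<lambda>z. A z $ i $ j) has_derivative (\<lambda>w. A' w $ i $ j)) (at x)" for i j
    by (intro bounded_linear.has_derivative[OF bounded_linear_vec_nth] assms)
  have d: "((\<lambda>z. det (A z)) has_derivative
     (\<lambda>w. \<Sum>p\<in>{p. p permutes UNIV}. of_int (sign p) *
        (\<Sum>i\<in>UNIV. A' w $ i $ p i * (\<Prod>j\<in>UNIV - {i}. A x $ j $ p j)))) (at x)"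
    unfolding det_def
    by (intro has_derivative_sum has_derivative_mult_right has_derivative_prod e)
  have "(\<Sum>p\<in>{p. p permutes (UNIV::'m set)}. of_int (sign p) *
        (\<Sum>i\<in>UNIV. A' w $ i $ p i * (\<Prod>j\<in>UNIV - {i}. A x $ j $ p j))) = trace (A' w)" for w
  proof -
    have z0: "(\<Prod>j\<in>UNIV - {i}. A x $ j $ p j) = 0" if p: "p permutes (UNIV :: 'm set)" "p \<noteq> id" for p i
    proof -
      have "\<exists>j. j \<noteq> i \<and> p j \<noteq> j"
      proof (rule ccontr)
        assume "\<nexists>j. j \<noteq> i \<and> p j \<noteq> j"
        then have f: "\<And>j. j \<noteq> i \<Longrightarrow> p j = j" by blast
        then have "p i = i" using permutes_inj[OF p(1)] by (metis injD)
        then show False using f p(2) by (metis eq_id_iff)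
      qed
      then obtain j where "j \<noteq> i" "p j \<noteq> j" by blast
      then have "A x $ j $ p j = 0" "j \<in> UNIV - {i}" using assms(2) by (auto simp: mat_def)
      then show ?thesis by (meson finite prod_zero)
    qed
    define t where "t = (\<lambda>p. of_int (sign p) *
        (\<Sum>i\<in>UNIV. A' w $ i $ p i * (\<Prod>j\<in>UNIV - {i}. A x $ j $ p j)))"
    have "t p = 0" if "p permutes (UNIV :: 'm set)" "p \<noteq> id" for p
      unfolding t_def by (simp only: z0[OF that] mult_zero_right sum.neutral_const)
    then have "sum t {p. p permutes (UNIV::'m set)} = sum t {id}"
      by (intro sum.mono_neutral_right) (auto simp: finite_permutations permutes_id)
    then have "(\<Sum>p\<in>{p. p permutes (UNIV::'m set)}. of_int (sign p) *
        (\<Sum>i\<in>UNIV. A' w $ i $ p i * (\<Prod>j\<in>UNIV - {i}. A x $ j $ p j)))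
       = of_int (sign (id :: 'm \<Rightarrow> 'm)) * (\<Sum>i\<in>UNIV. A' w $ i $ id i * (\<Prod>j\<in>UNIV - {i}. A x $ j $ id j))"
      by (simp only: t_def sum.insert finite.emptyI sum.empty empty_iff not_False_eq_True add_0_right)
    also have "\<dots> = trace (A' w)"
      using assms(2) by (simp add: trace_def mat_def)
    finally show ?thesis .
  qed
  then show ?thesis by (intro has_derivative_eq_rhs[OF d] ext)
qed

lemma has_derivative_matrix_entries:
  fixes A :: "'e::real_normed_vector \<Rightarrow> real ^ 'm ^ 'm"
  assumes "\<And>p q. ((\<lambda>z. A z $ p $ q) has_derivative (\<lambda>u. A' u $ p $ q)) (at x)"
  shows "(A has_derivative A') (at x)"
proof -
  have e: "M = (\<Sum>p\<in>UNIV. \<Sum>q\<in>UNIV. (M $ p $ q) *\<^sub>R axis p (axis q 1))" for M :: "real ^ 'm ^ 'm"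
  proof -
    have "(\<Sum>p\<in>UNIV. \<Sum>q\<in>UNIV. (M $ p $ q) *\<^sub>R axis p (axis q 1 :: real ^ 'm)) $ i $ j
        = (\<Sum>q\<in>UNIV. \<Sum>p\<in>UNIV. if p = i then (if q = j then M $ p $ q else 0) else 0)" for i j
      by (subst sum.swap) (auto simp: axis_def intro!: sum.cong)
    then show ?thesis by (simp add: vec_eq_iff)
  qed
  have "((\<lambda>z. \<Sum>p\<in>UNIV. \<Sum>q\<in>UNIV. (A z $ p $ q) *\<^sub>R axis p (axis q 1)) has_derivative
      (\<lambda>u. \<Sum>p\<in>UNIV. \<Sum>q\<in>UNIV. (A' u $ p $ q) *\<^sub>R axis p (axis q 1 :: real ^ 'm))) (at x)"
    by (intro has_derivative_sum has_derivative_scaleR_left assms)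
  then show ?thesis unfolding e[symmetric] .
qed

lemma bounded_linear_matrix_mult_right: "bounded_linear (\<lambda>B. (M :: real ^ 'm ^ 'm) ** B)"
  by (intro linear_conv_bounded_linear[THEN iffD1] linearI)
    (simp_all add: matrix_matrix_mult_def vec_eq_iff sum.distrib algebra_simps sum_distrib_left)

text \<open>Jacobi's formula. Multiplication with the inverse of \<open>A x\<close> moves the base
  point to the identity.\<close>

lemma has_derivative_det:
  fixes A :: "'e::real_normed_vector \<Rightarrow> real ^ 'm ^ 'm"
  assumes "(A has_derivative A') (at x)" "det (A x) \<noteq> 0"
  shows "((\<lambda>z. det (A z)) has_derivative
    (\<lambda>w. det (A x) * trace (matrix_inv (A x) ** A' w))) (at x)"
proof -
  have "((\<lambda>z. det (matrix_inv (A x) ** A z)) has_derivative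
     (\<lambda>w. trace (matrix_inv (A x) ** A' w))) (at x)"
    by (rule has_derivative_det_mat_1)
      (use assms in \<open>auto intro: bounded_linear.has_derivative[OF bounded_linear_matrix_mult_right]
         simp: matrix_inv_works\<close>)
  from has_derivative_mult_right[OF this, of "det (A x)"]
  have "((\<lambda>z. det (A x) * det (matrix_inv (A x) ** A z)) has_derivative
     (\<lambda>w. det (A x) * trace (matrix_inv (A x) ** A' w))) (at x)" .
  moreover have "det (A x) * det (matrix_inv (A x) ** A z) = det (A z)" for z
  proof -
    have "det (A x) * det (matrix_inv (A x)) = 1"
      unfolding det_mul[symmetric] by (simp add: matrix_inv_works assms(2))
    then show ?thesis by (simp add: det_mul mult.assoc[symmetric])
  qed
  ultimately show ?thesis by simp
qed

section \<open>Inner products and traces\<close>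

definition inner_form :: "(real ^ 'm::finite \<Rightarrow> real ^ 'm \<Rightarrow> real) \<Rightarrow> bool" where
  "inner_form b \<longleftrightarrow> bilinear b \<and> (\<forall>u v. b u v = b v u) \<and> (\<forall>u. u \<noteq> 0 \<longrightarrow> b u u > 0)"

text \<open>The vector that represents the form \<phi>. Writing it with the inverse Gram matrix
  makes its smooth dependence on \<open>b\<close> and \<phi> visible.\<close>

definition sharp :: "(real ^ 'm::finite \<Rightarrow> real ^ 'm \<Rightarrow> real) \<Rightarrow> (real ^ 'm \<Rightarrow> real) \<Rightarrow> real ^ 'm" where
  "sharp b \<phi> = matrix_inv (gram b) *v (\<chi> p. \<phi> (axis p 1))"

lemma inner_formD:
  assumes "inner_form b"
  shows "bilinear b" "b u v = b v u" "u \<noteq> 0 \<Longrightarrow> b u u > 0"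
  using assms unfolding inner_form_def by blast+

lemma bilinear_linear: "bilinear b \<Longrightarrow> linear (b u)" "bilinear b \<Longrightarrow> linear (\<lambda>u. b u v)"
  by (simp_all add: bilinear_def)

lemma bilinear_eq_gram:
  assumes "bilinear b" shows "b u v = u \<bullet> (gram b *v v)"
proof -
  have "b u v = (\<Sum>p\<in>UNIV. u $ p * b (axis p 1) v)"
    using linear_expand_axis[OF bilinear_linear(2)[OF assms], of u v] by simp
  also have "\<dots> = (\<Sum>p\<in>UNIV. u $ p * (\<Sum>q\<in>UNIV. v $ q * b (axis p 1) (axis q 1)))"
    using linear_expand_axis[OF bilinear_linear(1)[OF assms], of _ v] by simp
  also have "\<dots> = u \<bullet> (gram b *v v)"
    by (simp add: inner_vec_def matrix_vector_mult_def gram_def mult.commute)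
  finally show ?thesis .
qed

lemma inner_form_cancel:
  assumes "inner_form b" "\<And>v. b u v = b w v"
  shows "u = w"
proof (rule ccontr)
  assume "u \<noteq> w"
  then have "b (u - w) (u - w) > 0" using inner_formD(3)[OF assms(1)] by simp
  moreover have "b (u - w) (u - w) = b u (u - w) - b w (u - w)"
    using bilinear_linear(2)[OF inner_formD(1)[OF assms(1)]] by (rule linear_diff)
  ultimately show False using assms(2) by simp
qed

lemma det_pos_def_nonzero:
  fixes A :: "real ^ 'm ^ 'm"
  assumes "\<And>v. v \<noteq> 0 \<Longrightarrow> v \<bullet> (A *v v) > 0"
  shows "det A \<noteq> 0"
proof -
  have "\<forall>v. A *v v = 0 \<longrightarrow> v = 0" using assms by (metis inner_zero_right less_irrefl)
  then have "invertible A" by (metis invertible_left_inverse matrix_left_invertible_ker)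
  then show ?thesis by (simp add: invertible_det_nz)
qed

text \<open>The segment from the identity to the matrix consists of positive definite matrices, so the
  determinant does not change its sign along it.\<close>

lemma det_pos_def:
  fixes A :: "real ^ 'm ^ 'm"
  assumes "\<And>v. v \<noteq> 0 \<Longrightarrow> v \<bullet> (A *v v) > 0"
  shows "det A > 0"
proof (rule ccontr)
  assume "\<not> det A > 0"
  define B where "B = (\<lambda>t::real. (1 - t) *\<^sub>R mat 1 + t *\<^sub>R A)"
  have "continuous_on {0..1} (\<lambda>t. det (B t))"
    unfolding det_def B_def by (intro continuous_intros) 
  moreover have "det (B 1) \<le> 0" "0 \<le> det (B 0)" using \<open>\<not> det A > 0\<close> by (simp_all add: B_def)
  ultimately obtain t where t: "0 \<le> t" "t \<le> 1" "det (B t) = 0"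
    using IVT2'[of "\<lambda>t. det (B t)" 1 0 0] by auto
  have "v \<bullet> (B t *v v) > 0" if "v \<noteq> 0" for v
  proof -
    have "v \<bullet> (B t *v v) = (1 - t) * (v \<bullet> v) + t * (v \<bullet> (A *v v))"
      by (simp add: B_def matrix_vector_mult_add_rdistrib scaleR_matrix_vector_assoc[symmetric] inner_add_right)
    moreover have "v \<bullet> v > 0" "v \<bullet> (A *v v) > 0" using that assms by auto
    ultimately show ?thesis using t
      by (cases "t = 0") (auto intro!: add_nonneg_pos)
  qed
  then show False using det_pos_def_nonzero t(3) by blast
qed

lemma det_gram_pos: "inner_form b \<Longrightarrow> det (gram b) > 0"
  by (rule det_pos_def) (simp add: bilinear_eq_gram[symmetric] inner_formD)

lemma sharp_works:
  assumes "inner_form b" "linear \<phi>"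
  shows "b (sharp b \<phi>) v = \<phi> v"
proof -
  have "b (sharp b \<phi>) v = b v (sharp b \<phi>)" using assms(1) by (rule inner_formD)
  also have "\<dots> = v \<bullet> (gram b *v sharp b \<phi>)" using assms by (intro bilinear_eq_gram inner_formD)
  also have "gram b *v sharp b \<phi> = (\<chi> p. \<phi> (axis p 1))"
    using det_gram_pos[OF assms(1)]
    by (simp add: sharp_def matrix_vector_mul_assoc matrix_inv_works)
  also have "v \<bullet> \<dots> = \<phi> v"
    using linear_expand_axis[OF assms(2), of v] by (simp add: inner_vec_def)
  finally show ?thesis .
qed

lemma sharp_eqI:
  assumes "inner_form b" "\<And>v. b w v = \<phi> v"
  shows "sharp b \<phi> = w"
proof (rule inner_form_cancel[OF assms(1)])
  have "linear \<phi>" using assms bilinear_linear(1)[OF inner_formD(1)[OF assms(1)], of w] by presburger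
  then show "b (sharp b \<phi>) v = b w v" for v using assms by (simp add: sharp_works)
qed

lemma smooth_on_sharp:
  fixes b :: "'e::real_normed_vector \<Rightarrow> real ^ 'm::finite \<Rightarrow> real ^ 'm \<Rightarrow> real"
  assumes "open S" "\<And>x. x \<in> S \<Longrightarrow> inner_form (b x)" "\<And>u v. smooth_on S (\<lambda>x. b x u v)"
    "\<And>v. smooth_on S (\<lambda>x. \<phi> x v)"
  shows "smooth_on S (\<lambda>x. sharp (b x) (\<phi> x))"
proof (rule smooth_on_vec_lambda[OF _ assms(1)])
  fix p
  have "smooth_on S (\<lambda>x. matrix_inv (gram (b x)) $ p $ q)" for q
  proof (rule smooth_on_matrix_inv[OF _ assms(1)])
    show "smooth_on S (\<lambda>x. gram (b x) $ r $ s)" for r s using assms(3) by (simp add: gram_def)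
    show "det (gram (b x)) \<noteq> 0" if "x \<in> S" for x using det_gram_pos[OF assms(2)[OF that]] by simp
  qed
  then show "smooth_on S (\<lambda>x. sharp (b x) (\<phi> x) $ p)"
    unfolding sharp_def matrix_vector_mult_def vec_lambda_beta
    by (intro smooth_on_sum smooth_on_mult assms)
qed

lemma tr_form_eq_tr_end_sharp: "tr_form b q = tr_end (\<lambda>u. sharp b (q u))"
  by (simp add: tr_form_def tr_end_eq_sum sharp_def matrix_vector_mult_def)

text \<open>Computes a trace through any endomorphism that represents the form, without touching the
  Gram matrix again.\<close>

lemma tr_form_eqI:
  assumes "inner_form b" "\<And>u v. b (T u) v = q u v"
  shows "tr_form b q = tr_end T"
  unfolding tr_form_eq_tr_end_sharp using sharp_eqI[OF assms(1)] assms(2) by (intro tr_end_cong) blast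

lemma tr_form_add: "tr_form b (\<lambda>u v. q u v + r u v) = tr_form b q + tr_form b r"
  by (simp add: tr_form_def sum.distrib algebra_simps)

lemma tr_form_diff: "tr_form b (\<lambda>u v. q u v - r u v) = tr_form b q - tr_form b r"
  by (simp add: tr_form_def sum_subtractf algebra_simps)

lemma tr_form_mult: "tr_form b (\<lambda>u v. a * q u v) = a * tr_form b q"
  by (simp add: tr_form_def sum_distrib_left mult_ac)

lemma tr_form_self: "inner_form b \<Longrightarrow> tr_form b b = real CARD('m)"
  for b :: "real ^ 'm::finite \<Rightarrow> real ^ 'm \<Rightarrow> real"
  using tr_form_eqI[of b "\<lambda>u. u" b] by (simp add: tr_end_id)

lemma sharp_linear:
  assumes "inner_form b" "bilinear q"
  shows "linear (\<lambda>u. sharp b (q u))"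
proof
  have w: "b (sharp b (q u)) v = q u v" for u v
    using assms bilinear_linear(1) by (intro sharp_works)
  have q: "bilinear b" using assms(1) by (rule inner_formD)
  show "sharp b (q (u + v)) = sharp b (q u) + sharp b (q v)" for u v
    by (rule inner_form_cancel[OF assms(1)])
      (simp add: w bilinear_ladd[OF q] bilinear_ladd[OF assms(2)])
  show "sharp b (q (c *\<^sub>R u)) = c *\<^sub>R sharp b (q u)" for u c
    by (rule inner_form_cancel[OF assms(1)])
      (simp add: w bilinear_lmul[OF q] bilinear_lmul[OF assms(2)])
qed

text \<open>The endomorphism that represents \<open>q'\<close> is t / s times the conjugate by
  \<open>J\<close> of the one that represents \<open>q\<close>, and traces are invariant under
  conjugation.\<close>

lemma tr_form_natural:
  fixes b b' :: "real ^ 'm::finite \<Rightarrow> real ^ 'm \<Rightarrow> real"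
  assumes "inner_form b" "inner_form b'" "bilinear q"
    and J: "linear J" "linear K" "\<And>v. K (J v) = v" "\<And>v. J (K v) = v"
    and b': "\<And>u v. b' (J u) (J v) = s * b u v" and "s \<noteq> 0"
    and q': "\<And>u v. q' (J u) (J v) = t * q u v"
  shows "tr_form b' q' = t / s * tr_form b q"
proof -
  define T where "T = (\<lambda>u. sharp b (q u))"
  have T: "b (T u) v = q u v" for u v
    unfolding T_def using assms by (intro sharp_works bilinear_linear(1))
  have lT: "linear T" unfolding T_def using assms by (intro sharp_linear)
  have "tr_form b' q' = tr_end (\<lambda>u. (t / s) *\<^sub>R J (T (K u)))"
  proof (rule tr_form_eqI[OF assms(2)])
    fix u v
    have "b' ((t / s) *\<^sub>R J (T (K u))) v = (t / s) * b' (J (T (K u))) (J (K v))"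
      by (simp add: J bilinear_lmul[OF inner_formD(1)[OF assms(2)]])
    also have "\<dots> = t * q (K u) (K v)" using \<open>s \<noteq> 0\<close> by (simp add: b' T)
    also have "\<dots> = q' u v" using q'[of "K u" "K v"] by (simp add: J)
    finally show "b' ((t / s) *\<^sub>R J (T (K u))) v = q' u v" .
  qed
  also have "\<dots> = t / s * tr_end (\<lambda>u. J (T (K u)))" by (rule tr_end_scaleR)
  also have "tr_end (\<lambda>u. J (T (K u))) = tr_end (\<lambda>u. T (K (J u)))"
    using tr_end_commute[OF J(1), of "\<lambda>u. T (K u)"] linear_compose[OF J(2) lT] by (simp add: o_def)
  also have "\<dots> = tr_form b q" by (simp add: J T_def tr_form_eq_tr_end_sharp)
  finally show ?thesis .
qed

lemma inner_form_scale: "inner_form b \<Longrightarrow> s > 0 \<Longrightarrow> inner_form (\<lambda>u v. s * b u v)"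
  unfolding inner_form_def bilinear_def
  by (auto simp: linear_iff algebra_simps)

lemma tr_form_scale_form:
  assumes "inner_form b" "s > 0"
  shows "tr_form (\<lambda>u v. s * b u v) q = tr_form b q / s"
proof -
  text \<open>Only the values of \<open>q\<close> on the coordinate basis matter, so \<open>q\<close> may be replaced by a bilinear form.\<close>
  define q' where "q' = (\<lambda>u v. u \<bullet> (gram q *v v))"
  have "bilinear q'"
    unfolding q'_def bilinear_def
    by (simp add: linear_iff inner_add_left inner_add_right matrix_vector_right_distrib matrix_vector_mult_scaleR)
  then have "tr_form (\<lambda>u v. s * b u v) q' = tr_form b q' / s"
    using tr_form_natural[OF assms(1) inner_form_scale[OF assms], of q' "\<lambda>u. u" "\<lambda>u. u" s q' 1] assms(2)
    by (simp add: linear_ident)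
  moreover have "q' (axis r 1) (axis s 1) = q (axis r 1) (axis s 1)" for r s
    by (simp add: q'_def matrix_vector_mult_basis column_def inner_axis' gram_def)
  then have "tr_form c q' = tr_form c q" for c by (simp add: tr_form_def)
  ultimately show ?thesis by simp
qed

text \<open>The Gram matrix is symmetric, hence so is its inverse.\<close>

lemma tr_form_flip:
  assumes "inner_form b" shows "tr_form b (\<lambda>u v. q v u) = tr_form b q"
proof -
  define M where "M = matrix_inv (gram b)"
  have nz: "det (gram b) \<noteq> 0" using det_gram_pos[OF assms] by simp
  have g: "transpose (gram b) = gram b"
    by (simp add: transpose_def gram_def vec_eq_iff inner_formD(2)[OF assms])
  have 1: "transpose M ** gram b = mat 1"
    using matrix_inv_works(1)[OF nz] g by (metis M_def matrix_transpose_mul transpose_mat)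
  have "transpose M = transpose M ** (gram b ** M)"
    using matrix_inv_works(1)[OF nz] by (simp add: M_def)
  also have "\<dots> = M" by (simp add: matrix_mul_assoc 1)
  finally have "M $ r $ s = M $ s $ r" for r s by (metis transpose_def vec_lambda_beta)
  then have "tr_form b (\<lambda>u v. q v u) = (\<Sum>r\<in>UNIV. \<Sum>s\<in>UNIV. M $ s $ r * q (axis s 1) (axis r 1))"
    by (simp add: tr_form_def M_def)
  also have "\<dots> = tr_form b q" unfolding tr_form_def M_def by (rule sum.swap)
  finally show ?thesis .
qed

lemma tr_form_symm: "inner_form b \<Longrightarrow> tr_form b (symm q) = tr_form b q"
proof -
  assume b: "inner_form b"
  have "symm q = (\<lambda>u v. (1 / 2) * (q u v + q v u))" by (simp add: symm_def fun_eq_iff)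
  then have "tr_form b (symm q) = (1 / 2) * (tr_form b q + tr_form b (\<lambda>u v. q v u))"
    by (simp only: tr_form_mult tr_form_add)
  then show ?thesis using tr_form_flip[OF b, of q] by simp
qed

lemma tracefree_add: "tracefree b (\<lambda>u v. q u v + r u v) u v = tracefree b q u v + tracefree b r u v"
  by (simp add: tracefree_def tr_form_add algebra_simps add_divide_distrib)

lemma tracefree_diff: "tracefree b (\<lambda>u v. q u v - r u v) u v = tracefree b q u v - tracefree b r u v"
  by (simp add: tracefree_def tr_form_diff algebra_simps diff_divide_distrib)

lemma tracefree_mult: "tracefree b (\<lambda>u v. a * q u v) u v = a * tracefree b q u v"
  by (simp add: tracefree_def tr_form_mult algebra_simps)

lemma tracefree_self: "inner_form b \<Longrightarrow> tracefree b b u v = 0"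
  by (simp add: tracefree_def tr_form_self)

lemma tr_form_tracefree: "inner_form b \<Longrightarrow> tr_form b (tracefree b q) = 0"
proof -
  assume b: "inner_form b"
  have "tracefree b q = (\<lambda>u v. q u v - (tr_form b q / real CARD('a)) * b u v)"
    by (simp add: tracefree_def fun_eq_iff)
  then show ?thesis by (simp only: tr_form_diff tr_form_mult tr_form_self[OF b]) simp
qed

lemma tracefree_trivial: "tr_form b q = 0 \<Longrightarrow> tracefree b q u v = q u v"
  by (simp add: tracefree_def)

text \<open>A flip does not change the trace, so here the trace equals its own negative.\<close>

lemma tracefree_antisym:
  assumes "inner_form b" "\<And>u v. q v u = - q u v"
  shows "tracefree b q u v = q u v"
proof -
  have "(\<lambda>u v. q v u) = (\<lambda>u v. - 1 * q u v)" by (intro ext, subst assms(2), simp)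
  then have "tr_form b (\<lambda>u v. q v u) = tr_form b (\<lambda>u v. - 1 * q u v)" by (rule arg_cong)
  then have "tr_form b q = - 1 * tr_form b q" unfolding tr_form_mult tr_form_flip[OF assms(1), of q] .
  then show ?thesis by (intro tracefree_trivial) simp
qed

text \<open>The factor \<open>s\<close> of the metric cancels the factor 1 / s of the trace.
  Consequently the restricted metric and the normalised metric of \<open>N\<close> have the same
  trace-free parts.\<close>

lemma tracefree_scale_form:
  assumes "inner_form b" "s > 0"
  shows "tracefree (\<lambda>u v. s * b u v) q u v = tracefree b q u v"
  using assms by (simp add: tracefree_def tr_form_scale_form)

lemma tracefree_natural:
  fixes b b' :: "real ^ 'm::finite \<Rightarrow> real ^ 'm \<Rightarrow> real"
  assumes "inner_form b" "inner_form b'" "bilinear q"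
    and J: "linear J" "linear K" "\<And>v. K (J v) = v" "\<And>v. J (K v) = v"
    and b': "\<And>u v. b' (J u) (J v) = s * b u v" and "s \<noteq> 0"
    and q': "\<And>u v. q' (J u) (J v) = t * q u v"
  shows "tracefree b' q' (J u) (J v) = t * tracefree b q u v"
proof -
  have "tr_form b' q' = t / s * tr_form b q" by (rule tr_form_natural[OF assms])
  then show ?thesis using \<open>s \<noteq> 0\<close> by (simp add: tracefree_def b' q' algebra_simps)
qed

lemma symm_natural:
  "(\<And>u v. q' (J u) (J v) = t * q u v) \<Longrightarrow> symm q' (J u) (J v) = t * symm q u v" for t :: real
  by (simp add: symm_def algebra_simps)

lemma bilinear_symm: "bilinear q \<Longrightarrow> bilinear (symm q)"
  unfolding bilinear_def symm_def
  by (auto simp: linear_iff algebra_simps add_divide_distrib)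

lemma bilinear_tracefree: "bilinear b \<Longrightarrow> bilinear q \<Longrightarrow> bilinear (tracefree b q)"
  unfolding bilinear_def tracefree_def
  by (auto simp: linear_iff algebra_simps add_divide_distrib)

lemma smooth_on_tr_form:
  fixes b :: "'e::real_normed_vector \<Rightarrow> real ^ 'm::finite \<Rightarrow> real ^ 'm \<Rightarrow> real"
  assumes "open S" "\<And>x. x \<in> S \<Longrightarrow> inner_form (b x)" "\<And>u v. smooth_on S (\<lambda>x. b x u v)"
    "\<And>u v. smooth_on S (\<lambda>x. q x u v)"
  shows "smooth_on S (\<lambda>x. tr_form (b x) (q x))"
  unfolding tr_form_eq_tr_end_sharp
  by (intro smooth_on_tr_end smooth_on_sharp assms)

lemma smooth_on_tracefree:
  fixes b :: "'e::real_normed_vector \<Rightarrow> real ^ 'm::finite \<Rightarrow> real ^ 'm \<Rightarrow> real"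
  assumes "open S" "\<And>x. x \<in> S \<Longrightarrow> inner_form (b x)" "\<And>u v. smooth_on S (\<lambda>x. b x u v)"
    "\<And>u v. smooth_on S (\<lambda>x. q x u v)"
  shows "smooth_on S (\<lambda>x. tracefree (b x) (q x) u v)"
  unfolding tracefree_def
  by (intro smooth_on_diff smooth_on_mult smooth_on_const smooth_on_tr_form assms)

lemma smooth_on_symm:
  assumes "open S" "\<And>u v. smooth_on S (\<lambda>x. q x u v)"
  shows "smooth_on S (\<lambda>x. symm (q x) u v)"
proof -
  have "smooth_on S (\<lambda>x. (1 / 2) * (q x u v + q x v u))"
    by (intro smooth_on_mult smooth_on_const smooth_on_add assms)
  then show ?thesis by (simp add: symm_def)
qed

text \<open>Determinants of the matrix identity J^T B' J = s B for the two Gram matrices. It governs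
  how the weight factor transforms.\<close>

lemma det_gram_natural:
  fixes b b' :: "real ^ 'm::finite \<Rightarrow> real ^ 'm \<Rightarrow> real"
  assumes "bilinear b" "bilinear b'" "linear J" "\<And>u v. b' (J u) (J v) = s * b u v"
  shows "(det (matrix J))\<^sup>2 * det (gram b') = s ^ CARD('m) * det (gram b)"
proof -
  have "(transpose (matrix J) ** (gram b' ** matrix J)) $ p $ q = (s *\<^sub>R gram b) $ p $ q" for p q
  proof -
    have "(s *\<^sub>R gram b) $ p $ q = b' (J (axis p 1)) (J (axis q 1))"
      by (simp add: gram_def assms(4))
    also have "\<dots> = (matrix J *v axis p 1) \<bullet> (gram b' *v (matrix J *v axis q 1))"
      using assms by (simp add: bilinear_eq_gram matrix_works)
    also have "\<dots> = axis p 1 \<bullet> (transpose (matrix J) *v (gram b' *v (matrix J *v axis q 1)))"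
      by (metis dot_lmul_matrix inner_commute transpose_matrix_vector)
    also have "\<dots> = (transpose (matrix J) ** (gram b' ** matrix J)) $ p $ q"
    proof -
      have "(M *v axis q 1) $ p = M $ p $ q" for M :: "real ^ 'm ^ 'm"
        by (simp add: matrix_vector_mult_basis column_def)
      then show ?thesis by (simp only: matrix_vector_mul_assoc inner_axis' inner_real_def mult_1)
    qed
    finally show ?thesis by simp
  qed
  then have "transpose (matrix J) ** (gram b' ** matrix J) = s *\<^sub>R gram b" by (simp add: vec_eq_iff)
  from arg_cong[OF this, of det]
  have "det (matrix J) * (det (gram b') * det (matrix J)) = det (s *\<^sub>R gram b)"
    by (simp add: det_mul det_transpose)
  moreover have "det (s *\<^sub>R gram b) = s ^ CARD('m) * det (gram b)"
  proof -
    have "s *\<^sub>R gram b = (\<chi> i. s *s (gram b $ i))" by (simp add: vec_eq_iff)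
    then show ?thesis using det_rows_mul[of "\<lambda>_. s" "\<lambda>i. gram b $ i"] by simp
  qed
  ultimately show ?thesis by (simp add: power2_eq_square mult_ac)
qed

section \<open>Connections in a chart\<close>

text \<open>The connection form of \<open>L\<close> in the trivialisation given by the coordinate
  frame.\<close>

definition conn_form ::
    "(real ^ 'm::finite \<Rightarrow> real ^ 'm \<Rightarrow> real ^ 'm \<Rightarrow> real ^ 'm) \<Rightarrow> real ^ 'm \<Rightarrow> real ^ 'm \<Rightarrow> real" where
  "conn_form G x w = (1 / real CARD('m)) * tr_end (G x w)"

text \<open>A Hessian whose line bundle connection \<open>a\<close> and vector connection
  \<open>C\<close> are chosen separately: for sections of \<open>L\<^sub>M\<close> along
  \<open>N\<close> the form \<open>a\<close> comes from the ambient structure and \<open>C\<close>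
  from the induced one.\<close>

definition hess_gen ::
    "('e::real_normed_vector \<Rightarrow> 'e \<Rightarrow> real) \<Rightarrow> ('e \<Rightarrow> 'e \<Rightarrow> 'e \<Rightarrow> 'e) \<Rightarrow> ('e \<Rightarrow> real) \<Rightarrow> 'e \<Rightarrow> 'e \<Rightarrow> 'e \<Rightarrow> real" where
  "hess_gen a C l y u v = deriv_along (\<lambda>z. deriv_along l z v + a z v * l z) y u
     + a y u * (deriv_along l y v + a y v * l y) - (deriv_along l y (C y u v) + a y (C y u v) * l y)"

text \<open>The covariant derivative of a one-form, with the direction of differentiation as first
  argument.\<close>

definition cov_form ::
    "('e::real_normed_vector \<Rightarrow> 'e \<Rightarrow> real) \<Rightarrow> ('e \<Rightarrow> 'e \<Rightarrow> 'e \<Rightarrow> 'e) \<Rightarrow> 'e \<Rightarrow> 'e \<Rightarrow> 'e \<Rightarrow> real" where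
  "cov_form \<gamma> C y u v = deriv_along (\<lambda>z. \<gamma> z v) y u - \<gamma> y (C y u v)"

lemma hess_form_eq_gen: "hess_form G l = hess_gen (conn_form G) G l"
  by (simp add: fun_eq_iff hess_form_def hess_def cov_dens_def[abs_def] cov_vec_def hess_gen_def conn_form_def)

lemma curv_const:
  assumes "bilinear (G x)"
  shows "curv G (\<lambda>_. w) (\<lambda>_. u) (\<lambda>_. v) x =
    deriv_along (\<lambda>z. G z u v) x w + G x w (G x u v) - (deriv_along (\<lambda>z. G z w v) x u + G x u (G x w v))"
  using bilinear_lzero[OF assms]
  by (simp add: curv_def cov_vec_def[abs_def] lie_bracket_def[abs_def])

text \<open>The structure group of \<open>L\<close> is abelian: the quadratic terms cancel, and the
  curvature is the exterior derivative of the connection form.\<close>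

lemma faraday_eq:
  assumes "bilinear (G x)"
  shows "faraday G x u v =
    deriv_along (\<lambda>z. conn_form G z v) x u - deriv_along (\<lambda>z. conn_form G z u) x v"
proof -
  have "tr_end (G x 0) = 0" using bilinear_lzero[OF assms] by (simp add: tr_end_eq_sum)
  then show ?thesis
    by (simp add: faraday_def curv_dens_def cov_dens_def[abs_def] lie_bracket_def[abs_def]
        conn_form_def[abs_def])
qed

lemma cov_conf_const:
  assumes "bilinear (G x)"
  shows "cov_conf G g (\<lambda>_. w) (\<lambda>_. u) (\<lambda>_. v) x = deriv_along (\<lambda>z. g z u v) x w
    + 2 * conn_form G x w * g x u v - g x (G x w u) v - g x u (G x w v)"
  by (simp add: cov_conf_def cov_dens_def cov_vec_def conn_form_def)

locale connection_chart =
  fixes S :: "(real ^ 'm::finite) set" and G :: "real ^ 'm \<Rightarrow> real ^ 'm \<Rightarrow> real ^ 'm \<Rightarrow> real ^ 'm"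
  assumes open_S: "open S"
    and G_bilinear: "x \<in> S \<Longrightarrow> bilinear (G x)"
    and G_sym: "x \<in> S \<Longrightarrow> G x u v = G x v u"
    and G_smooth: "smooth_on S (\<lambda>x. G x u v)"
begin

lemma G_diff: "x \<in> S \<Longrightarrow> (\<lambda>z. G z u v) differentiable at x"
  using G_smooth by (rule smooth_on_imp_differentiable)

lemma conn_form_smooth: "smooth_on S (\<lambda>x. conn_form G x w)"
  unfolding conn_form_def
  by (rule smooth_on_mult[OF smooth_on_const smooth_on_tr_end[OF G_smooth open_S] open_S])

lemma conn_form_diff: "x \<in> S \<Longrightarrow> (\<lambda>z. conn_form G z w) differentiable at x"
  using conn_form_smooth by (rule smooth_on_imp_differentiable)

lemma conn_form_linear: assumes "x \<in> S" shows "linear (conn_form G x)"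
  using G_bilinear[OF assms]
  by (auto simp: linear_iff conn_form_def bilinear_ladd bilinear_lmul tr_end_eq_sum
      sum.distrib sum_distrib_left algebra_simps add_divide_distrib sum_divide_distrib)

lemma curv_smooth: "smooth_on S (\<lambda>x. curv G (\<lambda>_. w) (\<lambda>_. u) (\<lambda>_. v) x)"
proof -
  have GG: "smooth_on S (\<lambda>x. G x a (G x b c))" for a b c
    by (rule smooth_on_linear_family[OF open_S _ G_smooth G_smooth])
      (simp add: bilinear_linear G_bilinear)
  have "smooth_on S (\<lambda>x. deriv_along (\<lambda>z. G z u v) x w + G x w (G x u v)
     - (deriv_along (\<lambda>z. G z w v) x u + G x u (G x w v)))"
    by (rule smooth_on_diff smooth_on_add smooth_on_deriv_along G_smooth GG open_S)+
  then show ?thesis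
    by (rule smooth_on_cong[OF _ open_S]) (simp add: curv_const G_bilinear)
qed

lemma ricci_smooth: "smooth_on S (\<lambda>x. ricci G x u v)"
  unfolding ricci_def by (rule smooth_on_tr_end[OF curv_smooth open_S])

lemma bilinear_deriv:
  assumes "x \<in> S"
  shows "linear (\<lambda>v. deriv_along (\<lambda>z. G z u v) x w)" "linear (\<lambda>u. deriv_along (\<lambda>z. G z u v) x w)"
    "linear (\<lambda>w. deriv_along (\<lambda>z. G z u v) x w)"
  using linear_deriv_along_param[OF open_S assms, of "\<lambda>z. G z u"]
    linear_deriv_along_param[OF open_S assms, of "\<lambda>z u. G z u v"] assms
  by (simp_all add: bilinear_linear G_bilinear G_diff linear_deriv_along)

lemma curv_linear:
  assumes x: "x \<in> S"
  shows "linear (\<lambda>w. curv G (\<lambda>_. w) (\<lambda>_. u) (\<lambda>_. v) x)"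
    "linear (\<lambda>u. curv G (\<lambda>_. w) (\<lambda>_. u) (\<lambda>_. v) x)"
    "linear (\<lambda>v. curv G (\<lambda>_. w) (\<lambda>_. u) (\<lambda>_. v) x)"
proof -
  note B = G_bilinear[OF x]
  note L = bilinear_deriv[OF x, unfolded linear_iff]
  show "linear (\<lambda>w. curv G (\<lambda>_. w) (\<lambda>_. u) (\<lambda>_. v) x)"
    "linear (\<lambda>u. curv G (\<lambda>_. w) (\<lambda>_. u) (\<lambda>_. v) x)"
    "linear (\<lambda>v. curv G (\<lambda>_. w) (\<lambda>_. u) (\<lambda>_. v) x)"
    unfolding curv_const[of G x, OF B] linear_iff
    by (simp_all add: L bilinear_ladd[OF B] bilinear_radd[OF B] bilinear_lmul[OF B]
        bilinear_rmul[OF B] scaleR_add_right scaleR_diff_right)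
qed

lemma ricci_bilinear: assumes x: "x \<in> S" shows "bilinear (ricci G x)"
  unfolding bilinear_def ricci_def tr_end_eq_sum
  using curv_linear[OF x]
  by (auto simp: linear_iff sum.distrib sum_distrib_left)

lemma hess_form_bilinear:
  assumes x: "x \<in> S" and l: "smooth_on S l"
  shows "bilinear (hess_form G l x)"
proof -
  have d1: "(\<lambda>z. deriv_along l z v) differentiable at x" for v
    by (rule smooth_on_imp_differentiable[OF smooth_on_deriv_along[OF l] x])
  have d: "(\<lambda>z. deriv_along l z v + conn_form G z v * l z) differentiable at x" for v
    by (intro differentiable_add differentiable_mult d1 conn_form_diff smooth_on_imp_differentiable[OF l] x)
  have ll: "linear (deriv_along l z)" if "z \<in> S" for z
    by (rule linear_deriv_along[OF smooth_on_imp_differentiable[OF l that]])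
  have 1: "linear (\<lambda>v. deriv_along (\<lambda>z. deriv_along l z v + conn_form G z v * l z) x u)" for u
    using linear_deriv_along_param[OF open_S x, of "\<lambda>z v. deriv_along l z v + conn_form G z v * l z" u] d
      ll conn_form_linear by (simp add: linear_iff algebra_simps)
  have 2: "linear (\<lambda>u. deriv_along (\<lambda>z. deriv_along l z v + conn_form G z v * l z) x u)" for v
    by (rule linear_deriv_along[OF d])
  note B = G_bilinear[OF x]
  show ?thesis
    using 1 2 ll[OF x] conn_form_linear[OF x] unfolding hess_form_eq_gen bilinear_def hess_gen_def
    by (simp add: linear_iff bilinear_ladd[OF B] bilinear_radd[OF B] bilinear_lmul[OF B]
        bilinear_rmul[OF B]) (simp add: algebra_simps)
qed

end

locale weyl_chart = connection_chart S G
  for S :: "(real ^ 'm::finite) set" and G +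
  fixes g :: "real ^ 'm \<Rightarrow> real ^ 'm \<Rightarrow> real ^ 'm \<Rightarrow> real"
  assumes g_inner: "x \<in> S \<Longrightarrow> inner_form (g x)"
    and g_smooth: "smooth_on S (\<lambda>x. g x u v)"
    and compat: "x \<in> S \<Longrightarrow> cov_conf G g (\<lambda>_. w) (\<lambda>_. u) (\<lambda>_. v) x = 0"
begin

lemma deriv_g:
  "x \<in> S \<Longrightarrow> deriv_along (\<lambda>z. g z u v) x w
    = g x (G x w u) v + g x u (G x w v) - 2 * conn_form G x w * g x u v"
  using compat[of x w u v] by (simp add: cov_conf_const G_bilinear)

lemma g_diff: "x \<in> S \<Longrightarrow> (\<lambda>z. g z u v) differentiable at x"
  using g_smooth by (rule smooth_on_imp_differentiable)

lemma g_bilinear: "x \<in> S \<Longrightarrow> bilinear (g x)"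
  using g_inner inner_formD(1) by blast

end

section \<open>Change of the Weyl structure\<close>

locale weyl_change = A: weyl_chart S G g + B: weyl_chart S G' g
  for S :: "(real ^ 'm::finite) set" and G G' g
begin

definition gam :: "real ^ 'm \<Rightarrow> real ^ 'm \<Rightarrow> real" where
  "gam x w = conn_form G' x w - conn_form G x w"

definition gsharp :: "real ^ 'm \<Rightarrow> real ^ 'm" where
  "gsharp x = sharp (g x) (gam x)"

lemma gam_smooth: "smooth_on S (\<lambda>x. gam x w)"
  unfolding gam_def by (intro smooth_on_diff A.conn_form_smooth B.conn_form_smooth A.open_S)

lemma gam_diff: "x \<in> S \<Longrightarrow> (\<lambda>z. gam z w) differentiable at x"
  using gam_smooth by (rule smooth_on_imp_differentiable)

lemma gam_linear: "x \<in> S \<Longrightarrow> linear (gam x)"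
  using A.conn_form_linear B.conn_form_linear unfolding gam_def[abs_def] by (simp add: linear_compose_sub)

lemma g_gsharp: "x \<in> S \<Longrightarrow> g x (gsharp x) v = gam x v"
  unfolding gsharp_def by (intro sharp_works A.g_inner gam_linear)

lemma gsharp_smooth: "smooth_on S gsharp"
  unfolding gsharp_def by (intro smooth_on_sharp A.open_S A.g_inner A.g_smooth gam_smooth)

lemma gsharp_diff: "x \<in> S \<Longrightarrow> gsharp differentiable at x"
  using gsharp_smooth by (rule smooth_on_imp_differentiable)

text \<open>The difference of the connections is found as in the proof of the Koszul formula.\<close>

lemma connection_change:
  assumes x: "x \<in> S"
  shows "G' x u v = G x u v + gam x u *\<^sub>R v + gam x v *\<^sub>R u - g x u v *\<^sub>R gsharp x"
proof (rule inner_form_cancel[OF A.g_inner[OF x]])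
  fix z
  note b = A.g_bilinear[OF x]
  define E where "E = (\<lambda>w u v. g x (G' x w u - G x w u) v)"
  have g_sym: "g x a b = g x b a" for a b using A.g_inner[OF x] by (rule inner_formD)
  have E1: "E w u v + E w v u = 2 * gam x w * g x u v" for w u v
    using A.deriv_g[OF x, of u v w] B.deriv_g[OF x, of u v w] g_sym[of v "G' x w u - G x w u"]
      g_sym[of u "G x w v"] g_sym[of u "G' x w v"]
    by (simp add: E_def gam_def bilinear_lsub[OF b] bilinear_rsub[OF b] algebra_simps)
  have E2: "E w u v = E u w v" for w u v
    using A.G_sym[OF x] B.G_sym[OF x] by (simp add: E_def)
  have "2 * E u v z = 2 * (gam x u * g x v z + gam x v * g x u z - gam x z * g x u v)"
    using E1[of u v z] E1[of v z u] E1[of z u v] E2[of u v z] E2[of v z u] E2[of z u v]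
      g_sym[of z u] by (simp add: algebra_simps)
  then have "E u v z = gam x u * g x v z + gam x v * g x u z - gam x z * g x u v" by simp
  then show "g x (G' x u v) z
      = g x (G x u v + gam x u *\<^sub>R v + gam x v *\<^sub>R u - g x u v *\<^sub>R gsharp x) z"
    by (simp add: E_def bilinear_lsub[OF b] bilinear_ladd[OF b] bilinear_lmul[OF b] g_gsharp[OF x] mult.commute)
qed

text \<open>The difference tensor of the two connections, by
  \<open>connection_change\<close>.\<close>

definition Dif :: "real ^ 'm \<Rightarrow> real ^ 'm \<Rightarrow> real ^ 'm \<Rightarrow> real ^ 'm" where
  "Dif x u v = gam x u *\<^sub>R v + gam x v *\<^sub>R u - g x u v *\<^sub>R gsharp x"

text \<open>\<open>gsharp\<close> is a vector field of weight -2, which accounts for the last term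
  of its covariant derivative.\<close>

definition cov_gsharp :: "real ^ 'm \<Rightarrow> real ^ 'm \<Rightarrow> real ^ 'm" where
  "cov_gsharp x w = deriv_along gsharp x w + G x w (gsharp x) - (2 * conn_form G x w) *\<^sub>R gsharp x"

text \<open>The metric is parallel, so raising the index commutes with covariant
  differentiation.\<close>

lemma g_cov_gsharp:
  assumes x: "x \<in> S"
  shows "g x (cov_gsharp x w) v = cov_form gam G x w v"
proof -
  note b = A.g_bilinear[OF x]
  have "((\<lambda>z. g z (gsharp z) v) has_derivative
      (\<lambda>w. deriv_along (\<lambda>z. g z (gsharp x) v) x w + g x (deriv_along gsharp x w) v)) (at x)"
    by (rule has_derivative_linear_family[OF A.open_S x, of "\<lambda>z a. g z a v"])
      (auto simp: bilinear_linear A.g_bilinear A.g_diff x gsharp_diff has_derivative_deriv_along)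
  then have "deriv_along (\<lambda>z. g z (gsharp z) v) x w
      = deriv_along (\<lambda>z. g z (gsharp x) v) x w + g x (deriv_along gsharp x w) v"
    by (simp add: deriv_along_eqI)
  moreover have "deriv_along (\<lambda>z. g z (gsharp z) v) x w = deriv_along (\<lambda>z. gam z v) x w"
    by (simp add: frechet_derivative_cong_open[OF A.open_S x g_gsharp])
  ultimately show ?thesis
    by (simp add: A.deriv_g[OF x] cov_gsharp_def cov_form_def bilinear_lsub[OF b] bilinear_ladd[OF b]
        bilinear_lmul[OF b] g_gsharp[OF x])
qed

lemma deriv_Dif:
  assumes x: "x \<in> S"
  shows "((\<lambda>z. Dif z u v) has_derivative (\<lambda>w. deriv_along (\<lambda>z. gam z u) x w *\<^sub>R v
    + deriv_along (\<lambda>z. gam z v) x w *\<^sub>R u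
    - (g x u v *\<^sub>R deriv_along gsharp x w + deriv_along (\<lambda>z. g z u v) x w *\<^sub>R gsharp x))) (at x)"
  unfolding Dif_def
  by (intro has_derivative_diff has_derivative_add has_derivative_scaleR_left has_derivative_scaleR
      has_derivative_deriv_along gam_diff A.g_diff gsharp_diff x)

text \<open>The weights 2 of \<open>g\<close> and -2 of \<open>gsharp\<close> cancel in their
  product, and \<open>g\<close> is parallel; only \<gamma> and its dual vector get
  differentiated.\<close>

lemma cov_Dif:
  assumes x: "x \<in> S"
  shows "deriv_along (\<lambda>z. Dif z u v) x w + G x w (Dif x u v) - Dif x (G x w u) v - Dif x u (G x w v)
    = cov_form gam G x w u *\<^sub>R v + cov_form gam G x w v *\<^sub>R u - g x u v *\<^sub>R cov_gsharp x w"
proof -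
  note B = A.G_bilinear[OF x]
  show ?thesis
    unfolding deriv_along_eqI[OF deriv_Dif[OF x]] A.deriv_g[OF x]
    by (simp add: Dif_def cov_form_def cov_gsharp_def bilinear_radd[OF B] bilinear_rsub[OF B]
        bilinear_rmul[OF B] algebra_simps)
qed

lemma deriv_G':
  assumes x: "x \<in> S"
  shows "deriv_along (\<lambda>z. G' z u v) x w
    = deriv_along (\<lambda>z. G z u v) x w + deriv_along (\<lambda>z. Dif z u v) x w"
proof -
  have "deriv_along (\<lambda>z. G' z u v) x = deriv_along (\<lambda>z. G z u v + Dif z u v) x"
    by (rule frechet_derivative_cong_open[OF A.open_S x]) (simp add: connection_change Dif_def)
  also have "\<dots> = (\<lambda>w. deriv_along (\<lambda>z. G z u v) x w + deriv_along (\<lambda>z. Dif z u v) x w)"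
    using deriv_Dif[OF x] x
    by (intro deriv_along_eqI has_derivative_add has_derivative_deriv_along A.G_diff) (auto intro: differentiableI)
  finally show ?thesis by simp
qed

lemma Dif_bilinear: assumes x: "x \<in> S" shows "bilinear (Dif x)"
  using gam_linear[OF x] A.g_bilinear[OF x]
  unfolding bilinear_def Dif_def
  by (simp add: linear_iff algebra_simps)

text \<open>The formula R' = R + d D + [D, D] for the curvature of \<nabla> + D, with d the
  covariant exterior derivative. The terms in which \<open>G\<close> acts on the two form arguments
  cancel because \<open>G\<close> is symmetric.\<close>

lemma curv_change:
  assumes x: "x \<in> S"
  shows "curv G' (\<lambda>_. w) (\<lambda>_. u) (\<lambda>_. v) x = curv G (\<lambda>_. w) (\<lambda>_. u) (\<lambda>_. v) x
    + (cov_form gam G x w u *\<^sub>R v + cov_form gam G x w v *\<^sub>R u - g x u v *\<^sub>R cov_gsharp x w)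
    - (cov_form gam G x u w *\<^sub>R v + cov_form gam G x u v *\<^sub>R w - g x w v *\<^sub>R cov_gsharp x u)
    + Dif x w (Dif x u v) - Dif x u (Dif x w v)"
proof -
  note B = A.G_bilinear[OF x] and D = Dif_bilinear[OF x]
  have G': "G' x u v = G x u v + Dif x u v" for u v
    by (simp add: connection_change[OF x] Dif_def)
  have Ds: "Dif x u v = Dif x v u" for u v
    using inner_formD(2)[OF A.g_inner[OF x], of u v] by (simp add: Dif_def)
  show ?thesis
    unfolding cov_Dif[OF x, symmetric] curv_const[of G x, OF B] curv_const[of G' x, OF B.G_bilinear[OF x]] deriv_G'[OF x] G'
    using Ds[of w "G x u v"] Ds[of u "G x w v"] A.G_sym[OF x, of u w]
    by (simp add: bilinear_radd[OF B] bilinear_radd[OF D])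
qed

lemma cov_form_linear:
  assumes x: "x \<in> S"
  shows "linear (\<lambda>w. cov_form gam G x w v)" "linear (\<lambda>v. cov_form gam G x w v)"
proof -
  note L = linear_deriv_along[OF gam_diff[OF x], unfolded linear_iff]
    linear_deriv_along_param[OF A.open_S x gam_linear gam_diff[OF x], unfolded linear_iff]
    gam_linear[OF x, unfolded linear_iff] and B = A.G_bilinear[OF x]
  show "linear (\<lambda>w. cov_form gam G x w v)" "linear (\<lambda>v. cov_form gam G x w v)"
    unfolding cov_form_def linear_iff
    by (simp_all add: L bilinear_ladd[OF B] bilinear_radd[OF B] bilinear_lmul[OF B]
        bilinear_rmul[OF B] algebra_simps)
qed

text \<open>Traced over \<open>w\<close>, the change of the curvature falls into \<nabla>\<gamma>,
  its transpose, \<gamma> \<otimes> \<gamma> and multiples of \<open>g\<close>, which are all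
  collected in \<open>t\<close>. The transpose differs from \<nabla>\<gamma> by the change of the
  Faraday form.\<close>

lemma ricci_change:
  assumes x: "x \<in> S"
  shows "\<exists>t. \<forall>u v. ricci G' x u v = ricci G x u v + cov_form gam G x v u
    + (1 - real CARD('m)) * cov_form gam G x u v + (real CARD('m) - 2) * (gam x u * gam x v) + t * g x u v"
proof (intro exI allI)
  fix u v
  let ?m = "real CARD('m)"
  let ?C = "\<lambda>w. curv G (\<lambda>_. w) (\<lambda>_. u) (\<lambda>_. v) x"
  let ?S = "cov_form gam G x"
  \<comment> \<open>The squared length of \<gamma>.\<close>
  define n where "n = gam x (gsharp x)"
  define X where "X = Dif x u v"
  note gb = A.g_bilinear[OF x] and gl = gam_linear[OF x] and sl = cov_form_linear[OF x]
    and D = Dif_bilinear[OF x]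
  have g_sym: "g x a b = g x b a" for a b using A.g_inner[OF x] by (rule inner_formD)
  have gg: "g x a (gsharp x) = gam x a" for a using g_gsharp[OF x] g_sym by metis
  have Y: "Dif x u (gsharp x) = n *\<^sub>R u" by (simp add: Dif_def n_def gg)
  have gX: "gam x X = 2 * gam x u * gam x v - g x u v * n"
    by (simp add: X_def Dif_def n_def linear_add[OF gl] linear_diff[OF gl] linear_scale[OF gl])
  have Dw: "Dif x w X = gam x w *\<^sub>R X + gam x X *\<^sub>R w - g x w X *\<^sub>R gsharp x" for w
    by (simp add: Dif_def)
  have "Dif x u (Dif x w v) = gam x w *\<^sub>R X + gam x v *\<^sub>R Dif x u w - g x w v *\<^sub>R (n *\<^sub>R u)" for w
    unfolding Y[symmetric] by (subst (2) Dif_def) (simp add: bilinear_radd[OF D] bilinear_rsub[OF D] bilinear_rmul[OF D] X_def)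
  then have Du: "Dif x u (Dif x w v) = gam x w *\<^sub>R X
      + gam x v *\<^sub>R (gam x u *\<^sub>R w + gam x w *\<^sub>R u - g x u w *\<^sub>R gsharp x) - g x w v *\<^sub>R (n *\<^sub>R u)" for w
    by (simp add: Dif_def)
  have rk: "tr_end (\<lambda>w. gam x w *\<^sub>R z) = gam x z" "tr_end (\<lambda>w. ?S w a *\<^sub>R z) = ?S z a"
    "tr_end (\<lambda>w. ?S a w *\<^sub>R z) = ?S a z" "tr_end (\<lambda>w. g x w a *\<^sub>R z) = g x z a"
    "tr_end (\<lambda>w. g x a w *\<^sub>R z) = g x a z" for z a
    using gb gl sl by (simp_all add: tr_end_rank_one bilinear_linear)
  have "ricci G' x u v = tr_end (\<lambda>w. ?C w + (?S w u *\<^sub>R v + ?S w v *\<^sub>R u - g x u v *\<^sub>R cov_gsharp x w)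
     - (?S u w *\<^sub>R v + ?S u v *\<^sub>R w - g x w v *\<^sub>R cov_gsharp x u)
     + (gam x w *\<^sub>R X + gam x X *\<^sub>R w - g x w X *\<^sub>R gsharp x)
     - (gam x w *\<^sub>R X + gam x v *\<^sub>R (gam x u *\<^sub>R w + gam x w *\<^sub>R u - g x u w *\<^sub>R gsharp x)
        - g x w v *\<^sub>R (n *\<^sub>R u)))"
    unfolding ricci_def curv_change[OF x] Dw Du X_def[symmetric] ..
  also have "\<dots> = ricci G x u v + (?S v u + ?S u v - g x u v * tr_end (cov_gsharp x))
     - (?S u v + ?S u v * ?m - g x (cov_gsharp x u) v)
     + (gam x X + gam x X * ?m - g x (gsharp x) X)
     - (gam x X + gam x v * (gam x u * ?m + gam x u - g x u (gsharp x)) - g x (n *\<^sub>R u) v)"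
    by (simp only: tr_end_add tr_end_diff tr_end_scaleR rk tr_end_id ricci_def)
  also have "\<dots> = ricci G x u v + ?S v u + (1 - ?m) * ?S u v + (?m - 2) * (gam x u * gam x v)
      + (- tr_end (cov_gsharp x) - (?m - 2) * gam x (gsharp x)) * g x u v"
    by (simp add: g_cov_gsharp[OF x] g_gsharp[OF x] gg gX bilinear_lmul[OF gb] n_def[symmetric] algebra_simps)
  finally show "ricci G' x u v = ricci G x u v + ?S v u + (1 - ?m) * ?S u v
      + (?m - 2) * (gam x u * gam x v)
      + (- tr_end (cov_gsharp x) - (?m - 2) * gam x (gsharp x)) * g x u v" .
qed

text \<open>After symmetrisation the coefficients 1 and 1 - m of \<nabla>\<gamma> and its transpose
  add up to -(m - 2), which matches the coefficient of the quadratic term.\<close>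

lemma symm_ricci_change:
  assumes x: "x \<in> S"
  shows "\<exists>t. \<forall>u v. symm (ricci G' x) u v = symm (ricci G x) u v
    - (real CARD('m) - 2) * (symm (cov_form gam G x) u v - gam x u * gam x v) + t * g x u v"
proof -
  obtain t where t: "\<And>u v. ricci G' x u v = ricci G x u v + cov_form gam G x v u
    + (1 - real CARD('m)) * cov_form gam G x u v + (real CARD('m) - 2) * (gam x u * gam x v) + t * g x u v"
    using ricci_change[OF x] by blast
  have "g x v u = g x u v" for u v using A.g_inner[OF x] by (rule inner_formD)
  then show ?thesis
    by (intro exI[of _ t]) (simp add: symm_def t field_simps)
qed

end

text \<open>The first-order terms that \<gamma> brings in through \<open>a\<close> and through
  \<open>C\<close> cancel, precisely because the line bundle has weight 1. What remains is of order
  zero, apart from the term with \<open>b\<close>; in the applications \<open>b\<close> is the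
  metric on \<open>u\<close> and \<open>v\<close>, and \<open>n\<close> is the vector dual to
  \<gamma>.\<close>

lemma hess_gen_change:
  assumes S: "open S" "y \<in> S"
    and a: "\<And>z v. z \<in> S \<Longrightarrow> a' z v = a z v + \<gamma> z v" "\<And>v. (\<lambda>z. a z v) differentiable at y"
    and \<gamma>: "linear (\<gamma> y)" "linear (a y)" "\<And>v. (\<lambda>z. \<gamma> z v) differentiable at y"
    and l: "smooth_on S l"
    and C: "C' y u v = C y u v + \<gamma> y u *\<^sub>R v + \<gamma> y v *\<^sub>R u - b *\<^sub>R n"
  shows "hess_gen a' C' l y u v = hess_gen a C l y u v
    + (cov_form \<gamma> C y u v - \<gamma> y u * \<gamma> y v) * l y + b * (deriv_along l y n + a' y n * l y)"
proof -
  have dl: "l differentiable at y" by (rule smooth_on_imp_differentiable[OF l S(2)])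
  have ddl: "(\<lambda>z. deriv_along l z v) differentiable at y"
    by (rule smooth_on_imp_differentiable[OF smooth_on_deriv_along[OF l] S(2)])
  note L = linear_deriv_along[OF dl]
  have "deriv_along (\<lambda>z. deriv_along l z v + a' z v * l z) y
      = deriv_along (\<lambda>z. (deriv_along l z v + a z v * l z) + \<gamma> z v * l z) y"
    by (rule frechet_derivative_cong_open[OF S]) (simp add: a(1) algebra_simps)
  also have "\<dots> = (\<lambda>u. deriv_along (\<lambda>z. deriv_along l z v + a z v * l z) y u
      + (\<gamma> y v * deriv_along l y u + deriv_along (\<lambda>z. \<gamma> z v) y u * l y))"
    by (intro deriv_along_eqI has_derivative_add has_derivative_mult has_derivative_deriv_along
        differentiable_add differentiable_mult dl ddl a \<gamma>)
  finally have 1: "deriv_along (\<lambda>z. deriv_along l z v + a' z v * l z) y u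
      = deriv_along (\<lambda>z. deriv_along l z v + a z v * l z) y u
      + (\<gamma> y v * deriv_along l y u + deriv_along (\<lambda>z. \<gamma> z v) y u * l y)" by simp
  show ?thesis
    unfolding hess_gen_def 1 a(1)[OF S(2)] C cov_form_def
    by (simp add: linear_add[OF L] linear_diff[OF L] linear_scale[OF L] linear_add[OF \<gamma>(1)]
        linear_diff[OF \<gamma>(1)] linear_scale[OF \<gamma>(1)] linear_add[OF \<gamma>(2)] linear_diff[OF \<gamma>(2)]
        linear_scale[OF \<gamma>(2)] algebra_simps)
qed

text \<open>Multiplication with \<open>w\<close> changes the trivialisation of the line bundle: it
  adds dw / w to the connection form and leaves \<open>C\<close> alone.\<close>

lemma hess_gen_scale:
  assumes S: "open S" "y \<in> S" and w: "smooth_on S w" "\<And>z. z \<in> S \<Longrightarrow> w z \<noteq> 0"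
    and a: "\<And>v. (\<lambda>z. a z v) differentiable at y"
    and l: "smooth_on S l"
  shows "hess_gen a C (\<lambda>z. w z * l z) y u v
    = w y * hess_gen (\<lambda>z v. a z v + deriv_along w z v / w z) C l y u v"
proof -
  \<comment> \<open>The covariant derivative of \<open>l\<close> for the new connection
    form.\<close>
  define \<theta> where "\<theta> = (\<lambda>v z. deriv_along l z v + (a z v + deriv_along w z v / w z) * l z)"
  have dw: "(w has_derivative deriv_along w z) (at z)" and dl: "(l has_derivative deriv_along l z) (at z)"
    if "z \<in> S" for z using w l that by (auto intro: smooth_on_has_derivative)
  have 1: "deriv_along (\<lambda>z. w z * l z) z v + a z v * (w z * l z) = w z * \<theta> v z" if "z \<in> S" for z v
    using deriv_along_eqI[OF has_derivative_mult[OF dw[OF that] dl[OF that]]] w(2)[OF that]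
    by (simp add: \<theta>_def field_simps)
  have "\<theta> v differentiable at y"
    unfolding \<theta>_def
    by (intro differentiable_add differentiable_mult differentiable_divide a
        smooth_on_imp_differentiable[OF smooth_on_deriv_along[OF l] S(2)]
        smooth_on_imp_differentiable[OF smooth_on_deriv_along[OF w(1)] S(2)]
        smooth_on_imp_differentiable[OF l S(2)] smooth_on_imp_differentiable[OF w(1) S(2)] w(2) S(2))
  then have "((\<lambda>z. w z * \<theta> v z) has_derivative (\<lambda>u. w y * deriv_along (\<theta> v) y u + deriv_along w y u * \<theta> v y)) (at y)"
    by (intro has_derivative_mult dw S has_derivative_deriv_along)
  then have "deriv_along (\<lambda>z. w z * \<theta> v z) y u = w y * deriv_along (\<theta> v) y u + deriv_along w y u * \<theta> v y"
    by (simp add: deriv_along_eqI)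
  moreover have "deriv_along (\<lambda>z. deriv_along (\<lambda>z. w z * l z) z v + a z v * (w z * l z)) y u
      = deriv_along (\<lambda>z. w z * \<theta> v z) y u"
    by (rule arg_cong[where f="\<lambda>D. D u"], rule frechet_derivative_cong_open[OF S 1])
  ultimately have "hess_gen a C (\<lambda>z. w z * l z) y u v
     = w y * deriv_along (\<theta> v) y u + deriv_along w y u * \<theta> v y + a y u * (w y * \<theta> v y) - w y * \<theta> (C y u v) y"
    by (simp only: hess_gen_def 1[OF S(2)])
  also have "\<dots> = w y * (deriv_along (\<theta> v) y u + (a y u + deriv_along w y u / w y) * \<theta> v y - \<theta> (C y u v) y)"
    using w(2)[OF S(2)] by (simp add: field_simps)
  also have "\<dots> = w y * hess_gen (\<lambda>z v. a z v + deriv_along w z v / w z) C l y u v"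
    by (simp add: hess_gen_def \<theta>_def)
  finally show ?thesis .
qed

text \<open>For symmetric \<open>C\<close> the antisymmetric part of a Hessian is the curvature of
  the line bundle.\<close>

lemma hess_gen_antisym:
  fixes l :: "'e::real_normed_vector \<Rightarrow> real"
  assumes S: "open S" "y \<in> S" and l: "smooth_on S l"
    and a: "\<And>v. (\<lambda>z. a z v) differentiable at y" and C: "C y u v = C y v u"
  shows "hess_gen a C l y u v - hess_gen a C l y v u
    = (deriv_along (\<lambda>z. a z v) y u - deriv_along (\<lambda>z. a z u) y v) * l y"
proof -
  have 1: "deriv_along (\<lambda>z. deriv_along l z v + a z v * l z) y u
      = deriv_along (\<lambda>z. deriv_along l z v) y u
      + (a y v * deriv_along l y u + deriv_along (\<lambda>z. a z v) y u * l y)" for u v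
    by (subst deriv_along_eqI[OF has_derivative_add[OF has_derivative_deriv_along has_derivative_mult[OF has_derivative_deriv_along has_derivative_deriv_along]]])
      (simp_all add: a smooth_on_imp_differentiable[OF l S(2)]
          smooth_on_imp_differentiable[OF smooth_on_deriv_along[OF l] S(2)])
  show ?thesis
    unfolding hess_gen_def 1 C deriv_along_commute[OF S(1) l S(2), of v u]
    by (simp add: algebra_simps)
qed

section \<open>Slice charts\<close>

lemma incl_nth: "incl y $ Inl i = y $ i" "incl y $ Inr j = 0"
  by (simp_all add: incl_def)

lemma linear_incl: "linear (incl :: real ^ 'n::finite \<Rightarrow> real ^ ('n + 'k::finite))"
  by (rule linearI) (simp_all add: incl_def vec_eq_iff split: sum.splits)

lemma bounded_linear_incl: "bounded_linear (incl :: real ^ 'n::finite \<Rightarrow> real ^ ('n + 'k::finite))"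
  using linear_incl linear_conv_bounded_linear by blast

lemma incl_eq_iff [simp]: "incl u = incl v \<longleftrightarrow> u = v"
  by (metis incl_nth(1) vec_eq_iff)

lemma incl_zero [simp]: "incl 0 = 0"
  using linear_incl by (rule linear_0)

lemma has_derivative_incl: "(incl has_derivative incl) (at y)"
  by (rule bounded_linear_imp_has_derivative[OF bounded_linear_incl])

lemma has_derivative_compose_incl:
  assumes "f differentiable at (incl y)"
  shows "((\<lambda>z. f (incl z)) has_derivative (\<lambda>u. deriv_along f (incl y) (incl u))) (at y)"
  by (rule has_derivative_compose[OF has_derivative_incl has_derivative_deriv_along[OF assms]])

lemma deriv_along_compose_incl:
  assumes "f differentiable at (incl y)"
  shows "deriv_along (\<lambda>z. f (incl z)) y u = deriv_along f (incl y) (incl u)"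
  by (simp add: deriv_along_eqI[OF has_derivative_compose_incl[OF assms]])

lemma hess_gen_cong:
  assumes "open S" "y \<in> S" "\<And>z v. z \<in> S \<Longrightarrow> a z v = a' z v" "\<And>z. z \<in> S \<Longrightarrow> l z = l' z"
    "C y u v = C' y u v"
  shows "hess_gen a C l y u v = hess_gen a' C' l' y u v"
proof -
  have 1: "deriv_along l z = deriv_along l' z" if "z \<in> S" for z
    using frechet_derivative_cong_open[OF assms(1) that assms(4)] .
  have "deriv_along (\<lambda>z. deriv_along l z v + a z v * l z) y = deriv_along (\<lambda>z. deriv_along l' z v + a' z v * l' z) y"
    by (rule frechet_derivative_cong_open[OF assms(1,2)]) (simp add: 1 assms(3,4))
  then show ?thesis by (simp add: hess_gen_def 1 assms)
qed

locale slice_chart = weyl_chart S G g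
  for S :: "(real ^ ('n::finite + 'k::finite)) set" and G g
begin

definition T :: "(real ^ 'n) set" where "T = {y. incl y \<in> S}"

abbreviation tf :: "real ^ 'n \<Rightarrow> real ^ 'n \<Rightarrow> real ^ 'n \<Rightarrow> real" where "tf \<equiv> tan_form g"
abbreviation w :: "real ^ 'n \<Rightarrow> real" where "w \<equiv> weight_factor g"
abbreviation GN :: "real ^ 'n \<Rightarrow> real ^ 'n \<Rightarrow> real ^ 'n \<Rightarrow> real ^ 'n" where "GN \<equiv> christoffel_N g G"
abbreviation B :: "real ^ 'n \<Rightarrow> real ^ 'n \<Rightarrow> real ^ 'n \<Rightarrow> real ^ ('n + 'k)" where "B \<equiv> fund_form g G"

definition gN :: "real ^ 'n \<Rightarrow> real ^ 'n \<Rightarrow> real ^ 'n \<Rightarrow> real" where "gN y u v = tf y u v / (w y)\<^sup>2"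

lemma T_iff: "y \<in> T \<longleftrightarrow> incl y \<in> S" by (simp add: T_def)

lemma open_T: "open T"
proof -
  have "T = incl -` S" by (auto simp: T_def)
  then show ?thesis
    using open_S linear_continuous_on[OF bounded_linear_incl, of UNIV]
    by (metis continuous_open_vimage continuous_on_eq_continuous_at open_UNIV UNIV_I)
qed

lemma smooth_on_compose_incl: "smooth_on S f \<Longrightarrow> smooth_on T (\<lambda>y. f (incl y))"
  by (rule smooth_on_compose[OF _ smooth_on_bounded_linear_id[OF bounded_linear_incl] open_T open_S])
    (simp_all add: T_iff)

lemma g_sym: "y \<in> S \<Longrightarrow> g y u v = g y v u"
  using g_inner inner_formD(2) by blast

lemma tf_inner: assumes "y \<in> T" shows "inner_form (tf y)"
proof -
  note b = g_bilinear[OF assms[unfolded T_iff]]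
  have "bilinear (tf y)"
    unfolding bilinear_def tan_form_def
    by (simp add: linear_iff linear_add[OF linear_incl] linear_scale[OF linear_incl]
        bilinear_ladd[OF b] bilinear_radd[OF b] bilinear_lmul[OF b] bilinear_rmul[OF b])
  moreover have "tf y u v = tf y v u" for u v
    unfolding tan_form_def using assms by (intro g_sym) (simp add: T_iff)
  moreover have "tf y u u > 0" if "u \<noteq> 0" for u
    using inner_formD(3)[OF g_inner[OF assms[unfolded T_iff]], of "incl u"] that
      incl_eq_iff[of u 0] by (auto simp: tan_form_def)
  ultimately show ?thesis by (simp add: inner_form_def)
qed

lemma tf_bilinear: "y \<in> T \<Longrightarrow> bilinear (tf y)" using tf_inner inner_formD(1) by blast

lemma tf_smooth: "smooth_on T (\<lambda>y. tf y u v)"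
  unfolding tan_form_def by (rule smooth_on_compose_incl[OF g_smooth])

lemma normal_vec_iff: "normal_vec g y \<xi> \<longleftrightarrow> (\<forall>v. g (incl y) \<xi> (incl v) = 0)"
  by (simp add: normal_vec_def)

lemma g_tan_linear: "y \<in> T \<Longrightarrow> linear (\<lambda>v. g (incl y) \<xi> (incl v))"
  using linear_compose[OF linear_incl bilinear_linear(1)[OF g_bilinear]] by (simp add: T_iff o_def)

text \<open>Normality of \<xi> - incl u says that \<open>u\<close> represents the restriction to
  \<open>N\<close> of the form dual to \<xi>. Exactly one \<open>u\<close> does so, which resolves
  the definite description.\<close>

lemma tan_part_eq:
  assumes y: "y \<in> T"
  shows "tan_part g y \<xi> = sharp (tf y) (\<lambda>v. g (incl y) \<xi> (incl v))" (is "_ = ?u")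
proof -
  note b = g_bilinear[OF y[unfolded T_iff]]
  have n: "normal_vec g y (\<xi> - incl u) \<longleftrightarrow> (\<forall>v. tf y u v = g (incl y) \<xi> (incl v))" for u
    by (auto simp: normal_vec_iff bilinear_lsub[OF b] tan_form_def)
  have "tf y ?u v = g (incl y) \<xi> (incl v)" for v
    using y by (intro sharp_works tf_inner g_tan_linear)
  then show ?thesis
    unfolding tan_part_def
  proof (intro the_equality)
    show "u = ?u" if "normal_vec g y (\<xi> - incl u)" for u
      using that unfolding n by (intro sharp_eqI[OF tf_inner[OF y], symmetric]) blast
  qed (simp add: n)
qed

lemma tf_tan_part: "y \<in> T \<Longrightarrow> tf y (tan_part g y \<xi>) v = g (incl y) \<xi> (incl v)"
  unfolding tan_part_eq by (intro sharp_works tf_inner g_tan_linear)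

lemma tan_part_eqI:
  "y \<in> T \<Longrightarrow> (\<And>v. tf y u v = g (incl y) \<xi> (incl v)) \<Longrightarrow> tan_part g y \<xi> = u"
  unfolding tan_part_eq by (rule sharp_eqI[OF tf_inner])

lemma tan_part_linear: assumes y: "y \<in> T" shows "linear (tan_part g y)"
proof -
  note b = g_bilinear[OF y[unfolded T_iff]] and t = tf_bilinear[OF y]
  show ?thesis
    by (rule linearI; rule tan_part_eqI[OF y])
      (simp_all add: bilinear_ladd[OF t] bilinear_lmul[OF t] tf_tan_part[OF y] bilinear_ladd[OF b] bilinear_lmul[OF b])
qed

lemma tan_part_incl: "y \<in> T \<Longrightarrow> tan_part g y (incl u) = u"
  by (rule tan_part_eqI) (simp_all add: tan_form_def)

lemma tan_part_smooth: "smooth_on T X \<Longrightarrow> smooth_on T (\<lambda>y. tan_part g y (X y))"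
proof (rule smooth_on_cong[OF _ open_T tan_part_eq[symmetric]])
  assume X: "smooth_on T X"
  have "smooth_on T (\<lambda>y. g (incl y) (X y) (incl v))" for v
    by (rule smooth_on_linear_family[OF open_T _ _ X, of "\<lambda>y a. g (incl y) a (incl v)"])
      (simp_all add: smooth_on_compose_incl[OF g_smooth] bilinear_linear g_bilinear T_iff)
  then show "smooth_on T (\<lambda>y. sharp (tf y) (\<lambda>v. g (incl y) (X y) (incl v)))"
    by (intro smooth_on_sharp open_T tf_inner tf_smooth)
qed

lemma g_nor_part:
  assumes y: "y \<in> T"
  shows "g (incl y) (nor_part g y \<xi>) (incl v) = 0" "g (incl y) (incl v) (nor_part g y \<xi>) = 0"
proof -
  note b = g_bilinear[OF y[unfolded T_iff]]
  show 1: "g (incl y) (nor_part g y \<xi>) (incl v) = 0"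
    using tf_tan_part[OF y, of \<xi> v] by (simp add: nor_part_def bilinear_lsub[OF b] tan_form_def)
  then show "g (incl y) (incl v) (nor_part g y \<xi>) = 0"
    using g_sym y by (simp add: T_iff)
qed

lemma nor_part_linear: "y \<in> T \<Longrightarrow> linear (nor_part g y)"
  unfolding nor_part_def[abs_def]
  using linear_compose[OF tan_part_linear linear_incl]
  by (intro linear_compose_sub linear_ident) (simp add: o_def)

lemma nor_part_incl: "y \<in> T \<Longrightarrow> nor_part g y (incl u) = 0"
  by (simp add: nor_part_def tan_part_incl)

lemma nor_part_smooth: "smooth_on T X \<Longrightarrow> smooth_on T (\<lambda>y. nor_part g y (X y))"
  unfolding nor_part_def
  by (intro smooth_on_diff open_T smooth_on_bounded_linear[OF tan_part_smooth open_T bounded_linear_incl])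

lemma GN_eq: "GN y u v = tan_part g y (G (incl y) (incl u) (incl v))"
  by (simp add: christoffel_N_def nabla_N_def along_vec_def)

lemma B_eq: "B y u v = nor_part g y (G (incl y) (incl u) (incl v))"
  by (simp add: fund_form_def along_vec_def)

lemma G_decomp: "G (incl y) (incl u) (incl v) = incl (GN y u v) + B y u v"
  by (simp add: GN_eq B_eq nor_part_def)

lemma GN_bilinear: assumes y: "y \<in> T" shows "bilinear (GN y)"
proof -
  note b = G_bilinear[OF y[unfolded T_iff]] and t = tan_part_linear[OF y]
  show ?thesis
    unfolding bilinear_def GN_eq
    by (simp add: linear_iff linear_add[OF linear_incl] linear_scale[OF linear_incl] linear_add[OF t] linear_scale[OF t]
        bilinear_ladd[OF b] bilinear_radd[OF b] bilinear_lmul[OF b] bilinear_rmul[OF b])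
qed

lemma B_bilinear: assumes y: "y \<in> T" shows "bilinear (B y)"
proof -
  note b = G_bilinear[OF y[unfolded T_iff]] and t = nor_part_linear[OF y]
  show ?thesis
    unfolding bilinear_def B_eq
    by (simp add: linear_iff linear_add[OF linear_incl] linear_scale[OF linear_incl] linear_add[OF t] linear_scale[OF t]
        bilinear_ladd[OF b] bilinear_radd[OF b] bilinear_lmul[OF b] bilinear_rmul[OF b])
qed

lemma B_sym: "y \<in> T \<Longrightarrow> B y u v = B y v u"
  unfolding B_eq using G_sym T_iff by metis

lemma G_incl_smooth: "smooth_on T (\<lambda>y. G (incl y) a b)"
  by (rule smooth_on_compose_incl[OF G_smooth])

lemma B_smooth: "smooth_on T (\<lambda>y. B y u v)"
  unfolding B_eq by (rule nor_part_smooth[OF G_incl_smooth])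

sublocale N: connection_chart T GN
proof
  show "GN y u v = GN y v u" if "y \<in> T" for y u v
    unfolding GN_eq using G_sym that T_iff by metis
  show "smooth_on T (\<lambda>y. GN y u v)" for u v
    unfolding GN_eq by (rule tan_part_smooth[OF G_incl_smooth])
qed (use open_T GN_bilinear in auto)

text \<open>The restriction of \<nabla> c = 0 to tangent vectors of \<open>N\<close>: the normal
  parts of the Christoffel symbols drop out, but the weight term is still that of
  \<open>L\<^sub>M\<close>.\<close>

lemma deriv_tf:
  assumes y: "y \<in> T"
  shows "deriv_along (\<lambda>z. tf z u v) y a
    = tf y (GN y a u) v + tf y u (GN y a v) - 2 * conn_form G (incl y) (incl a) * tf y u v"
proof -
  note b = g_bilinear[OF y[unfolded T_iff]] and yS = y[unfolded T_iff]
  have "deriv_along (\<lambda>z. tf z u v) y a = deriv_along (\<lambda>x. g x (incl u) (incl v)) (incl y) (incl a)"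
    unfolding tan_form_def by (rule deriv_along_compose_incl[OF g_diff[OF yS]])
  then show ?thesis
    unfolding deriv_g[OF yS] G_decomp
    by (simp add: bilinear_ladd[OF b] bilinear_radd[OF b] B_eq g_nor_part[OF y] tan_form_def)
qed

section \<open>The weight factor and the induced Weyl structure\<close>

lemma w_pos: assumes "y \<in> T" shows "w y > 0"
  using det_gram_pos[OF tf_inner[OF assms]] by (simp add: weight_factor_def)

lemma w_smooth: "smooth_on T w"
  unfolding weight_factor_def
proof (intro smooth_on_powr smooth_on_det open_T)
  show "smooth_on T (\<lambda>y. gram (tf y) $ p $ q)" for p q by (simp add: gram_def tf_smooth)
  show "det (gram (tf y)) > 0" if "y \<in> T" for y by (rule det_gram_pos[OF tf_inner[OF that]])
qed

text \<open>\<open>w\<close> is the 2n-th root of a Gram determinant, so Jacobi's formula gives its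
  logarithmic derivative as 1 / (2n) times the trace of \<open>deriv_tf\<close>. Both metric terms
  there have trace \<open>tr_end (GN y a)\<close>, and the weight term contributes -2n times the
  ambient connection form.\<close>

lemma deriv_w:
  assumes y: "y \<in> T"
  shows "deriv_along w y a = (conn_form GN y a - conn_form G (incl y) (incl a)) * w y"
proof -
  let ?n = "real CARD('n)" and ?q = "\<lambda>u v. deriv_along (\<lambda>z. tf z u v) y a"
  have pos: "det (gram (tf y)) > 0" by (rule det_gram_pos[OF tf_inner[OF y]])
  have "((\<lambda>z. gram (tf z)) has_derivative (\<lambda>a. gram (\<lambda>u v. deriv_along (\<lambda>z. tf z u v) y a))) (at y)"
    by (rule has_derivative_matrix_entries)
      (simp add: gram_def smooth_on_has_derivative[OF tf_smooth y])
  from has_derivative_det[OF this] pos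
  have "((\<lambda>z. det (gram (tf z))) has_derivative (\<lambda>a. det (gram (tf y)) *
    trace (matrix_inv (gram (tf y)) ** gram (\<lambda>u v. deriv_along (\<lambda>z. tf z u v) y a)))) (at y)" by simp
  moreover have "trace (matrix_inv (gram (tf y)) ** gram (\<lambda>u v. deriv_along (\<lambda>z. tf z u v) y a))
     = 2 * (?n * (conn_form GN y a - conn_form G (incl y) (incl a)))" for a
  proof -
    let ?q = "\<lambda>u v. deriv_along (\<lambda>z. tf z u v) y a"
    have "trace (matrix_inv (gram (tf y)) ** gram ?q) = tr_form (tf y) (\<lambda>u v. ?q v u)"
      by (simp add: trace_def matrix_matrix_mult_def tr_form_def gram_def)
    also have "\<dots> = tr_form (tf y) ?q" by (rule tr_form_flip[OF tf_inner[OF y]])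
    also have "\<dots> = tr_form (tf y) (\<lambda>u v. tf y (GN y a u) v) + tr_form (tf y) (\<lambda>u v. tf y u (GN y a v))
        - 2 * conn_form G (incl y) (incl a) * ?n"
      unfolding deriv_tf[OF y] tr_form_add tr_form_diff tr_form_mult tr_form_self[OF tf_inner[OF y]] ..
    also have "tr_form (tf y) (\<lambda>u v. tf y u (GN y a v)) = tr_form (tf y) (\<lambda>u v. tf y (GN y a u) v)"
    proof -
      have "(\<lambda>u v. tf y u (GN y a v)) = (\<lambda>u v. tf y (GN y a v) u)"
        by (intro ext) (rule inner_formD(2)[OF tf_inner[OF y]])
      then show ?thesis using tr_form_flip[OF tf_inner[OF y], of "\<lambda>u v. tf y (GN y a u) v"] by simp
    qed
    also have "tr_form (tf y) (\<lambda>u v. tf y (GN y a u) v) = tr_end (GN y a)"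
      by (rule tr_form_eqI[OF tf_inner[OF y]]) simp
    finally show ?thesis by (simp add: conn_form_def algebra_simps)
  qed
  ultimately have d: "((\<lambda>z. det (gram (tf z))) has_derivative (\<lambda>a. det (gram (tf y)) *
    (2 * (?n * (conn_form GN y a - conn_form G (incl y) (incl a)))))) (at y)" by simp
  have "((\<lambda>t. t powr (1 / (2 * ?n))) has_real_derivative (1 / (2 * ?n)) * det (gram (tf y)) powr (1 / (2 * ?n) - 1))
      (at (det (gram (tf y))))"
    by (rule has_real_derivative_powr[OF pos])
  then have "(w has_derivative (\<lambda>a. (1 / (2 * ?n)) * det (gram (tf y)) powr (1 / (2 * ?n) - 1) * (det (gram (tf y)) *
    (2 * (?n * (conn_form GN y a - conn_form G (incl y) (incl a))))))) (at y)"
    unfolding weight_factor_def[abs_def] has_field_derivative_def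
    using has_derivative_compose[OF d] by blast
  then have "deriv_along w y a = (1 / (2 * ?n)) * det (gram (tf y)) powr (1 / (2 * ?n) - 1) * (det (gram (tf y)) *
    (2 * (?n * (conn_form GN y a - conn_form G (incl y) (incl a)))))"
    by (simp only: deriv_along_eqI)
  also have "\<dots> = (det (gram (tf y)) powr (1 / (2 * ?n) - 1) * det (gram (tf y))) * (conn_form GN y a - conn_form G (incl y) (incl a))"
    by (simp add: field_simps)
  also have "det (gram (tf y)) powr (1 / (2 * ?n) - 1) * det (gram (tf y)) = w y"
    using pos by (simp add: weight_factor_def powr_diff)
  finally show ?thesis by simp
qed

text \<open>In other words, the isomorphism of \<open>L\<^sub>N\<close> with the restriction of
  \<open>L\<^sub>M\<close> is parallel.\<close>

lemma conn_form_GN: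
  assumes y: "y \<in> T"
  shows "conn_form G (incl y) (incl a) + deriv_along w y a / w y = conn_form GN y a"
  using w_pos[OF y] by (simp add: deriv_w[OF y])

lemma gN_inner: "y \<in> T \<Longrightarrow> inner_form (gN y)"
  using inner_form_scale[OF tf_inner, of y "1 / (w y)\<^sup>2"] w_pos[of y]
  by (simp add: gN_def[abs_def])

lemma tracefree_gN: "y \<in> T \<Longrightarrow> tracefree (gN y) q u v = tracefree (tf y) q u v"
  using tracefree_scale_form[OF tf_inner, of y "1 / (w y)\<^sup>2" q u v] w_pos[of y]
  by (simp add: gN_def[abs_def])

lemma gN_smooth: "smooth_on T (\<lambda>y. gN y u v)"
  unfolding gN_def power2_eq_square
  by (intro smooth_on_divide smooth_on_mult tf_smooth w_smooth open_T) (use w_pos in fastforce)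

text \<open>Dividing by the square of \<open>w\<close> exchanges, in \<open>deriv_tf\<close>, the
  connection form of \<open>L\<^sub>M\<close> for that of \<open>L\<^sub>N\<close>.\<close>

sublocale N: weyl_chart T GN gN
proof
  fix y a u v assume y: "y \<in> T"
  have "((\<lambda>z. tf z u v / (w z)\<^sup>2) has_derivative (\<lambda>h. - tf y u v * (inverse ((w y)\<^sup>2) *
      (2 * w y * deriv_along w y h) * inverse ((w y)\<^sup>2)) + deriv_along (\<lambda>z. tf z u v) y h / (w y)\<^sup>2)) (at y)"
    using w_pos[OF y]
    by (intro has_derivative_divide has_derivative_deriv_along
        smooth_on_imp_differentiable[OF tf_smooth y])
       (auto intro!: derivative_eq_intros has_derivative_deriv_along smooth_on_imp_differentiable[OF w_smooth y])
  from deriv_along_eqI[OF this]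
  have "deriv_along (\<lambda>z. gN z u v) y a = - tf y u v * (inverse ((w y)\<^sup>2) *
      (2 * w y * deriv_along w y a) * inverse ((w y)\<^sup>2)) + deriv_along (\<lambda>z. tf z u v) y a / (w y)\<^sup>2"
    by (simp add: gN_def)
  also have "\<dots> = (tf y (GN y a u) v + tf y u (GN y a v) - 2 * conn_form GN y a * tf y u v) / (w y)\<^sup>2"
    unfolding deriv_w[OF y] deriv_tf[OF y] using w_pos[OF y]
    by (simp add: field_simps power2_eq_square)
  finally show "cov_conf GN gN (\<lambda>_. a) (\<lambda>_. u) (\<lambda>_. v) y = 0"
    by (simp add: cov_conf_const[of GN, OF GN_bilinear[OF y]] gN_def add_divide_distrib diff_divide_distrib mult_ac)
qed (use gN_inner gN_smooth in auto)

end

definition ind_zero_order ::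
    "(real ^ ('n::finite + 'k::finite) \<Rightarrow> real ^ ('n + 'k) \<Rightarrow> real ^ ('n + 'k) \<Rightarrow> real)
      \<Rightarrow> (real ^ ('n + 'k) \<Rightarrow> real ^ ('n + 'k) \<Rightarrow> real ^ ('n + 'k) \<Rightarrow> real ^ ('n + 'k))
      \<Rightarrow> real ^ 'n \<Rightarrow> real ^ 'n \<Rightarrow> real ^ 'n \<Rightarrow> real" where
  "ind_zero_order g G y u v =
     (1 / (real CARD('n + 'k) - 2)) *
       tracefree (tan_form g y) (\<lambda>u v. symm (ricci G (incl y)) (incl u) (incl v)) u v
     + mean_curv g G y (fund_form0 g G y u v)"

section \<open>The mean curvature and the trace-free fundamental form\<close>

context slice_chart
begin

abbreviation H :: "real ^ 'n \<Rightarrow> real ^ ('n + 'k)" where "H \<equiv> mean_curv_vec g G"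
abbreviation B0 :: "real ^ 'n \<Rightarrow> real ^ 'n \<Rightarrow> real ^ 'n \<Rightarrow> real ^ ('n + 'k)" where "B0 \<equiv> fund_form0 g G"

lemma g_B_normal: "y \<in> T \<Longrightarrow> g (incl y) (B y u v) (incl a) = 0" "y \<in> T \<Longrightarrow> g (incl y) (incl a) (B y u v) = 0"
  unfolding B_eq by (rule g_nor_part; assumption)+

lemma g_nor_part_B:
  assumes y: "y \<in> T"
  shows "g (incl y) (nor_part g y \<xi>) (B y u v) = g (incl y) \<xi> (B y u v)"
  using g_B_normal(2)[OF y] by (simp add: nor_part_def bilinear_lsub[OF g_bilinear[OF y[unfolded T_iff]]])

text \<open>Differentiating \<open>g (nor \<xi>) v = 0\<close> along \<open>N\<close> shows that the shape operator is adjoint to the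
  fundamental form.\<close>

lemma mean_curv_eq:
  assumes y: "y \<in> T"
  shows "mean_curv g G y \<xi> = (1 / real CARD('n)) * tr_form (tf y) (\<lambda>u v. g (incl y) (B y u v) \<xi>)"
proof -
  note b = g_bilinear[OF y[unfolded T_iff]] and yS = y[unfolded T_iff] and Gb = G_bilinear[OF y[unfolded T_iff]]
  define X where "X = (\<lambda>z. nor_part g z \<xi>)"
  have X: "smooth_on T X" unfolding X_def by (rule nor_part_smooth[OF smooth_on_const])
  define R where "R = (\<lambda>u. tan_part g y (along_vec G (\<lambda>_. u) X y))"
  have "tf y (R u) v = - g (incl y) (B y u v) \<xi>" for u v
  proof -
    have "((\<lambda>z. g (incl z) (X z) (incl v)) has_derivative (\<lambda>u. deriv_along (\<lambda>z. g (incl z) (X y) (incl v)) y u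
        + g (incl y) (deriv_along X y u) (incl v))) (at y)"
      by (rule has_derivative_linear_family[OF open_T y, of "\<lambda>z a. g (incl z) a (incl v)"])
        (simp_all add: bilinear_linear g_bilinear T_iff smooth_on_has_derivative[OF X y]
          smooth_on_imp_differentiable[OF smooth_on_compose_incl[OF g_smooth] y])
    from deriv_along_eqI[OF this]
    have "deriv_along (\<lambda>z. g (incl z) (X z) (incl v)) y u
        = deriv_along (\<lambda>z. g (incl z) (X y) (incl v)) y u + g (incl y) (deriv_along X y u) (incl v)" by simp
    moreover have "deriv_along (\<lambda>z. g (incl z) (X z) (incl v)) y = deriv_along (\<lambda>z. 0) y"
      by (rule frechet_derivative_cong_open[OF open_T y]) (simp add: X_def g_nor_part)
    moreover have "deriv_along (\<lambda>z. g (incl z) (X y) (incl v)) y u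
        = g (incl y) (G (incl y) (incl u) (X y)) (incl v) + g (incl y) (X y) (G (incl y) (incl u) (incl v))
          - 2 * conn_form G (incl y) (incl u) * g (incl y) (X y) (incl v)"
      unfolding deriv_g[OF yS, symmetric] by (rule deriv_along_compose_incl[OF g_diff[OF yS]])
    moreover have "g (incl y) (X y) (incl a) = 0" for a by (simp add: X_def g_nor_part[OF y])
    ultimately have "g (incl y) (deriv_along X y u + G (incl y) (incl u) (X y)) (incl v)
        = - g (incl y) (X y) (B y u v)"
      by (simp add: bilinear_ladd[OF b] bilinear_radd[OF b] G_decomp)
    also have "g (incl y) (X y) (B y u v) = g (incl y) (B y u v) \<xi>"
      using g_nor_part_B[OF y] g_sym[OF yS] by (simp add: X_def)
    finally show ?thesis by (simp add: R_def tf_tan_part[OF y] along_vec_def)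
  qed
  then have "tr_end R = tr_form (tf y) (\<lambda>u v. - g (incl y) (B y u v) \<xi>)"
    by (intro tr_form_eqI[OF tf_inner[OF y], symmetric])
  also have "\<dots> = - tr_form (tf y) (\<lambda>u v. g (incl y) (B y u v) \<xi>)"
    using tr_form_mult[of "tf y" "-1" "\<lambda>u v. g (incl y) (B y u v) \<xi>"] by simp
  finally show ?thesis by (simp add: mean_curv_def R_def X_def)
qed

lemma mean_curv_linear: assumes y: "y \<in> T" shows "linear (mean_curv g G y)"
proof -
  note b = g_bilinear[OF y[unfolded T_iff]]
  show ?thesis
    by (rule linearI) (simp_all add: mean_curv_eq[OF y] bilinear_radd[OF b] bilinear_rmul[OF b] tr_form_add
        tr_form_mult algebra_simps)
qed

lemma mean_curv_incl: "y \<in> T \<Longrightarrow> mean_curv g G y (incl a) = 0"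
  by (simp add: mean_curv_eq g_B_normal tr_form_def)

lemma mean_curv_nor_part: assumes y: "y \<in> T" shows "mean_curv g G y (nor_part g y \<xi>) = mean_curv g G y \<xi>"
  by (simp add: nor_part_def linear_diff[OF mean_curv_linear[OF y]] mean_curv_incl[OF y])

text \<open>The mean curvature form vanishes on TN, so its dual vector is normal. Conversely, a
  normal vector with the right values on normal vectors has the right values on all vectors.\<close>

lemma mean_curv_vec_eq:
  assumes y: "y \<in> T"
  shows "H y = sharp (g (incl y)) (mean_curv g G y)" (is "_ = ?h")
proof -
  have h: "g (incl y) ?h \<xi> = mean_curv g G y \<xi>" for \<xi>
    using y by (intro sharp_works g_inner mean_curv_linear) (simp_all add: T_iff)
  show ?thesis
    unfolding mean_curv_vec_def
  proof (intro the_equality conjI allI impI)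
    show "normal_vec g y ?h" by (simp add: normal_vec_iff h mean_curv_incl[OF y])
    fix W assume W: "normal_vec g y W \<and> (\<forall>\<xi>. normal_vec g y \<xi> \<longrightarrow> g (incl y) W \<xi> = mean_curv g G y \<xi>)"
    note b = g_bilinear[OF y[unfolded T_iff]]
    have "g (incl y) W \<xi> = mean_curv g G y \<xi>" for \<xi>
    proof -
      have "g (incl y) W \<xi> = g (incl y) W (nor_part g y \<xi>)"
        using W by (simp add: nor_part_def bilinear_rsub[OF b] normal_vec_iff)
      also have "\<dots> = mean_curv g G y (nor_part g y \<xi>)"
        using W g_nor_part[OF y] by (simp add: normal_vec_iff)
      finally show ?thesis by (simp add: mean_curv_nor_part[OF y])
    qed
    then show "W = ?h"
      using y by (intro sharp_eqI[symmetric] g_inner) (auto simp: T_iff)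
  qed (rule h)
qed

lemma g_mean_curv_vec:
  assumes y: "y \<in> T" shows "g (incl y) (H y) \<xi> = mean_curv g G y \<xi>"
  unfolding mean_curv_vec_eq[OF y]
  using y by (intro sharp_works g_inner mean_curv_linear) (simp_all add: T_iff)

text \<open>Represent \<phi> by a vector \<open>z\<close>: the trace is n times the mean curvature
  at \<open>z\<close>, which is \<phi> at the mean curvature vector. The lemma serves for \<phi> the
  change of the connection form, the mean curvature form, and the derivative of an extended
  section.\<close>

lemma tr_form_B:
  assumes y: "y \<in> T" and \<phi>: "linear \<phi>"
  shows "tr_form (tf y) (\<lambda>u v. \<phi> (B y u v)) = real CARD('n) * \<phi> (H y)"
proof -
  define z where "z = sharp (g (incl y)) \<phi>"
  have yS: "incl y \<in> S" using y by (simp add: T_iff)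
  have z: "g (incl y) z \<xi> = \<phi> \<xi>" "g (incl y) \<xi> z = \<phi> \<xi>" for \<xi>
    unfolding z_def using sharp_works[OF g_inner[OF yS] \<phi>] g_sym[OF yS] by metis+
  have "\<phi> (H y) = mean_curv g G y z" using g_mean_curv_vec[OF y, of z] z by simp
  then show ?thesis by (simp add: mean_curv_eq[OF y] z)
qed

lemma tracefree_B:
  assumes y: "y \<in> T" and \<phi>: "linear \<phi>"
  shows "tracefree (tf y) (\<lambda>u v. \<phi> (B y u v)) u v = \<phi> (B0 y u v)"
  unfolding tracefree_def tr_form_B[OF assms]
  by (simp add: fund_form0_def linear_diff[OF \<phi>] linear_scale[OF \<phi>])

lemma tr_form_B0:
  assumes y: "y \<in> T" and \<phi>: "linear \<phi>"
  shows "tr_form (tf y) (\<lambda>u v. \<phi> (B0 y u v)) = 0"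
  unfolding tracefree_B[OF assms, symmetric] by (rule tr_form_tracefree[OF tf_inner[OF y]])

lemma B0_bilinear: assumes y: "y \<in> T" shows "bilinear (B0 y)"
  using B_bilinear[OF y] tf_bilinear[OF y]
  unfolding bilinear_def fund_form0_def linear_iff by (simp add: algebra_simps)

lemma B0_sym: "y \<in> T \<Longrightarrow> B0 y u v = B0 y v u"
  using B_sym[of y u v] inner_formD(2)[OF tf_inner, of y u v] by (simp add: fund_form0_def)

lemma mean_curv_smooth: "smooth_on T (\<lambda>y. mean_curv g G y \<xi>)"
proof -
  have "smooth_on T (\<lambda>y. g (incl y) (B y u v) \<xi>)" for u v
    by (rule smooth_on_linear_family[OF open_T _ _ B_smooth, of "\<lambda>y a. g (incl y) a \<xi>"])
      (simp_all add: smooth_on_compose_incl[OF g_smooth] bilinear_linear g_bilinear T_iff)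
  then have "smooth_on T (\<lambda>y. (1 / real CARD('n)) * tr_form (tf y) (\<lambda>u v. g (incl y) (B y u v) \<xi>))"
    by (intro smooth_on_mult smooth_on_const smooth_on_tr_form open_T tf_inner tf_smooth)
  then show ?thesis by (rule smooth_on_cong[OF _ open_T]) (simp add: mean_curv_eq)
qed

lemma H_smooth: "smooth_on T H"
proof -
  have "smooth_on T (\<lambda>y. sharp (g (incl y)) (mean_curv g G y))"
    by (intro smooth_on_sharp open_T smooth_on_compose_incl[OF g_smooth] mean_curv_smooth)
      (simp add: g_inner T_iff)
  then show ?thesis by (rule smooth_on_cong[OF _ open_T]) (simp add: mean_curv_vec_eq)
qed

lemma B0_smooth: "smooth_on T (\<lambda>y. B0 y u v)"
  unfolding fund_form0_def by (intro smooth_on_diff smooth_on_scaleR B_smooth tf_smooth H_smooth open_T)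

lemma mean_curv_B0_smooth: "smooth_on T (\<lambda>y. mean_curv g G y (B0 y u v))"
  by (rule smooth_on_linear_family[OF open_T mean_curv_linear mean_curv_smooth B0_smooth])

section \<open>The induced operator in a slice chart\<close>

lemma ricci_tan_bilinear:
  assumes y: "y \<in> T" shows "bilinear (\<lambda>u v. symm (ricci G (incl y)) (incl u) (incl v))"
  using bilinear_symm[OF ricci_bilinear[OF y[unfolded T_iff]]]
  by (simp add: bilinear_def linear_iff linear_add[OF linear_incl] linear_scale[OF linear_incl])

lemma ind_zero_order_smooth: "smooth_on T (\<lambda>y. ind_zero_order g G y u v)"
  unfolding ind_zero_order_def
  by (intro smooth_on_add smooth_on_mult smooth_on_const smooth_on_tracefree open_T tf_inner tf_smooth
      mean_curv_B0_smooth smooth_on_compose_incl smooth_on_symm ricci_smooth open_S)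

lemma ind_zero_order_bilinear:
  assumes y: "y \<in> T" shows "bilinear (ind_zero_order g G y)"
proof -
  have 1: "bilinear (tracefree (tf y) (\<lambda>u v. symm (ricci G (incl y)) (incl u) (incl v)))"
    by (rule bilinear_tracefree[OF tf_bilinear[OF y] ricci_tan_bilinear[OF y]])
  note B = B0_bilinear[OF y] and m = mean_curv_linear[OF y]
  show ?thesis
    unfolding bilinear_def ind_zero_order_def
    by (simp add: linear_iff bilinear_ladd[OF B] bilinear_radd[OF B] bilinear_lmul[OF B] bilinear_rmul[OF B]
        linear_add[OF m] linear_scale[OF m] bilinear_ladd[OF 1] bilinear_radd[OF 1] bilinear_lmul[OF 1] bilinear_rmul[OF 1])
      (simp add: add_divide_distrib algebra_simps)
qed

lemma ind_zero_order_sym: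
  assumes y: "y \<in> T" shows "ind_zero_order g G y u v = ind_zero_order g G y v u"
  using inner_formD(2)[OF tf_inner[OF y], of u v]
  by (simp add: ind_zero_order_def tracefree_def symm_def add.commute B0_sym[OF y, of u v])

lemma ind_zero_order_tr:
  assumes y: "y \<in> T" shows "tr_form (gN y) (ind_zero_order g G y) = 0"
proof -
  have "tr_form (tf y) (ind_zero_order g G y) = 0"
    unfolding ind_zero_order_def[abs_def] tr_form_add tr_form_mult
    using tr_form_tracefree[OF tf_inner[OF y]] tr_form_B0[OF y mean_curv_linear[OF y]] by simp
  moreover have "gN y = (\<lambda>u v. (1 / (w y)\<^sup>2) * tf y u v)" by (simp add: gN_def fun_eq_iff)
  ultimately show ?thesis
    using tr_form_scale_form[OF tf_inner[OF y], of "1 / (w y)\<^sup>2"] w_pos[OF y]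
    by simp
qed

lemma hess_bar_eq: "hess_bar g G (\<lambda>_. u) (\<lambda>_. v) l y
    = hess_gen (\<lambda>y v. conn_form G (incl y) (incl v)) GN l y u v"
  by (simp add: hess_bar_def along_dens_def[abs_def] hess_gen_def conn_form_def christoffel_N_def)

lemma conn_incl_diff:
  "y \<in> T \<Longrightarrow> (\<lambda>z. conn_form G (incl z) (incl v)) differentiable at y"
  using smooth_on_compose_incl[OF conn_form_smooth] by (rule smooth_on_imp_differentiable)

lemma hess_gen_weight:
  assumes y: "y \<in> T" and l: "smooth_on T l"
  shows "hess_gen (\<lambda>y v. conn_form G (incl y) (incl v)) GN (\<lambda>z. w z * l z) y u v = w y * hess_form GN l y u v"
proof -
  have "hess_gen (\<lambda>y v. conn_form G (incl y) (incl v)) GN (\<lambda>z. w z * l z) y u v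
     = w y * hess_gen (\<lambda>z v. conn_form G (incl z) (incl v) + deriv_along w z v / w z) GN l y u v"
    by (rule hess_gen_scale[OF open_T y w_smooth _ conn_incl_diff[OF y] l]) (use w_pos in fastforce)
  also have "hess_gen (\<lambda>z v. conn_form G (incl z) (incl v) + deriv_along w z v / w z) GN l y u v
     = hess_form GN l y u v"
    unfolding hess_form_eq_gen by (rule hess_gen_cong[OF open_T y]) (simp_all add: conn_form_GN)
  finally show ?thesis .
qed

lemma faraday_conn_incl:
  assumes y: "y \<in> T"
  shows "deriv_along (\<lambda>z. conn_form G (incl z) (incl v)) y u - deriv_along (\<lambda>z. conn_form G (incl z) (incl u)) y v
    = faraday G (incl y) (incl u) (incl v)"
  using y[unfolded T_iff]
  by (simp add: faraday_eq[of G, OF G_bilinear]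
      deriv_along_compose_incl[OF conn_form_diff])

lemma hess_form_GN_antisym:
  assumes y: "y \<in> T" and l: "smooth_on T l"
  shows "hess_form GN l y u v - hess_form GN l y v u = faraday GN y u v * l y"
  unfolding hess_form_eq_gen faraday_eq[of GN, OF GN_bilinear[OF y]]
  by (rule hess_gen_antisym[OF open_T y l], rule N.conn_form_diff[OF y], rule N.G_sym[OF y])

text \<open>The constant section 1 of \<open>L\<^sub>N\<close> corresponds to the section
  \<open>w\<close> of \<open>L\<^sub>M\<close>. Comparing the antisymmetric parts of their Hessians
  gives both curvatures and avoids differentiating dw / w.\<close>

lemma faraday_GN:
  assumes y: "y \<in> T"
  shows "faraday GN y u v = faraday G (incl y) (incl u) (incl v)"
proof -
  let ?a = "\<lambda>y v. conn_form G (incl y) (incl v)"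
  have "w y * faraday GN y u v = w y * (hess_form GN (\<lambda>_. 1) y u v - hess_form GN (\<lambda>_. 1) y v u)"
    using hess_form_GN_antisym[OF y smooth_on_const, of 1] by simp
  also have "\<dots> = hess_gen ?a GN w y u v - hess_gen ?a GN w y v u"
    using hess_gen_weight[OF y smooth_on_const, of 1] by (simp add: right_diff_distrib)
  also have "\<dots> = faraday G (incl y) (incl u) (incl v) * w y"
    unfolding faraday_conn_incl[OF y, symmetric]
    by (rule hess_gen_antisym[OF open_T y w_smooth], rule conn_incl_diff[OF y], rule N.G_sym[OF y])
  finally show ?thesis using w_pos[OF y] by simp
qed

text \<open>The trace subtracted in the definition of h is the one over TM, so restricted to
  \<open>N\<close> it is merely a multiple of the metric and goes into \<open>t\<close> together
  with the scalar curvature.\<close>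

lemma schouten_weyl_tan_eq:
  "\<exists>t. \<forall>u v. schouten_weyl_tan g G y u v =
     (1 / (real CARD('n + 'k) - 2)) * symm (ricci G (incl y)) (incl u) (incl v)
     + t * tf y u v - (1 / 2) * faraday G (incl y) (incl u) (incl v)"
proof (intro exI allI)
  fix u v
  let ?m = "real CARD('n + 'k)"
  define p q where "p = 1 / (?m - 2)" and "q = 1 / ?m"
  define \<tau> where "\<tau> = tr_form (g (incl y)) (symm (ricci G (incl y)))"
  show "schouten_weyl_tan g G y u v =
     (1 / (?m - 2)) * symm (ricci G (incl y)) (incl u) (incl v)
     + (- (1 / (?m - 2)) * ((1 / ?m) * tr_form (g (incl y)) (symm (ricci G (incl y))))
        + (1 / ?m) * sigma G g (incl y)) * tf y u v - (1 / 2) * faraday G (incl y) (incl u) (incl v)"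
    unfolding schouten_weyl_tan_def schouten_weyl_def tracefree_def tan_form_def
      p_def[symmetric] q_def[symmetric] \<tau>_def[symmetric]
    by (simp add: algebra_simps)
qed

lemma tracefree_schouten_weyl_tan:
  assumes y: "y \<in> T"
  shows "tracefree (tf y) (schouten_weyl_tan g G y) u v
    = (1 / (real CARD('n + 'k) - 2)) * tracefree (tf y) (\<lambda>u v. symm (ricci G (incl y)) (incl u) (incl v)) u v
      - (1 / 2) * faraday GN y u v"
proof -
  obtain t where t: "\<And>u v. schouten_weyl_tan g G y u v =
     (1 / (real CARD('n + 'k) - 2)) * symm (ricci G (incl y)) (incl u) (incl v)
     + t * tf y u v - (1 / 2) * faraday G (incl y) (incl u) (incl v)"
    using schouten_weyl_tan_eq[of y] by blast
  have e: "schouten_weyl_tan g G y = (\<lambda>u v. (1 / (real CARD('n + 'k) - 2)) * symm (ricci G (incl y)) (incl u) (incl v)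
     + t * tf y u v - (1 / 2) * faraday GN y u v)"
    by (simp only: fun_eq_iff t faraday_GN[OF y] simp_thms)
  have "tracefree (tf y) (faraday GN y) u v = faraday GN y u v"
    by (rule tracefree_antisym[OF tf_inner[OF y]]) (simp add: faraday_eq[of GN, OF GN_bilinear[OF y]])
  then show ?thesis
    unfolding e tracefree_add tracefree_diff tracefree_mult tracefree_self[OF tf_inner[OF y]] by simp
qed

lemma tracefree_hess_form_GN:
  assumes y: "y \<in> T" and l: "smooth_on T l"
  shows "tracefree (tf y) (hess_form GN l y) u v = hess0 GN gN l y u v + (1 / 2) * faraday GN y u v * l y"
proof -
  have "tracefree (tf y) (hess_form GN l y) u v - tracefree (tf y) (symm (hess_form GN l y)) u v
     = (hess_form GN l y u v - hess_form GN l y v u) / 2"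
    by (simp add: tracefree_def tr_form_symm[OF tf_inner[OF y]] symm_def field_simps)
  then show ?thesis
    unfolding hess_form_GN_antisym[OF y l] hess0_def
      tracefree_gN[OF y] by simp
qed

lemma ind_moebius_local_eq:
  assumes y: "y \<in> T" and l: "smooth_on T l"
  shows "ind_moebius_local g G (\<lambda>z. w z * l z) y u v
    = w y * (hess0 GN gN l y u v + ind_zero_order g G y u v * l y)"
proof -
  have "P_form g G (\<lambda>z. w z * l z) y = (\<lambda>u v. w y * (hess_form GN l y u v + l y * schouten_weyl_tan g G y u v))"
    unfolding fun_eq_iff P_form_def hess_bar_eq hess_gen_weight[OF y l]
    by (simp add: distrib_left)
  then have "tracefree (tf y) (P_form g G (\<lambda>z. w z * l z) y) u v
     = w y * (tracefree (tf y) (hess_form GN l y) u v + l y * tracefree (tf y) (schouten_weyl_tan g G y) u v)"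
    by (simp only: tracefree_mult tracefree_add)
  then show ?thesis
    unfolding ind_moebius_local_def tracefree_hess_form_GN[OF y l] tracefree_schouten_weyl_tan[OF y] ind_zero_order_def
    by (simp add: algebra_simps)
qed

text \<open>The ambient Hessian subtracts the derivative along all of \<nabla>_X Y, whereas
  \<open>hess_bar\<close> subtracts only the tangential part. The difference is the derivative along
  the fundamental form; its trace-free part is what the additional term along \<open>B0\<close>
  restores.\<close>

lemma ind_moebius_ext_eq:
  assumes y: "y \<in> T" and V: "open V" "incl y \<in> V" "V \<subseteq> S" and l': "smooth_on V l'"
    and L: "\<And>z. incl z \<in> V \<Longrightarrow> l' (incl z) = L z"
  shows "ind_moebius_ext g G l' y u v = ind_moebius_local g G L y u v"
proof -
  define V' :: "(real ^ 'n) set" where "V' = incl -` V"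
  have V': "open V'" "y \<in> V'"
    using V linear_continuous_on[OF bounded_linear_incl, of UNIV] unfolding V'_def
    by (auto intro: continuous_open_vimage simp: continuous_on_eq_continuous_at)
  have yS: "incl y \<in> S" using y by (simp add: T_iff)
  \<comment> \<open>The covariant derivative of the extension as a linear form on all ambient
    vectors, so that \<open>tracefree_B\<close> applies to it.\<close>
  define \<phi> where "\<phi> = (\<lambda>\<xi>. cov_dens G 1 (\<lambda>_. \<xi>) l' (incl y))"
  have \<phi>: "\<phi> \<xi> = deriv_along l' (incl y) \<xi> + conn_form G (incl y) \<xi> * l' (incl y)" for \<xi>
    by (simp add: \<phi>_def cov_dens_def conn_form_def)
  have dl: "l' differentiable at x" if "x \<in> V" for x by (rule smooth_on_imp_differentiable[OF l' that])
  have l\<phi>: "linear \<phi>"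
    using linear_deriv_along[OF dl[OF V(2)]] conn_form_linear[OF yS]
    by (simp add: linear_iff \<phi> algebra_simps)
  have dL: "deriv_along L z a = deriv_along l' (incl z) (incl a)" if "z \<in> V'" for z a
  proof -
    have "deriv_along L z = deriv_along (\<lambda>z. l' (incl z)) z"
      by (rule frechet_derivative_cong_open[OF V'(1) that]) (simp add: V'_def L)
    then show ?thesis using that by (simp add: deriv_along_compose_incl[OF dl] V'_def)
  qed
  have Ly: "L y = l' (incl y)" using L V(2) by simp
  have "hess_form G l' (incl y) (incl u) (incl v) = hess_bar g G (\<lambda>_. u) (\<lambda>_. v) L y - \<phi> (B y u v)" for u v
  proof -
    have "(\<lambda>x. deriv_along l' x (incl v) + conn_form G x (incl v) * l' x) differentiable at (incl y)"
      by (intro differentiable_add differentiable_mult dl V(2) conn_form_diff[OF yS]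
        smooth_on_imp_differentiable[OF smooth_on_deriv_along[OF l']])
    from deriv_along_compose_incl[OF this]
    have "deriv_along (\<lambda>x. deriv_along l' x (incl v) + conn_form G x (incl v) * l' x) (incl y) (incl u)
       = deriv_along (\<lambda>z. deriv_along l' (incl z) (incl v) + conn_form G (incl z) (incl v) * l' (incl z)) y u" by simp
    also have "deriv_along (\<lambda>z. deriv_along l' (incl z) (incl v) + conn_form G (incl z) (incl v) * l' (incl z)) y
       = deriv_along (\<lambda>z. deriv_along L z v + conn_form G (incl z) (incl v) * L z) y"
      by (rule frechet_derivative_cong_open[OF V']) (simp add: dL, simp add: L V'_def)
    finally have 1: "deriv_along (\<lambda>x. deriv_along l' x (incl v) + conn_form G x (incl v) * l' x) (incl y) (incl u)
       = deriv_along (\<lambda>z. deriv_along L z v + conn_form G (incl z) (incl v) * L z) y u" .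
    have "hess_form G l' (incl y) (incl u) (incl v)
      = deriv_along (\<lambda>z. deriv_along L z v + conn_form G (incl z) (incl v) * L z) y u
       + conn_form G (incl y) (incl u) * (deriv_along L y v + conn_form G (incl y) (incl v) * L y)
       - \<phi> (G (incl y) (incl u) (incl v))"
      by (simp only: hess_form_eq_gen hess_gen_def 1 \<phi> dL[OF V'(2)] Ly)
    also have "\<phi> (G (incl y) (incl u) (incl v)) = \<phi> (incl (GN y u v)) + \<phi> (B y u v)"
      unfolding G_decomp by (rule linear_add[OF l\<phi>])
    also have "\<phi> (incl (GN y u v)) = deriv_along L y (GN y u v) + conn_form G (incl y) (incl (GN y u v)) * L y"
      by (simp only: \<phi> dL[OF V'(2)] Ly)
    finally show ?thesis by (simp add: hess_bar_eq hess_gen_def)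
  qed
  then have e: "(\<lambda>u' v'. hess_form G l' (incl y) (incl u') (incl v'))
      = (\<lambda>u v. hess_bar g G (\<lambda>_. u) (\<lambda>_. v) L y - \<phi> (B y u v))" by simp
  have P: "P_form g G L y = (\<lambda>u v. hess_bar g G (\<lambda>_. u) (\<lambda>_. v) L y + L y * schouten_weyl_tan g G y u v)"
    by (simp add: fun_eq_iff P_form_def)
  show ?thesis
    unfolding ind_moebius_ext_def ind_moebius_local_def e P tracefree_diff tracefree_add tracefree_mult
      tracefree_B[OF y l\<phi>] Ly[symmetric] by (simp add: \<phi>_def)
qed

end

section \<open>Independence of the Weyl structure in a chart\<close>

context weyl_chart
begin

lemma tracefree_symm_schouten_weyl:
  assumes x: "x \<in> S"
  shows "tracefree (g x) (symm (schouten_weyl G g x)) u v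
    = (1 / (real CARD('m) - 2)) * tracefree (g x) (symm (ricci G x)) u v"
proof -
  let ?t = "tracefree (g x) (symm (ricci G x))"
  have e: "symm (schouten_weyl G g x) = (\<lambda>u v. (1 / (real CARD('m) - 2)) * ?t u v
      + (1 / real CARD('m) * sigma G g x) * g x u v)"
  proof (intro ext)
    fix u v
    have "g x v u = g x u v" "faraday G x v u = - faraday G x u v" "?t v u = ?t u v"
      using inner_formD(2)[OF g_inner[OF x], of u v]
      by (simp_all add: faraday_eq[of G, OF G_bilinear[OF x]] tracefree_def symm_def add.commute)
    then show "symm (schouten_weyl G g x) u v = (1 / (real CARD('m) - 2)) * ?t u v
      + (1 / real CARD('m) * sigma G g x) * g x u v"
      by (simp add: symm_def[of "schouten_weyl G g x"] schouten_weyl_def mult.commute)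
  qed
  show ?thesis
    unfolding e tracefree_add tracefree_mult tracefree_self[OF g_inner[OF x]]
    by (simp add: tracefree_trivial tr_form_tracefree g_inner[OF x])
qed

end

context weyl_change
begin

text \<open>The zero-order change of the symmetrised Hessian on \<open>L\<close>, up to multiples of
  the metric.\<close>

definition dzero :: "real ^ 'm \<Rightarrow> real ^ 'm \<Rightarrow> real ^ 'm \<Rightarrow> real" where
  "dzero x u v = symm (cov_form gam G x) u v - gam x u * gam x v"

lemma hess0_change:
  assumes x: "x \<in> S" and l: "smooth_on S l"
  shows "hess0 G' g l x u v = hess0 G g l x u v + tracefree (g x) (dzero x) u v * l x"
proof -
  define K where "K = deriv_along l x (gsharp x) + conn_form G' x (gsharp x) * l x"
  have 1: "hess_form G' l x u v = hess_form G l x u v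
      + (cov_form gam G x u v - gam x u * gam x v) * l x + g x u v * K" for u v
    unfolding hess_form_eq_gen K_def
    by (rule hess_gen_change[OF A.open_S x], simp add: gam_def, rule A.conn_form_diff[OF x],
        rule gam_linear[OF x], rule A.conn_form_linear[OF x], rule gam_diff[OF x], rule l,
        rule connection_change[OF x])
  have "g x v u = g x u v" for u v by (rule inner_formD(2)[OF A.g_inner[OF x]])
  then have e: "symm (hess_form G' l x) = (\<lambda>u v. symm (hess_form G l x) u v + l x * dzero x u v + K * g x u v)"
    by (simp add: fun_eq_iff symm_def 1 dzero_def field_simps)
  show ?thesis
    unfolding hess0_def e tracefree_add tracefree_mult tracefree_self[OF A.g_inner[OF x]] by simp
qed

lemma tracefree_symm_ricci_change:
  assumes x: "x \<in> S"
  shows "tracefree (g x) (symm (ricci G' x)) u v = tracefree (g x) (symm (ricci G x)) u v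
    - (real CARD('m) - 2) * tracefree (g x) (dzero x) u v"
proof -
  obtain t where t: "\<And>u v. symm (ricci G' x) u v = symm (ricci G x) u v
    - (real CARD('m) - 2) * dzero x u v + t * g x u v"
    using symm_ricci_change[OF x] unfolding dzero_def by blast
  have e: "symm (ricci G' x) = (\<lambda>u v. symm (ricci G x) u v
    - (real CARD('m) - 2) * dzero x u v + t * g x u v)" by (intro ext) (rule t)
  show ?thesis
    unfolding e tracefree_add tracefree_diff tracefree_mult tracefree_self[OF A.g_inner[OF x]] by simp
qed

lemma canonical_moebius_change:
  assumes x: "x \<in> S" and l: "smooth_on S l" and m: "CARD('m) \<ge> 3"
  shows "hess0 G' g l x u v + tracefree (g x) (symm (schouten_weyl G' g x)) u v * l x
    = hess0 G g l x u v + tracefree (g x) (symm (schouten_weyl G g x)) u v * l x"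
proof -
  have "real CARD('m) - 2 \<noteq> 0" using m by simp
  then show ?thesis
    unfolding hess0_change[OF x l] A.tracefree_symm_schouten_weyl[OF x] B.tracefree_symm_schouten_weyl[OF x]
      tracefree_symm_ricci_change[OF x]
    by (simp add: field_simps)
qed

lemma dzero_smooth: "smooth_on S (\<lambda>x. dzero x u v)"
proof -
  have "smooth_on S (\<lambda>x. gam x (G x u v))" for u v
    by (rule smooth_on_linear_family[OF A.open_S gam_linear gam_smooth A.G_smooth])
  then have "smooth_on S (\<lambda>x. cov_form gam G x u v)" for u v
    unfolding cov_form_def by (intro smooth_on_diff smooth_on_deriv_along gam_smooth A.open_S)
  then show ?thesis
    unfolding dzero_def
    by (intro smooth_on_diff smooth_on_symm smooth_on_mult gam_smooth A.open_S)
qed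

lemma dzero_bilinear: assumes x: "x \<in> S" shows "bilinear (dzero x)"
proof -
  have "bilinear (cov_form gam G x)" using cov_form_linear[OF x] by (simp add: bilinear_def)
  from bilinear_symm[OF this] show ?thesis
    using gam_linear[OF x] unfolding dzero_def by (simp add: bilinear_def linear_iff algebra_simps)
qed

lemma dzero_sym: "dzero x u v = dzero x v u"
  by (simp add: dzero_def symm_def mult.commute add.commute)

end

section \<open>Change of the Weyl structure along a submanifold\<close>

locale slice_change = A: slice_chart S G g + B: slice_chart S G' g
  for S :: "(real ^ ('n::finite + 'k::finite)) set" and G G' g
begin

sublocale M: weyl_change S G G' g ..
sublocale N: weyl_change A.T A.GN B.GN A.gN ..

text \<open>The weight factor depends on the metric alone, so dw / w cancels in the difference of
  the connection forms.\<close>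

lemma gam_N: "y \<in> A.T \<Longrightarrow> N.gam y u = M.gam (incl y) (incl u)"
  using A.conn_form_GN[of y u] B.conn_form_GN[of y u] by (simp add: N.gam_def M.gam_def)

lemma cov_gam_N:
  assumes y: "y \<in> A.T"
  shows "cov_form M.gam G (incl y) (incl u) (incl v) = cov_form N.gam A.GN y u v - M.gam (incl y) (A.B y u v)"
proof -
  have yS: "incl y \<in> S" using y by (simp add: A.T_iff)
  have "deriv_along (\<lambda>z. N.gam z v) y = deriv_along (\<lambda>z. M.gam (incl z) (incl v)) y"
    by (rule frechet_derivative_cong_open[OF A.open_T y gam_N])
  then show ?thesis
    by (simp add: cov_form_def deriv_along_compose_incl[OF M.gam_diff[OF yS]] A.G_decomp
        linear_add[OF M.gam_linear[OF yS]] gam_N[OF y])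
qed

lemma B_change:
  assumes y: "y \<in> A.T"
  shows "B.B y u v = A.B y u v - A.tf y u v *\<^sub>R nor_part g y (M.gsharp (incl y))"
proof -
  have yS: "incl y \<in> S" using y by (simp add: A.T_iff)
  note L = A.nor_part_linear[OF y]
  show ?thesis
    unfolding A.B_eq B.B_eq M.connection_change[OF yS]
    by (simp add: linear_add[OF L] linear_diff[OF L] linear_scale[OF L] A.nor_part_incl[OF y] tan_form_def)
qed

lemma mean_curv_change:
  assumes y: "y \<in> A.T"
  shows "mean_curv g G' y \<xi> = mean_curv g G y \<xi> - g (incl y) (nor_part g y (M.gsharp (incl y))) \<xi>"
proof -
  note b = A.g_bilinear[OF y[unfolded A.T_iff]]
  define k where "k = g (incl y) (nor_part g y (M.gsharp (incl y))) \<xi>"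
  have "(\<lambda>u v. g (incl y) (B.B y u v) \<xi>) = (\<lambda>u v. g (incl y) (A.B y u v) \<xi> - k * A.tf y u v)"
    by (simp add: fun_eq_iff B_change[OF y] bilinear_lsub[OF b] bilinear_lmul[OF b] k_def mult.commute)
  then have "mean_curv g G' y \<xi> = (1 / real CARD('n)) * (tr_form (A.tf y) (\<lambda>u v. g (incl y) (A.B y u v) \<xi>)
      - k * real CARD('n))"
    by (simp only: B.mean_curv_eq[OF y] tr_form_diff tr_form_mult tr_form_self[OF A.tf_inner[OF y]])
  then show ?thesis by (simp add: A.mean_curv_eq[OF y] k_def field_simps)
qed

text \<open>The fundamental form changes by the metric times a normal vector, and the mean curvature
  vector changes by that same normal vector.\<close>

lemma B0_change:
  assumes y: "y \<in> A.T"
  shows "B.B0 y u v = A.B0 y u v"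
proof -
  have yS: "incl y \<in> S" using y by (simp add: A.T_iff)
  have "B.H y = A.H y - nor_part g y (M.gsharp (incl y))"
    by (rule inner_form_cancel[OF A.g_inner[OF yS]])
      (simp add: A.g_mean_curv_vec[OF y] B.g_mean_curv_vec[OF y] mean_curv_change[OF y]
        bilinear_lsub[OF A.g_bilinear[OF yS]])
  then have "A.H y = B.H y + nor_part g y (M.gsharp (incl y))" by simp
  then show ?thesis by (simp add: fund_form0_def B_change[OF y] scaleR_add_right)
qed

text \<open>\<open>B0\<close> is normal, so pairing it with the normal part of \<open>gsharp\<close>
  is the same as pairing it with \<open>gsharp\<close>, and this gives \<gamma>.\<close>

lemma mean_curv_B0_change:
  assumes y: "y \<in> A.T"
  shows "mean_curv g G' y (B.B0 y u v) = mean_curv g G y (A.B0 y u v) - M.gam (incl y) (A.B0 y u v)"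
proof -
  have yS: "incl y \<in> S" using y by (simp add: A.T_iff)
  note b = A.g_bilinear[OF yS]
  have "g (incl y) (incl a) (A.H y) = 0" for a
    using A.g_mean_curv_vec[OF y, of "incl a"] A.mean_curv_incl[OF y] A.g_sym[OF yS] by metis
  then have "g (incl y) (incl a) (A.B0 y u v) = 0" for a
    by (simp add: fund_form0_def bilinear_rsub[OF b] bilinear_rmul[OF b] A.g_B_normal[OF y])
  then have "g (incl y) (nor_part g y (M.gsharp (incl y))) (A.B0 y u v) = M.gam (incl y) (A.B0 y u v)"
    by (simp add: nor_part_def bilinear_lsub[OF b] M.g_gsharp[OF yS])
  then show ?thesis by (simp add: B0_change[OF y] mean_curv_change[OF y])
qed

lemma ind_zero_order_change:
  assumes y: "y \<in> A.T" and m: "CARD('n + 'k) \<ge> 3"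
  shows "ind_zero_order g G' y u v = ind_zero_order g G y u v - tracefree (A.tf y) (N.dzero y) u v"
proof -
  have yS: "incl y \<in> S" using y by (simp add: A.T_iff)
  define k where "k = real CARD('n + 'k) - 2"
  have k: "k \<noteq> 0" using m unfolding k_def by linarith
  obtain t where t: "\<And>u v. symm (ricci G' (incl y)) u v = symm (ricci G (incl y)) u v
    - k * (symm (cov_form M.gam G (incl y)) u v - M.gam (incl y) u * M.gam (incl y) v) + t * g (incl y) u v"
    using M.symm_ricci_change[OF yS] unfolding k_def by blast
  have "symm (cov_form M.gam G (incl y)) (incl u) (incl v) - M.gam (incl y) (incl u) * M.gam (incl y) (incl v)
     = N.dzero y u v - M.gam (incl y) (A.B y u v)" for u v
    using A.B_sym[OF y, of v u]
    by (simp add: symm_def cov_gam_N[OF y] N.dzero_def gam_N[OF y])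
  then have "(\<lambda>u v. symm (ricci G' (incl y)) (incl u) (incl v)) = (\<lambda>u v. symm (ricci G (incl y)) (incl u) (incl v)
      - k * (N.dzero y u v - M.gam (incl y) (A.B y u v)) + t * A.tf y u v)"
    by (simp only: t tan_form_def)
  then have "tracefree (A.tf y) (\<lambda>u v. symm (ricci G' (incl y)) (incl u) (incl v)) u v
     = tracefree (A.tf y) (\<lambda>u v. symm (ricci G (incl y)) (incl u) (incl v)) u v
      - k * (tracefree (A.tf y) (N.dzero y) u v - M.gam (incl y) (A.B0 y u v))"
    by (simp only: tracefree_add tracefree_diff tracefree_mult tracefree_self[OF A.tf_inner[OF y]]
        A.tracefree_B[OF y M.gam_linear[OF yS]] mult_zero_right add_0_right)
  then show ?thesis
    unfolding ind_zero_order_def k_def[symmetric] mean_curv_B0_change[OF y]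
    using k by (simp add: field_simps)
qed

lemma ind_moebius_local_change:
  assumes y: "y \<in> A.T" and l: "smooth_on A.T l" and m: "CARD('n + 'k) \<ge> 3"
  shows "ind_moebius_local g G' (\<lambda>z. A.w z * l z) y u v = ind_moebius_local g G (\<lambda>z. A.w z * l z) y u v"
  unfolding A.ind_moebius_local_eq[OF y l] B.ind_moebius_local_eq[OF y l]
    N.hess0_change[OF y l] ind_zero_order_change[OF y m] A.tracefree_gN[OF y]
  by (simp add: algebra_simps)

end

context slice_chart
begin

text \<open>The hypothesis on \<open>h\<close> is the shape shared by both intrinsic Schouten-Weyl
  tensors: \<open>A\<close> is the trace-free Ricci part if n >= 3 and the zero-order part of the
  Moebius structure if n = 2. The Faraday terms of the ambient and the intrinsic tensor
  cancel.\<close>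

lemma tracefree_rel_schouten_weyl:
  assumes y: "y \<in> T" and A: "tracefree (gN y) A u v = A u v"
    and h: "\<And>u v. h y u v = A u v + t * gN y u v - (1 / 2) * faraday GN y u v"
  shows "tracefree (gN y) (rel_schouten_weyl g G h y) u v = ind_zero_order g G y u v - A u v"
proof -
  note i = tf_inner[OF y]
  \<comment> \<open>Collects the metric multiples, including the one with the squared mean
    curvature; the division converts \<open>gN\<close> to the restricted metric.\<close>
  define t' where "t' = (1 / 2) * g (incl y) (H y) (H y) - t / (w y)\<^sup>2"
  have F: "tracefree (tf y) (faraday GN y) u v = faraday GN y u v"
    by (rule tracefree_antisym[OF i]) (simp add: faraday_eq[of GN, OF GN_bilinear[OF y]])
  have e: "rel_schouten_weyl g G h y = (\<lambda>u v. schouten_weyl_tan g G y u v - A u v + t' * tf y u v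
      + (1 / 2) * faraday GN y u v + mean_curv g G y (B0 y u v))"
    unfolding rel_schouten_weyl_def[abs_def] h gN_def t'_def by (simp add: fun_eq_iff algebra_simps)
  have "tracefree (tf y) (\<lambda>u v. mean_curv g G y (B0 y u v)) u v = mean_curv g G y (B0 y u v)"
    by (rule tracefree_trivial[OF tr_form_B0[OF y mean_curv_linear[OF y]]])
  then show ?thesis
    unfolding tracefree_gN[OF y] e tracefree_add tracefree_diff tracefree_mult tracefree_self[OF i] F
      tracefree_schouten_weyl_tan[OF y]
    using A unfolding tracefree_gN[OF y] by (simp add: ind_zero_order_def)
qed

end

section \<open>Naturality under coordinate changes\<close>

text \<open>A transition map with its inverse, detached from any atlas, so that one set of lemmas
  serves both \<open>M\<close> and \<open>N\<close>.\<close>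

locale chart_map =
  fixes V V' :: "(real ^ 'm::finite) set" and \<tau> \<sigma> :: "real ^ 'm \<Rightarrow> real ^ 'm"
  assumes open_V: "open V" and open_V': "open V'"
    and \<tau>_smooth: "smooth_on V \<tau>" and \<sigma>_smooth: "smooth_on V' \<sigma>"
    and \<tau>_in: "x \<in> V \<Longrightarrow> \<tau> x \<in> V'" and \<sigma>_in: "y \<in> V' \<Longrightarrow> \<sigma> y \<in> V"
    and \<sigma>_\<tau>: "x \<in> V \<Longrightarrow> \<sigma> (\<tau> x) = x" and \<tau>_\<sigma>: "y \<in> V' \<Longrightarrow> \<tau> (\<sigma> y) = y"
begin

abbreviation J :: "real ^ 'm \<Rightarrow> real ^ 'm \<Rightarrow> real ^ 'm" where "J x \<equiv> frechet_derivative \<tau> (at x)"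
definition K :: "real ^ 'm \<Rightarrow> real ^ 'm \<Rightarrow> real ^ 'm" where "K x = frechet_derivative \<sigma> (at (\<tau> x))"
definition D2 :: "real ^ 'm \<Rightarrow> real ^ 'm \<Rightarrow> real ^ 'm \<Rightarrow> real ^ 'm" where
  "D2 x u v = deriv_along (\<lambda>z. deriv_along \<tau> z v) x u"
definition factor :: "real \<Rightarrow> real ^ 'm \<Rightarrow> real" where
  "factor k x = \<bar>det (matrix (J x))\<bar> powr (k / real CARD('m))"

lemma has_derivative_\<tau>: "x \<in> V \<Longrightarrow> (\<tau> has_derivative J x) (at x)"
  by (rule smooth_on_has_derivative[OF \<tau>_smooth])

lemma has_derivative_\<sigma>: "x \<in> V \<Longrightarrow> (\<sigma> has_derivative K x) (at (\<tau> x))"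
  unfolding K_def by (rule smooth_on_has_derivative[OF \<sigma>_smooth \<tau>_in])

lemma J_linear: "x \<in> V \<Longrightarrow> linear (J x)"
  using has_derivative_\<tau> has_derivative_linear by blast

lemma K_linear: "x \<in> V \<Longrightarrow> linear (K x)"
  using has_derivative_\<sigma> has_derivative_linear by blast

lemma K_J: assumes x: "x \<in> V" shows "K x (J x v) = v"
proof -
  have "((\<lambda>z. \<sigma> (\<tau> z)) has_derivative (\<lambda>v. K x (J x v))) (at x)"
    by (rule has_derivative_compose[OF has_derivative_\<tau>[OF x] has_derivative_\<sigma>[OF x]])
  then have "((\<lambda>z. z) has_derivative (\<lambda>v. K x (J x v))) (at x)"
    by (rule has_derivative_transform_within_open[OF _ open_V x]) (rule \<sigma>_\<tau>)
  then show ?thesis using has_derivative_unique[OF _ has_derivative_ident] by (metis (no_types))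
qed

lemma J_K: assumes x: "x \<in> V" shows "J x (K x v) = v"
proof -
  have "((\<lambda>z. \<tau> (\<sigma> z)) has_derivative (\<lambda>v. J x (K x v))) (at (\<tau> x))"
    using has_derivative_compose[OF has_derivative_\<sigma>[OF x], of \<tau> "J x"] has_derivative_\<tau>[OF x] \<sigma>_\<tau>[OF x] by simp
  then have "((\<lambda>z. z) has_derivative (\<lambda>v. J x (K x v))) (at (\<tau> x))"
    by (rule has_derivative_transform_within_open[OF _ open_V' \<tau>_in[OF x]]) (rule \<tau>_\<sigma>)
  then show ?thesis using has_derivative_unique[OF _ has_derivative_ident] by (metis (no_types))
qed

lemma matrix_K_J:
  assumes x: "x \<in> V"
  shows "matrix (K x) ** matrix (J x) = mat 1" "matrix (J x) ** matrix (K x) = mat 1"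
proof -
  have "matrix (\<lambda>v::real ^ 'm. v) = mat 1" by (simp add: matrix_def mat_def axis_def vec_eq_iff)
  then show "matrix (K x) ** matrix (J x) = mat 1" "matrix (J x) ** matrix (K x) = mat 1"
    using matrix_compose[OF J_linear[OF x] K_linear[OF x]] matrix_compose[OF K_linear[OF x] J_linear[OF x]]
    by (simp_all add: o_def K_J[OF x] J_K[OF x])
qed

lemma det_J_nonzero: assumes x: "x \<in> V" shows "det (matrix (J x)) \<noteq> 0"
  using arg_cong[OF matrix_K_J(1)[OF x], of det] by (auto simp: det_mul)

lemma matrix_inv_J: assumes x: "x \<in> V" shows "matrix_inv (matrix (J x)) = matrix (K x)"
proof -
  have "matrix_inv (matrix (J x)) = (matrix (K x) ** matrix (J x)) ** matrix_inv (matrix (J x))"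
    by (simp add: matrix_K_J[OF x])
  also have "\<dots> = matrix (K x)"
    using matrix_inv_works(1)[OF det_J_nonzero[OF x]] by (simp add: matrix_mul_assoc[symmetric])
  finally show ?thesis .
qed

lemma J_smooth: "smooth_on V (\<lambda>x. J x v)"
  by (rule smooth_on_deriv_along[OF \<tau>_smooth])

lemma D2_sym: "x \<in> V \<Longrightarrow> D2 x u v = D2 x v u"
  unfolding D2_def by (rule deriv_along_commute[OF open_V \<tau>_smooth])

lemma D2_linear: "x \<in> V \<Longrightarrow> linear (D2 x u)"
  unfolding D2_def[abs_def]
  by (rule linear_deriv_along_param[OF open_V _ J_linear smooth_on_imp_differentiable[OF J_smooth]])

lemma factor_pos: "x \<in> V \<Longrightarrow> factor k x > 0"
  using det_J_nonzero by (simp add: factor_def)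

lemma factor_0: "x \<in> V \<Longrightarrow> factor 0 x = 1"
  using det_J_nonzero by (simp add: factor_def)

lemma factor_2: "x \<in> V \<Longrightarrow> factor 2 x = (factor 1 x)\<^sup>2"
  using det_J_nonzero[of x] by (simp add: factor_def power2_eq_square powr_add[symmetric])

lemma factor_smooth: "smooth_on V (factor k)"
proof -
  have "smooth_on V (\<lambda>x. matrix (J x) $ p $ q)" for p q
    unfolding matrix_def by (simp add: smooth_on_vec_nth[OF J_smooth open_V])
  then show ?thesis
    unfolding factor_def[abs_def]
    by (intro smooth_on_abs_powr smooth_on_det open_V det_J_nonzero)
qed

lemma has_derivative_matrix_J:
  assumes x: "x \<in> V"
  shows "((\<lambda>z. matrix (J z)) has_derivative (\<lambda>u. matrix (D2 x u))) (at x)"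
  unfolding D2_def
  by (rule has_derivative_matrix_entries)
    (simp add: matrix_def bounded_linear.has_derivative[OF bounded_linear_vec_nth]
      smooth_on_has_derivative[OF J_smooth x])

text \<open>The logarithmic derivative of the Jacobian determinant is the trace of the inverse
  Jacobian times its derivative; here \<open>K\<close> is the inverse of \<open>J\<close>.\<close>

lemma deriv_factor:
  assumes x: "x \<in> V"
  shows "deriv_along (factor k) x u = factor k x * ((k / real CARD('m)) * tr_end (\<lambda>v. K x (D2 x u v)))"
proof -
  define a where "a = k / real CARD('m)"
  define d where "d = (\<lambda>z. det (matrix (J z)))"
  define t where "t = (\<lambda>u. tr_end (\<lambda>v. K x (D2 x u v)))"
  have nz: "d x \<noteq> 0" using det_J_nonzero[OF x] by (simp add: d_def)
  have "trace (matrix_inv (matrix (J x)) ** matrix (D2 x u)) = t u" for u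
    using matrix_compose[OF D2_linear[OF x] K_linear[OF x], of u]
    by (simp add: matrix_inv_J[OF x] t_def tr_end_def o_def)
  then have d: "(d has_derivative (\<lambda>u. d x * t u)) (at x)"
    using has_derivative_det[OF has_derivative_matrix_J[OF x] det_J_nonzero[OF x]] unfolding d_def by simp
  have dd: "d x * d x > 0" using nz by (simp add: zero_less_mult_iff linorder_neq_iff) argo
  have "((\<lambda>s. s powr (a / 2)) has_derivative (\<lambda>h. h * ((a / 2) * (d x * d x) powr (a / 2 - 1)))) (at (d x * d x))"
    by (rule has_derivative_eq_rhs[OF has_real_derivative_powr[OF dd, unfolded has_field_derivative_def]])
      (simp add: fun_eq_iff)
  from has_derivative_compose[OF has_derivative_mult[OF d d] this]
  have "((\<lambda>z. (d z * d z) powr (a / 2)) has_derivative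
      (\<lambda>u. (d x * (d x * t u) + d x * t u * d x) * ((a / 2) * (d x * d x) powr (a / 2 - 1)))) (at x)" .
  moreover have "factor k = (\<lambda>z. (d z * d z) powr (a / 2))"
    by (simp only: factor_def[abs_def] abs_powr_eq_square_powr a_def d_def)
  ultimately have "deriv_along (factor k) x u
     = (d x * (d x * t u) + d x * t u * d x) * ((a / 2) * (d x * d x) powr (a / 2 - 1))"
    by (simp add: deriv_along_eqI)
  also have "\<dots> = ((d x * d x) powr (a / 2 - 1) * (d x * d x)) * (a * t u)" by (simp add: algebra_simps)
  also have "(d x * d x) powr (a / 2 - 1) * (d x * d x) = (d x * d x) powr (a / 2)"
    using dd by (simp add: powr_diff)
  also have "\<dots> = factor k x" using \<open>factor k = _\<close> by simp
  finally show ?thesis by (simp add: a_def t_def)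
qed

lemma deriv_compose_\<tau>:
  assumes x: "x \<in> V" and f: "smooth_on V' f"
  shows "deriv_along (\<lambda>z. f (\<tau> z)) x u = deriv_along f (\<tau> x) (J x u)"
  using has_derivative_compose[OF has_derivative_\<tau>[OF x] smooth_on_has_derivative[OF f \<tau>_in[OF x]]]
  by (simp add: deriv_along_eqI)

lemma smooth_compose_\<tau>: "smooth_on V' f \<Longrightarrow> smooth_on V (\<lambda>z. f (\<tau> z))"
  by (rule smooth_on_compose[OF _ \<tau>_smooth open_V open_V' \<tau>_in])

text \<open>Differentiating the law of a one-form of weight \<open>k\<close> leaves two
  inhomogeneous terms, one from the density factor and one from the Jacobian. Connection terms
  cancel them in \<open>cov_form_natural\<close>.\<close>

lemma deriv_form_natural:
  assumes x: "x \<in> V"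
    and \<theta>': "\<And>z. z \<in> V' \<Longrightarrow> linear (\<theta>' z)" "\<And>v. smooth_on V' (\<lambda>z. \<theta>' z v)"
    and \<theta>: "\<And>v. smooth_on V (\<lambda>z. \<theta> z v)"
    and rel: "\<And>z v. z \<in> V \<Longrightarrow> \<theta>' (\<tau> z) (J z v) = factor k z * \<theta> z v"
  shows "deriv_along (\<lambda>y. \<theta>' y (J x v)) (\<tau> x) (J x u) = factor k x * (deriv_along (\<lambda>z. \<theta> z v) x u
      + (k / real CARD('m)) * tr_end (\<lambda>v. K x (D2 x u v)) * \<theta> x v) - \<theta>' (\<tau> x) (D2 x u v)"
proof -
  have "((\<lambda>z. \<theta>' (\<tau> z) (J z v)) has_derivative
      (\<lambda>u. deriv_along (\<lambda>z. \<theta>' (\<tau> z) (J x v)) x u + \<theta>' (\<tau> x) (D2 x u v))) (at x)"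
    unfolding D2_def
    by (rule has_derivative_linear_family[OF open_V x, of "\<lambda>z. \<theta>' (\<tau> z)"])
      (simp_all add: \<theta>' \<tau>_in smooth_on_imp_differentiable[OF smooth_compose_\<tau>[OF \<theta>'(2)] x]
        smooth_on_has_derivative[OF J_smooth x])
  from deriv_along_eqI[OF this]
  have "deriv_along (\<lambda>z. \<theta>' (\<tau> z) (J z v)) x u
      = deriv_along (\<lambda>y. \<theta>' y (J x v)) (\<tau> x) (J x u) + \<theta>' (\<tau> x) (D2 x u v)"
    by (simp add: deriv_compose_\<tau>[OF x \<theta>'(2)])
  moreover have "deriv_along (\<lambda>z. \<theta>' (\<tau> z) (J z v)) x = deriv_along (\<lambda>z. factor k z * \<theta> z v) x"
    by (rule frechet_derivative_cong_open[OF open_V x rel])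
  moreover have "deriv_along (\<lambda>z. factor k z * \<theta> z v) x u
      = factor k x * deriv_along (\<lambda>z. \<theta> z v) x u + deriv_along (factor k) x u * \<theta> x v"
    by (simp add: deriv_along_eqI[OF has_derivative_mult[OF smooth_on_has_derivative[OF factor_smooth x]
        smooth_on_has_derivative[OF \<theta> x]]])
  ultimately show ?thesis by (simp add: deriv_factor[OF x] algebra_simps)
qed

end

section \<open>Tensoriality of curvature and Hessian\<close>

locale conn_map = chart_map V V' \<tau> \<sigma> + A: connection_chart V G + B: connection_chart V' G'
  for V V' :: "(real ^ 'm::finite) set" and \<tau> \<sigma> G G' +
  assumes law: "x \<in> V \<Longrightarrow> G' (\<tau> x) (J x u) (J x v) = J x (G x u v) - D2 x u v"
begin

text \<open>The trace of the law for Christoffel symbols. The inhomogeneous term is minus the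
  logarithmic derivative of \<open>factor 1\<close>, as expected of a connection on
  \<open>L\<close>.\<close>

lemma conn_form_natural:
  assumes x: "x \<in> V"
  shows "conn_form G' (\<tau> x) (J x u) = conn_form G x u - (1 / real CARD('m)) * tr_end (\<lambda>v. K x (D2 x u v))"
proof -
  have "tr_end (G' (\<tau> x) (J x u)) = tr_end (\<lambda>w. J x (G x u (K x w)) - D2 x u (K x w))"
  proof (rule tr_end_cong)
    show "G' (\<tau> x) (J x u) w = J x (G x u (K x w)) - D2 x u (K x w)" for w
      using law[OF x, of u "K x w"] by (simp add: J_K[OF x])
  qed
  also have "\<dots> = tr_end (\<lambda>w. J x (G x u (K x w))) - tr_end (\<lambda>w. D2 x u (K x w))" by (rule tr_end_diff)
  also have "tr_end (\<lambda>w. J x (G x u (K x w))) = tr_end (\<lambda>w. G x u (K x (J x w)))"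
    using linear_compose[OF K_linear[OF x] bilinear_linear(1)[OF A.G_bilinear[OF x]], of u]
    by (intro tr_end_commute J_linear x) (simp add: o_def)
  also have "tr_end (\<lambda>w. D2 x u (K x w)) = tr_end (\<lambda>w. K x (D2 x u w))"
    by (intro tr_end_commute D2_linear K_linear x)
  finally show ?thesis unfolding conn_form_def K_J[OF x] by (simp add: diff_divide_distrib)
qed

text \<open>Differentiating the law for Christoffel symbols produces third derivatives of \<tau>.
  They are symmetric in the two form arguments \<open>w\<close> and \<open>u\<close>, so they drop
  out of the curvature.\<close>

lemma curv_natural:
  assumes x: "x \<in> V"
  shows "curv G' (\<lambda>_. J x w) (\<lambda>_. J x u) (\<lambda>_. J x v) (\<tau> x) = J x (curv G (\<lambda>_. w) (\<lambda>_. u) (\<lambda>_. v) x)"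
proof -
  note x' = \<tau>_in[OF x] and B = B.G_bilinear[OF \<tau>_in[OF x]] and jl = J_linear[OF x]
  have D3: "deriv_along (\<lambda>z. D2 z u v) x w = deriv_along (\<lambda>z. D2 z w v) x u"
    unfolding D2_def by (rule deriv_along_commute[OF open_V J_smooth x])
  have main: "deriv_along (\<lambda>y. G' y (J x u) (J x v)) (\<tau> x) (J x w)
     = D2 x w (G x u v) + J x (deriv_along (\<lambda>z. G z u v) x w) - deriv_along (\<lambda>z. D2 z u v) x w
       - G' (\<tau> x) (D2 x w u) (J x v) - G' (\<tau> x) (J x u) (D2 x w v)" for u v w
  proof -
    have dJ: "((\<lambda>z. J z v) has_derivative (\<lambda>w. D2 x w v)) (at x)" for v
      unfolding D2_def by (rule smooth_on_has_derivative[OF J_smooth x])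
    have "((\<lambda>z. G' (\<tau> z) (J z u) (J z v)) has_derivative
      (\<lambda>w. deriv_along (\<lambda>z. G' (\<tau> z) (J x u) (J x v)) x w
        + G' (\<tau> x) (D2 x w u) (J x v) + G' (\<tau> x) (J x u) (D2 x w v))) (at x)"
      by (rule has_derivative_bilinear_family[OF open_V x, of "\<lambda>z. G' (\<tau> z)"])
        (simp_all add: B.G_bilinear \<tau>_in smooth_on_imp_differentiable[OF smooth_compose_\<tau>[OF B.G_smooth] x] dJ)
    from deriv_along_eqI[OF this]
    have "deriv_along (\<lambda>z. G' (\<tau> z) (J z u) (J z v)) x w
      = deriv_along (\<lambda>y. G' y (J x u) (J x v)) (\<tau> x) (J x w)
        + G' (\<tau> x) (D2 x w u) (J x v) + G' (\<tau> x) (J x u) (D2 x w v)"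
      by (simp add: deriv_compose_\<tau>[OF x B.G_smooth])
    moreover have "deriv_along (\<lambda>z. G' (\<tau> z) (J z u) (J z v)) x = deriv_along (\<lambda>z. J z (G z u v) - D2 z u v) x"
      by (rule frechet_derivative_cong_open[OF open_V x law])
    moreover have "((\<lambda>z. J z (G z u v) - D2 z u v) has_derivative
       (\<lambda>w. (D2 x w (G x u v) + J x (deriv_along (\<lambda>z. G z u v) x w)) - deriv_along (\<lambda>z. D2 z u v) x w)) (at x)"
    proof (rule has_derivative_diff)
      show "((\<lambda>z. J z (G z u v)) has_derivative
         (\<lambda>w. D2 x w (G x u v) + J x (deriv_along (\<lambda>z. G z u v) x w))) (at x)"
        unfolding D2_def
        by (rule has_derivative_linear_family[OF open_V x J_linear smooth_on_imp_differentiable[OF J_smooth x]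
              smooth_on_has_derivative[OF A.G_smooth x]])
      show "((\<lambda>z. D2 z u v) has_derivative (deriv_along (\<lambda>z. D2 z u v) x)) (at x)"
        unfolding D2_def by (rule smooth_on_has_derivative[OF smooth_on_deriv_along[OF J_smooth] x])
    qed
    ultimately show ?thesis by (simp add: deriv_along_eqI algebra_simps)
  qed
  have GG: "G' (\<tau> x) (J x w) (G' (\<tau> x) (J x u) (J x v))
     = J x (G x w (G x u v)) - D2 x w (G x u v) - G' (\<tau> x) (J x w) (D2 x u v)" for w u v
    using law[OF x, of w "G x u v"] by (simp add: law[OF x] bilinear_rsub[OF B])
  show ?thesis
    unfolding curv_const[of G "x", OF A.G_bilinear[OF x]] curv_const[of G' "\<tau> x", OF B] main GG
    using D3 D2_sym[OF x, of w u] by (simp add: linear_add[OF jl] linear_diff[OF jl])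
qed

lemma ricci_natural:
  assumes x: "x \<in> V"
  shows "ricci G' (\<tau> x) (J x u) (J x v) = ricci G x u v"
proof -
  let ?C = "\<lambda>w. curv G (\<lambda>_. w) (\<lambda>_. u) (\<lambda>_. v) x"
  have "curv G' (\<lambda>_. w) (\<lambda>_. J x u) (\<lambda>_. J x v) (\<tau> x) = J x (?C (K x w))" for w
    using curv_natural[OF x, of "K x w" u v] by (simp add: J_K[OF x])
  then have "ricci G' (\<tau> x) (J x u) (J x v) = tr_end (\<lambda>w. J x (?C (K x w)))" by (simp add: ricci_def)
  also have "\<dots> = tr_end (\<lambda>w. ?C (K x (J x w)))"
    using linear_compose[OF K_linear[OF x] A.curv_linear(1)[OF x], of u v]
    by (intro tr_end_commute J_linear x) (simp add: o_def)
  finally show ?thesis by (simp add: K_J[OF x] ricci_def)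
qed

text \<open>The full covariant derivative of a one-form of weight \<open>k\<close>, weight term
  included. The case k = 1 is applied to the derivative of a section of \<open>L\<close>, and k = 0
  to the change of the connection form.\<close>

lemma cov_form_natural:
  assumes x: "x \<in> V"
    and \<theta>': "\<And>z. z \<in> V' \<Longrightarrow> linear (\<theta>' z)" "\<And>v. smooth_on V' (\<lambda>z. \<theta>' z v)"
    and \<theta>: "\<And>v. smooth_on V (\<lambda>z. \<theta> z v)"
    and rel: "\<And>z v. z \<in> V \<Longrightarrow> \<theta>' (\<tau> z) (J z v) = factor k z * \<theta> z v"
  shows "cov_form \<theta>' G' (\<tau> x) (J x u) (J x v) + k * conn_form G' (\<tau> x) (J x u) * \<theta>' (\<tau> x) (J x v)
    = factor k x * (cov_form \<theta> G x u v + k * conn_form G x u * \<theta> x v)"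
proof -
  have "deriv_along (\<lambda>y. \<theta>' y (J x v)) (\<tau> x) (J x u) = factor k x * (deriv_along (\<lambda>z. \<theta> z v) x u
      + (k / real CARD('m)) * tr_end (\<lambda>v. K x (D2 x u v)) * \<theta> x v) - \<theta>' (\<tau> x) (D2 x u v)"
    by (rule deriv_form_natural[OF assms])
  moreover have "\<theta>' (\<tau> x) (G' (\<tau> x) (J x u) (J x v)) = factor k x * \<theta> x (G x u v) - \<theta>' (\<tau> x) (D2 x u v)"
    by (simp add: law[OF x] linear_diff[OF \<theta>'(1)[OF \<tau>_in[OF x]]] rel[OF x])
  ultimately show ?thesis
    unfolding cov_form_def conn_form_natural[OF x] rel[OF x] by (simp add: algebra_simps)
qed

text \<open>The derivative of a section of \<open>L\<close> is a one-form of weight 1, and the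
  Hessian is its covariant derivative.\<close>

lemma hess_form_natural:
  assumes x: "x \<in> V" and l: "smooth_on V l" and l': "smooth_on V' l'"
    and rel: "\<And>z. z \<in> V \<Longrightarrow> l' (\<tau> z) = factor 1 z * l z"
  shows "hess_form G' l' (\<tau> x) (J x u) (J x v) = factor 1 x * hess_form G l x u v"
proof -
  define \<theta>' where "\<theta>' = (\<lambda>y v. deriv_along l' y v + conn_form G' y v * l' y)"
  define \<theta> where "\<theta> = (\<lambda>y v. deriv_along l y v + conn_form G y v * l y)"
  have "\<theta>' (\<tau> z) (J z v) = factor 1 z * \<theta> z v" if z: "z \<in> V" for z v
  proof -
    have "deriv_along (\<lambda>z. l' (\<tau> z)) z = deriv_along (\<lambda>z. factor 1 z * l z) z"
      by (rule frechet_derivative_cong_open[OF open_V z rel])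
    then have "deriv_along l' (\<tau> z) (J z v) = factor 1 z * deriv_along l z v + deriv_along (factor 1) z v * l z"
      by (simp add: deriv_compose_\<tau>[OF z l', symmetric] deriv_along_eqI[OF has_derivative_mult[OF
            smooth_on_has_derivative[OF factor_smooth z] smooth_on_has_derivative[OF l z]]])
    then show ?thesis
      by (simp add: \<theta>'_def \<theta>_def deriv_factor[OF z] conn_form_natural[OF z] rel[OF z] algebra_simps)
  qed
  moreover have "linear (\<theta>' z)" if "z \<in> V'" for z
    using linear_deriv_along[OF smooth_on_imp_differentiable[OF l' that]] B.conn_form_linear[OF that]
    by (simp add: \<theta>'_def linear_iff algebra_simps)
  moreover have "smooth_on V' (\<lambda>z. \<theta>' z v)" "smooth_on V (\<lambda>z. \<theta> z v)" for v
    unfolding \<theta>'_def \<theta>_def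
    by (intro smooth_on_add smooth_on_mult smooth_on_deriv_along l l' A.conn_form_smooth B.conn_form_smooth
        open_V open_V')+
  ultimately have "cov_form \<theta>' G' (\<tau> x) (J x u) (J x v) + 1 * conn_form G' (\<tau> x) (J x u) * \<theta>' (\<tau> x) (J x v)
    = factor 1 x * (cov_form \<theta> G x u v + 1 * conn_form G x u * \<theta> x v)"
    by (intro cov_form_natural[OF x])
  then show ?thesis
    unfolding hess_form_eq_gen hess_gen_def by (simp add: cov_form_def \<theta>'_def \<theta>_def algebra_simps)
qed

end

lemma (in chart_map) tracefree_natural_chart:
  assumes x: "x \<in> V" and "inner_form b" "inner_form b'" "bilinear q"
    and "\<And>u v. b' (J x u) (J x v) = factor 2 x * b u v"
    and "\<And>u v. q' (J x u) (J x v) = t * q u v"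
  shows "tracefree b' q' (J x u) (J x v) = t * tracefree b q u v"
  using factor_pos[OF x, of 2]
  by (intro tracefree_natural[OF assms(2-4) J_linear[OF x] K_linear[OF x] K_J[OF x] J_K[OF x] assms(5) _ assms(6)]) simp

locale weyl_map = conn_map V V' \<tau> \<sigma> G G' + A: weyl_chart V G g + B: weyl_chart V' G' g'
  for V V' :: "(real ^ 'm::finite) set" and \<tau> \<sigma> G G' g g' +
  assumes glaw: "x \<in> V \<Longrightarrow> g' (\<tau> x) (J x u) (J x v) = factor 2 x * g x u v"
begin

lemma hess0_natural:
  assumes x: "x \<in> V" and l: "smooth_on V l" and l': "smooth_on V' l'"
    and rel: "\<And>z. z \<in> V \<Longrightarrow> l' (\<tau> z) = factor 1 z * l z"
  shows "hess0 G' g' l' (\<tau> x) (J x u) (J x v) = factor 1 x * hess0 G g l x u v"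
  unfolding hess0_def
  by (rule tracefree_natural_chart[OF x A.g_inner[OF x] B.g_inner[OF \<tau>_in[OF x]]
      bilinear_symm[OF A.hess_form_bilinear[OF x l]] glaw[OF x]],
      rule symm_natural, rule hess_form_natural[OF assms])

end

locale change_map = C: weyl_change V G1 G2 g + C': weyl_change V' G1' G2' g'
    + M1: weyl_map V V' \<tau> \<sigma> G1 G1' g g' + M2: weyl_map V V' \<tau> \<sigma> G2 G2' g g'
  for V V' :: "(real ^ 'm::finite) set" and \<tau> \<sigma> G1 G1' G2 G2' g g'
begin

lemma gam_natural: "x \<in> V \<Longrightarrow> C'.gam (\<tau> x) (M1.J x v) = C.gam x v"
  by (simp add: C'.gam_def C.gam_def M1.conn_form_natural M2.conn_form_natural)

lemma dzero_natural:
  assumes x: "x \<in> V"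
  shows "C'.dzero (\<tau> x) (M1.J x u) (M1.J x v) = C.dzero x u v"
proof -
  have "cov_form C'.gam G1' (\<tau> x) (M1.J x u) (M1.J x v) = cov_form C.gam G1 x u v" for u v
  proof -
    have "cov_form C'.gam G1' (\<tau> x) (M1.J x u) (M1.J x v) + 0 * conn_form G1' (\<tau> x) (M1.J x u) * C'.gam (\<tau> x) (M1.J x v)
        = M1.factor 0 x * (cov_form C.gam G1 x u v + 0 * conn_form G1 x u * C.gam x v)"
      by (rule M1.cov_form_natural[OF x C'.gam_linear C'.gam_smooth C.gam_smooth])
        (simp_all add: gam_natural M1.factor_0)
    then show ?thesis by (simp add: M1.factor_0[OF x])
  qed
  then show ?thesis by (simp add: C'.dzero_def C.dzero_def symm_def gam_natural[OF x])
qed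

lemma tracefree_dzero_natural:
  assumes x: "x \<in> V"
  shows "tracefree (g' (\<tau> x)) (C'.dzero (\<tau> x)) (M1.J x u) (M1.J x v) = tracefree (g x) (C.dzero x) u v"
  using M1.tracefree_natural_chart[OF x C.A.g_inner[OF x] C'.A.g_inner[OF M1.\<tau>_in[OF x]]
      C.dzero_bilinear[OF x] M1.glaw[OF x], of "C'.dzero (\<tau> x)" 1] dzero_natural[OF x] by simp

end

section \<open>Naturality of the submanifold data\<close>

locale slice_map = A: slice_chart V G g + B: slice_chart V' G' g' + M: weyl_map V V' \<tau> \<sigma> G G' g g'
    + N: chart_map A.T B.T \<tau>N \<sigma>N
  for V V' :: "(real ^ ('n::finite + 'k::finite)) set" and \<tau> \<sigma> G G' g g'
    and \<tau>N \<sigma>N :: "real ^ 'n \<Rightarrow> real ^ 'n" +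
  assumes \<tau>_incl: "y \<in> A.T \<Longrightarrow> \<tau> (incl y) = incl (\<tau>N y)"
begin

lemma incl_V: "y \<in> A.T \<Longrightarrow> incl y \<in> V" by (simp add: A.T_iff)

lemma J_incl:
  assumes y: "y \<in> A.T" shows "M.J (incl y) (incl u) = incl (N.J y u)"
proof -
  have "deriv_along (\<lambda>z. \<tau> (incl z)) y = deriv_along (\<lambda>z. incl (\<tau>N z)) y"
    by (rule frechet_derivative_cong_open[OF A.open_T y \<tau>_incl])
  from fun_cong[OF this, of u] show ?thesis
    by (simp add: deriv_along_compose_incl[OF smooth_on_imp_differentiable[OF M.\<tau>_smooth incl_V[OF y]]]
        deriv_along_bounded_linear[OF bounded_linear_incl smooth_on_imp_differentiable[OF N.\<tau>_smooth y]])
qed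

lemma D2_incl:
  assumes y: "y \<in> A.T" shows "M.D2 (incl y) (incl u) (incl v) = incl (N.D2 y u v)"
proof -
  have "deriv_along (\<lambda>z. M.J (incl z) (incl v)) y = deriv_along (\<lambda>z. incl (N.J z v)) y"
    by (rule frechet_derivative_cong_open[OF A.open_T y J_incl])
  from fun_cong[OF this, of u] show ?thesis
    unfolding M.D2_def N.D2_def
    by (simp add: deriv_along_compose_incl[OF smooth_on_imp_differentiable[OF M.J_smooth incl_V[OF y]]]
        deriv_along_bounded_linear[OF bounded_linear_incl smooth_on_imp_differentiable[OF N.J_smooth y]])
qed

lemma tf_natural: "y \<in> A.T \<Longrightarrow> B.tf (\<tau>N y) (N.J y u) (N.J y v) = M.factor 2 (incl y) * A.tf y u v"
  using M.glaw[OF incl_V, of y "incl u" "incl v"] by (simp add: tan_form_def J_incl \<tau>_incl)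

lemma tan_part_natural:
  assumes y: "y \<in> A.T"
  shows "tan_part g' (\<tau>N y) (M.J (incl y) \<xi>) = N.J y (tan_part g y \<xi>)"
proof (rule B.tan_part_eqI[OF N.\<tau>_in[OF y]])
  fix v
  have "B.tf (\<tau>N y) (N.J y (tan_part g y \<xi>)) v = B.tf (\<tau>N y) (N.J y (tan_part g y \<xi>)) (N.J y (N.K y v))"
    by (simp add: N.J_K[OF y])
  also have "\<dots> = M.factor 2 (incl y) * g (incl y) \<xi> (incl (N.K y v))"
    by (simp add: tf_natural[OF y] A.tf_tan_part[OF y])
  also have "\<dots> = g' (\<tau> (incl y)) (M.J (incl y) \<xi>) (M.J (incl y) (incl (N.K y v)))"
    by (rule M.glaw[OF incl_V[OF y], symmetric])
  also have "\<dots> = g' (incl (\<tau>N y)) (M.J (incl y) \<xi>) (incl v)"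
    by (simp add: J_incl[OF y] N.J_K[OF y] \<tau>_incl[OF y])
  finally show "B.tf (\<tau>N y) (N.J y (tan_part g y \<xi>)) v = g' (incl (\<tau>N y)) (M.J (incl y) \<xi>) (incl v)" .
qed

lemma nor_part_natural:
  assumes y: "y \<in> A.T"
  shows "nor_part g' (\<tau>N y) (M.J (incl y) \<xi>) = M.J (incl y) (nor_part g y \<xi>)"
  by (simp add: nor_part_def tan_part_natural[OF y] J_incl[OF y, symmetric] linear_diff[OF M.J_linear[OF incl_V[OF y]]])

lemma G_natural:
  assumes y: "y \<in> A.T"
  shows "G' (incl (\<tau>N y)) (incl (N.J y u)) (incl (N.J y v))
    = M.J (incl y) (G (incl y) (incl u) (incl v)) - incl (N.D2 y u v)"
  using M.law[OF incl_V[OF y], of "incl u" "incl v"] by (simp add: J_incl[OF y] \<tau>_incl[OF y] D2_incl[OF y])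

lemma GN_law:
  assumes y: "y \<in> A.T"
  shows "B.GN (\<tau>N y) (N.J y u) (N.J y v) = N.J y (A.GN y u v) - N.D2 y u v"
  unfolding A.GN_eq B.GN_eq G_natural[OF y] linear_diff[OF B.tan_part_linear[OF N.\<tau>_in[OF y]]]
  by (simp add: tan_part_natural[OF y] B.tan_part_incl[OF N.\<tau>_in[OF y]])

text \<open>The inhomogeneous term of the Christoffel symbols is tangent to \<open>N\<close>, so the
  normal part transforms as a tensor.\<close>

lemma B_natural:
  assumes y: "y \<in> A.T"
  shows "B.B (\<tau>N y) (N.J y u) (N.J y v) = M.J (incl y) (A.B y u v)"
  unfolding A.B_eq B.B_eq G_natural[OF y] linear_diff[OF B.nor_part_linear[OF N.\<tau>_in[OF y]]]
  by (simp add: nor_part_natural[OF y] B.nor_part_incl[OF N.\<tau>_in[OF y]])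

lemma mean_curv_natural:
  assumes y: "y \<in> A.T"
  shows "mean_curv g' G' (\<tau>N y) (M.J (incl y) \<xi>) = mean_curv g G y \<xi>"
proof -
  note yV = incl_V[OF y] and y' = N.\<tau>_in[OF y]
  have b: "bilinear (\<lambda>u v. g (incl y) (A.B y u v) \<xi>)"
    using A.B_bilinear[OF y] A.g_bilinear[OF yV] unfolding bilinear_def by (simp add: linear_iff)
  have q: "g' (incl (\<tau>N y)) (B.B (\<tau>N y) (N.J y u) (N.J y v)) (M.J (incl y) \<xi>)
      = M.factor 2 (incl y) * g (incl y) (A.B y u v) \<xi>" for u v
    using M.glaw[OF yV, of "A.B y u v" \<xi>] by (simp add: B_natural[OF y] \<tau>_incl[OF y])
  have nz: "M.factor 2 (incl y) \<noteq> 0" using M.factor_pos[OF yV, of 2] by simp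
  have "tr_form (B.tf (\<tau>N y)) (\<lambda>u v. g' (incl (\<tau>N y)) (B.B (\<tau>N y) u v) (M.J (incl y) \<xi>))
     = M.factor 2 (incl y) / M.factor 2 (incl y) * tr_form (A.tf y) (\<lambda>u v. g (incl y) (A.B y u v) \<xi>)"
    by (rule tr_form_natural[OF A.tf_inner[OF y] B.tf_inner[OF y'] b N.J_linear[OF y] N.K_linear[OF y]
          N.K_J[OF y] N.J_K[OF y] tf_natural[OF y] nz q])
  then show ?thesis using nz by (simp add: A.mean_curv_eq[OF y] B.mean_curv_eq[OF y'])
qed

text \<open>The mean curvature vector has weight -2 and the restricted metric weight 2, so the
  factor \<open>s\<close> cancels in their product.\<close>

lemma B0_natural:
  assumes y: "y \<in> A.T"
  shows "B.B0 (\<tau>N y) (N.J y u) (N.J y v) = M.J (incl y) (A.B0 y u v)"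
proof -
  note yV = incl_V[OF y] and y' = N.\<tau>_in[OF y] and jl = M.J_linear[OF incl_V[OF y]]
  define s where "s = M.factor 2 (incl y)"
  have nz: "s \<noteq> 0" using M.factor_pos[OF yV, of 2] by (simp add: s_def)
  have "B.H (\<tau>N y) = (1 / s) *\<^sub>R M.J (incl y) (A.H y)"
  proof (rule inner_form_cancel[OF B.g_inner[of "incl (\<tau>N y)"]])
    show "incl (\<tau>N y) \<in> V'" using y' by (simp add: B.T_iff)
    then have b: "bilinear (g' (incl (\<tau>N y)))" by (rule B.g_bilinear)
    fix \<xi>
    define \<eta> where "\<eta> = M.K (incl y) \<xi>"
    have \<eta>: "\<xi> = M.J (incl y) \<eta>" by (simp add: \<eta>_def M.J_K[OF yV])
    have "g' (incl (\<tau>N y)) (M.J (incl y) (A.H y)) \<xi> = s * mean_curv g G y \<eta>"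
      using M.glaw[OF yV, of "A.H y" \<eta>] by (simp add: \<eta> \<tau>_incl[OF y] s_def A.g_mean_curv_vec[OF y])
    then show "g' (incl (\<tau>N y)) (B.H (\<tau>N y)) \<xi> = g' (incl (\<tau>N y)) ((1 / s) *\<^sub>R M.J (incl y) (A.H y)) \<xi>"
      using nz by (simp add: B.g_mean_curv_vec[OF y'] bilinear_lmul[OF b] \<eta> mean_curv_natural[OF y])
  qed
  then show ?thesis
    using nz by (simp add: fund_form0_def B_natural[OF y] tf_natural[OF y] s_def[symmetric]
        linear_diff[OF jl] linear_scale[OF jl])
qed

lemma ind_zero_order_natural:
  assumes y: "y \<in> A.T"
  shows "ind_zero_order g' G' (\<tau>N y) (N.J y u) (N.J y v) = ind_zero_order g G y u v"
proof -
  note yV = incl_V[OF y] and y' = N.\<tau>_in[OF y]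
  have q: "symm (ricci G' (incl (\<tau>N y))) (incl (N.J y u)) (incl (N.J y v))
      = 1 * symm (ricci G (incl y)) (incl u) (incl v)" for u v
    using M.ricci_natural[OF yV, of "incl u" "incl v"] M.ricci_natural[OF yV, of "incl v" "incl u"]
    by (simp add: symm_def J_incl[OF y] \<tau>_incl[OF y])
  have nz: "M.factor 2 (incl y) \<noteq> 0" using M.factor_pos[OF yV, of 2] by simp
  have "tracefree (B.tf (\<tau>N y)) (\<lambda>u v. symm (ricci G' (incl (\<tau>N y))) (incl u) (incl v)) (N.J y u) (N.J y v)
      = 1 * tracefree (A.tf y) (\<lambda>u v. symm (ricci G (incl y)) (incl u) (incl v)) u v"
    by (rule tracefree_natural[OF A.tf_inner[OF y] B.tf_inner[OF y'] A.ricci_tan_bilinear[OF y]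
          N.J_linear[OF y] N.K_linear[OF y] N.K_J[OF y] N.J_K[OF y] tf_natural[OF y] nz q])
  then show ?thesis
    by (simp only: ind_zero_order_def B0_natural[OF y] mean_curv_natural[OF y] mult_1)
qed

text \<open>The 2n-th root of the identity between Gram determinants. It expresses that
  \<open>w\<close> is an isomorphism of line bundles: it intertwines the density factors of
  \<open>N\<close> and of \<open>M\<close>.\<close>

lemma weight_natural:
  assumes y: "y \<in> A.T"
  shows "B.w (\<tau>N y) * N.factor 1 y = M.factor 1 (incl y) * A.w y"
proof -
  let ?n = "real CARD('n)"
  note yV = incl_V[OF y] and y' = N.\<tau>_in[OF y]
  define d where "d = det (matrix (N.J y))"
  define s where "s = M.factor 1 (incl y)"
  have s: "s > 0" using M.factor_pos[OF yV] by (simp add: s_def)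
  have d: "d \<noteq> 0" using N.det_J_nonzero[OF y] by (simp add: d_def)
  have pa: "det (gram (A.tf y)) > 0" "det (gram (B.tf (\<tau>N y))) > 0"
    using det_gram_pos A.tf_inner[OF y] B.tf_inner[OF y'] by auto
  have "d\<^sup>2 * det (gram (B.tf (\<tau>N y))) = (s\<^sup>2) ^ CARD('n) * det (gram (A.tf y))"
    unfolding d_def s_def
    by (rule det_gram_natural[OF A.tf_bilinear[OF y] B.tf_bilinear[OF y'] N.J_linear[OF y]])
      (simp add: tf_natural[OF y] M.factor_2[OF yV])
  then have "(d\<^sup>2 * det (gram (B.tf (\<tau>N y)))) powr (1 / (2 * ?n))
     = ((s\<^sup>2) ^ CARD('n) * det (gram (A.tf y))) powr (1 / (2 * ?n))" by simp
  moreover have "(d\<^sup>2) powr (1 / (2 * ?n)) = N.factor 1 y"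
    using abs_powr_eq_square_powr[of d "1 / ?n"] by (simp add: N.factor_def d_def power2_eq_square mult.commute)
  moreover have "((s\<^sup>2) ^ CARD('n)) powr (1 / (2 * ?n)) = s"
  proof -
    have "(s\<^sup>2) ^ CARD('n) = s powr (2 * ?n)"
      using powr_realpow[OF s, of "2 * CARD('n)"] by (simp add: power_mult)
    then show ?thesis using s by (simp add: powr_powr)
  qed
  ultimately show ?thesis
    using pa s d by (simp add: powr_mult weight_factor_def s_def mult.commute)
qed

lemma gN_natural:
  assumes y: "y \<in> A.T"
  shows "B.gN (\<tau>N y) (N.J y u) (N.J y v) = N.factor 2 y * A.gN y u v"
proof -
  have p: "N.factor 1 y > 0" "A.w y > 0" "M.factor 1 (incl y) > 0"
    using N.factor_pos[OF y] A.w_pos[OF y] M.factor_pos[OF incl_V[OF y]] by auto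
  then have bw: "B.w (\<tau>N y) = M.factor 1 (incl y) * A.w y / N.factor 1 y"
    using weight_natural[OF y] by (simp add: field_simps)
  show ?thesis
    unfolding A.gN_def B.gN_def tf_natural[OF y] N.factor_2[OF y] M.factor_2[OF incl_V[OF y]] bw
    using p by (simp add: field_simps power2_eq_square)
qed

sublocale NN: weyl_map A.T B.T \<tau>N \<sigma>N A.GN B.GN A.gN B.gN
  by unfold_locales (simp_all add: GN_law gN_natural)

lemma ind_moebius_natural:
  assumes y: "y \<in> A.T" and l: "smooth_on A.T l" and l': "smooth_on B.T l'"
    and rel: "\<And>z. z \<in> A.T \<Longrightarrow> l' (\<tau>N z) = N.factor 1 z * l z"
  shows "hess0 B.GN B.gN l' (\<tau>N y) (N.J y u) (N.J y v) + ind_zero_order g' G' (\<tau>N y) (N.J y u) (N.J y v) * l' (\<tau>N y)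
    = N.factor 1 y * (hess0 A.GN A.gN l y u v + ind_zero_order g G y u v * l y)"
  by (simp add: NN.hess0_natural[OF assms] ind_zero_order_natural[OF y] rel[OF y] algebra_simps)

end

section \<open>The trace-free Hessian as a second order operator\<close>

lemma tr_form_sum: "tr_form b (\<lambda>u v. \<Sum>i\<in>I. q i u v) = (\<Sum>i\<in>I. tr_form b (q i))"
  by (induction I rule: infinite_finite_induct) (simp_all add: tr_form_add, simp_all add: tr_form_def)

lemma tracefree_sum: "tracefree b (\<lambda>u v. \<Sum>i\<in>I. q i u v) u v = (\<Sum>i\<in>I. tracefree b (q i) u v)"
  by (simp add: tracefree_def tr_form_sum sum_subtractf sum_distrib_left)

lemma symm_sum: "symm (\<lambda>u v. \<Sum>i\<in>I. q i u v) u v = (\<Sum>i\<in>I. symm (q i) u v)"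
  by (simp add: symm_def sum.distrib[symmetric] sum_divide_distrib)

lemma symm_mult: "symm (\<lambda>u v. a * q u v) u v = a * symm q u v"
  by (simp add: symm_def algebra_simps)

lemma symm_add: "symm (\<lambda>u v. q u v + r u v) u v = symm q u v + symm r u v"
  by (simp add: symm_def field_simps)

lemma deriv2_expand:
  fixes l :: "real ^ 'm \<Rightarrow> real"
  assumes S: "open S" "x \<in> S" and l: "smooth_on S l"
  shows "deriv_along (\<lambda>z. deriv_along l z v) x u = (\<Sum>p\<in>UNIV. \<Sum>q\<in>UNIV.
    (u $ p * v $ q) * deriv_along (\<lambda>z. deriv_along l z (axis q 1)) x (axis p 1))"
proof -
  have d: "(\<lambda>z. deriv_along l z v) differentiable at x" for v
    by (rule smooth_on_imp_differentiable[OF smooth_on_deriv_along[OF l] S(2)])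
  have 1: "linear (deriv_along (\<lambda>z. deriv_along l z v) x)" for v by (rule linear_deriv_along[OF d])
  have 2: "linear (\<lambda>v. deriv_along (\<lambda>z. deriv_along l z v) x u)" for u
    using linear_deriv_along[OF smooth_on_imp_differentiable[OF l]] d
    by (intro linear_deriv_along_param[OF S]) auto
  have "deriv_along (\<lambda>z. deriv_along l z v) x u
      = (\<Sum>p\<in>UNIV. u $ p * deriv_along (\<lambda>z. deriv_along l z v) x (axis p 1))"
    using linear_expand_axis[OF 1, of v u] by simp
  also have "\<dots> = (\<Sum>p\<in>UNIV. u $ p * (\<Sum>q\<in>UNIV. v $ q * deriv_along (\<lambda>z. deriv_along l z (axis q 1)) x (axis p 1)))"
  proof (rule sum.cong[OF refl])
    fix p
    show "u $ p * deriv_along (\<lambda>z. deriv_along l z v) x (axis p 1)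
        = u $ p * (\<Sum>q\<in>UNIV. v $ q * deriv_along (\<lambda>z. deriv_along l z (axis q 1)) x (axis p 1))"
      using linear_expand_axis[OF 2[of "axis p 1"], of v] by simp
  qed
  finally show ?thesis by (simp add: sum_distrib_left mult.assoc)
qed

context connection_chart
begin

lemma conn_form_G_smooth: "smooth_on S (\<lambda>x. conn_form G x (G x u v))"
  by (rule smooth_on_linear_family[OF open_S conn_form_linear conn_form_smooth G_smooth])

text \<open>The coefficient of the p-th partial derivative in the Hessian, as
  \<open>hess_zero\<close> is that of the section itself; they provide the smooth coefficients
  demanded by \<open>second_order_op\<close>.\<close>

definition hess_first :: "'m \<Rightarrow> real ^ 'm \<Rightarrow> real ^ 'm \<Rightarrow> real ^ 'm \<Rightarrow> real" where
  "hess_first p x u v = conn_form G x v * u $ p + conn_form G x u * v $ p - G x u v $ p"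

definition hess_zero :: "real ^ 'm \<Rightarrow> real ^ 'm \<Rightarrow> real ^ 'm \<Rightarrow> real" where
  "hess_zero x u v = deriv_along (\<lambda>z. conn_form G z v) x u + conn_form G x u * conn_form G x v
     - conn_form G x (G x u v)"

lemma hess_first_smooth: "smooth_on S (\<lambda>x. hess_first p x u v)"
  unfolding hess_first_def
  by (intro smooth_on_diff smooth_on_add smooth_on_mult smooth_on_const conn_form_smooth
      smooth_on_vec_nth[OF G_smooth] open_S)

lemma hess_zero_smooth: "smooth_on S (\<lambda>x. hess_zero x u v)"
  unfolding hess_zero_def
  by (intro smooth_on_diff smooth_on_add smooth_on_mult smooth_on_deriv_along conn_form_smooth
      conn_form_G_smooth open_S)

lemma hess_form_expand:
  assumes x: "x \<in> S" and l: "smooth_on S l"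
  shows "hess_form G l x u v = (\<Sum>p\<in>UNIV. \<Sum>q\<in>UNIV.
      deriv_along (\<lambda>z. deriv_along l z (axis q 1)) x (axis p 1) * (u $ p * v $ q))
    + (\<Sum>p\<in>UNIV. deriv_along l x (axis p 1) * hess_first p x u v) + l x * hess_zero x u v"
proof -
  note dl = smooth_on_has_derivative[OF l x]
  have e: "deriv_along l x w = (\<Sum>p\<in>UNIV. w $ p * deriv_along l x (axis p 1))" for w
    using linear_expand_axis[OF has_derivative_linear[OF dl], of w] by simp
  have "deriv_along (\<lambda>z. deriv_along l z v + conn_form G z v * l z) x u
     = deriv_along (\<lambda>z. deriv_along l z v) x u
       + (conn_form G x v * deriv_along l x u + deriv_along (\<lambda>z. conn_form G z v) x u * l x)"
    by (simp add: deriv_along_eqI[OF has_derivative_add[OF smooth_on_has_derivative[OF smooth_on_deriv_along[OF l] x]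
        has_derivative_mult[OF smooth_on_has_derivative[OF conn_form_smooth x] dl]]])
  then have "hess_form G l x u v = deriv_along (\<lambda>z. deriv_along l z v) x u
     + (conn_form G x v * deriv_along l x u + conn_form G x u * deriv_along l x v - deriv_along l x (G x u v))
     + l x * hess_zero x u v"
    by (simp add: hess_form_eq_gen hess_gen_def hess_zero_def algebra_simps)
  also have "conn_form G x v * deriv_along l x u + conn_form G x u * deriv_along l x v - deriv_along l x (G x u v)
     = (\<Sum>p\<in>UNIV. deriv_along l x (axis p 1) * hess_first p x u v)"
    unfolding e[of u] e[of v] e[of "G x u v"]
    by (simp add: hess_first_def sum_distrib_left sum.distrib[symmetric] sum_subtractf[symmetric] algebra_simps)
  also have "deriv_along (\<lambda>z. deriv_along l z v) x u = (\<Sum>p\<in>UNIV. \<Sum>q\<in>UNIV.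
      deriv_along (\<lambda>z. deriv_along l z (axis q 1)) x (axis p 1) * (u $ p * v $ q))"
    by (simp add: deriv2_expand[OF open_S x l, of v u] mult.commute)
  finally show ?thesis .
qed

end

context weyl_chart
begin

lemma hess0_expand:
  assumes x: "x \<in> S" and l: "smooth_on S l"
  shows "hess0 G g l x u v = (\<Sum>p\<in>UNIV. \<Sum>q\<in>UNIV.
      tracefree (g x) (symm (\<lambda>u v. u $ p * v $ q)) u v * deriv_along (\<lambda>z. deriv_along l z (axis q 1)) x (axis p 1))
    + (\<Sum>p\<in>UNIV. tracefree (g x) (symm (hess_first p x)) u v * deriv_along l x (axis p 1))
    + tracefree (g x) (symm (hess_zero x)) u v * l x"
proof -
  have e: "symm (hess_form G l x) = (\<lambda>u v. (\<Sum>p\<in>UNIV. \<Sum>q\<in>UNIV.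
      deriv_along (\<lambda>z. deriv_along l z (axis q 1)) x (axis p 1) * symm (\<lambda>u v. u $ p * v $ q) u v)
    + (\<Sum>p\<in>UNIV. deriv_along l x (axis p 1) * symm (hess_first p x) u v) + l x * symm (hess_zero x) u v)"
  proof (intro ext)
    fix u v
    have e: "hess_form G l x = (\<lambda>u v. (\<Sum>p\<in>UNIV. \<Sum>q\<in>UNIV.
      deriv_along (\<lambda>z. deriv_along l z (axis q 1)) x (axis p 1) * (u $ p * v $ q))
      + (\<Sum>p\<in>UNIV. deriv_along l x (axis p 1) * hess_first p x u v) + l x * hess_zero x u v)"
      by (intro ext) (rule hess_form_expand[OF x l])
    show "symm (hess_form G l x) u v = (\<Sum>p\<in>UNIV. \<Sum>q\<in>UNIV.
      deriv_along (\<lambda>z. deriv_along l z (axis q 1)) x (axis p 1) * symm (\<lambda>u v. u $ p * v $ q) u v)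
      + (\<Sum>p\<in>UNIV. deriv_along l x (axis p 1) * symm (hess_first p x) u v) + l x * symm (hess_zero x) u v"
      unfolding e symm_add symm_sum symm_mult ..
  qed
  show ?thesis
    unfolding hess0_def e tracefree_add tracefree_sum tracefree_mult by (simp add: mult.commute)
qed

lemma hess0_smooth:
  assumes l: "smooth_on S l"
  shows "smooth_on S (\<lambda>x. hess0 G g l x u v)"
proof (rule smooth_on_cong[OF _ open_S hess0_expand[OF _ l, symmetric]])
  show "smooth_on S (\<lambda>x. (\<Sum>p\<in>UNIV. \<Sum>q\<in>UNIV.
      tracefree (g x) (symm (\<lambda>u v. u $ p * v $ q)) u v * deriv_along (\<lambda>z. deriv_along l z (axis q 1)) x (axis p 1))
    + (\<Sum>p\<in>UNIV. tracefree (g x) (symm (hess_first p x)) u v * deriv_along l x (axis p 1))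
    + tracefree (g x) (symm (hess_zero x)) u v * l x)"
    by (intro smooth_on_add smooth_on_sum smooth_on_mult smooth_on_tracefree smooth_on_symm smooth_on_const
        smooth_on_deriv_along l hess_first_smooth hess_zero_smooth g_inner g_smooth open_S)
qed

lemma hess0_bilinear: "x \<in> S \<Longrightarrow> smooth_on S l \<Longrightarrow> bilinear (hess0 G g l x)"
  unfolding hess0_def
  by (intro bilinear_tracefree bilinear_symm g_bilinear hess_form_bilinear)

lemma hess0_sym: "x \<in> S \<Longrightarrow> hess0 G g l x u v = hess0 G g l x v u"
  using inner_formD(2)[OF g_inner, of x u v]
  by (simp add: hess0_def tracefree_def symm_def add.commute)

lemma hess0_tr: "x \<in> S \<Longrightarrow> tr_form (g x) (hess0 G g l x) = 0"
  unfolding hess0_def by (intro tr_form_tracefree g_inner)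

lemma restrict: "open V \<Longrightarrow> V \<subseteq> S \<Longrightarrow> weyl_chart V G g"
  by unfold_locales (auto intro: G_bilinear G_sym g_inner compat smooth_on_subset[OF G_smooth]
      smooth_on_subset[OF g_smooth])

end

section \<open>Atlases\<close>

text \<open>The properties that slice charts inherit by restriction, so that \<open>M\<close> and
  \<open>N\<close> can be treated alike without a topology on \<open>N\<close>.\<close>

definition regular_atlas :: "('i, 'a, 'm::finite) atlas \<Rightarrow> bool" where
  "regular_atlas \<A> \<longleftrightarrow> (\<forall>i\<in>labels \<A>. inj_on (cmap \<A> i) (cdom \<A> i) \<and> open (cimg \<A> i)) \<and>
     (\<forall>i\<in>labels \<A>. \<forall>j\<in>labels \<A>. open (overlap \<A> i j) \<and> smooth_on (overlap \<A> i j) (transition \<A> i j))"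

lemma is_chart_inj_on: "is_chart X U \<phi> \<Longrightarrow> inj_on \<phi> U"
  unfolding is_chart_def
  by (metis homeomorphic_imp_injective_map openin_subset topspace_subtopology_subset)

lemma is_chart_open_image:
  assumes "is_chart X U \<phi>" "openin X W"
  shows "open (\<phi> ` (U \<inter> W))"
proof -
  have "open_map (subtopology X U) (top_of_set (\<phi> ` U)) \<phi>"
    using assms homeomorphic_imp_open_map unfolding is_chart_def by blast
  moreover have "openin (subtopology X U) (U \<inter> W)" using assms(2) by (rule openin_subtopology_Int2)
  ultimately have "openin (top_of_set (\<phi> ` U)) (\<phi> ` (U \<inter> W))" by (simp add: open_map_def)
  then show ?thesis using assms(1) openin_open_trans unfolding is_chart_def by blast
qed

lemma smooth_atlas_regular:
  assumes "smooth_atlas X \<A>" shows "regular_atlas \<A>"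
proof -
  have c: "is_chart X (cdom \<A> i) (cmap \<A> i)" if "i \<in> labels \<A>" for i
    using assms that by (simp add: smooth_atlas_def)
  then have o: "openin X (cdom \<A> i)" if "i \<in> labels \<A>" for i using that by (simp add: is_chart_def)
  show ?thesis
    unfolding regular_atlas_def
  proof (intro conjI ballI)
    fix i assume i: "i \<in> labels \<A>"
    show "inj_on (cmap \<A> i) (cdom \<A> i)" by (rule is_chart_inj_on[OF c[OF i]])
    show "open (cimg \<A> i)" using c[OF i] by (simp add: is_chart_def cimg_def)
    fix j assume j: "j \<in> labels \<A>"
    show "open (overlap \<A> i j)" unfolding overlap_def by (rule is_chart_open_image[OF c[OF i] o[OF j]])
    have "compatible (cdom \<A> i) (cmap \<A> i) (cdom \<A> j) (cmap \<A> j)"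
      using assms i j unfolding smooth_atlas_def by blast
    then show "smooth_on (overlap \<A> i j) (transition \<A> i j)"
      by (simp add: compatible_def overlap_def transition_def)
  qed
qed

lemma transition_cmap:
  assumes "regular_atlas \<A>" "i \<in> labels \<A>" "p \<in> cdom \<A> i"
  shows "transition \<A> i j (cmap \<A> i p) = cmap \<A> j p"
  using assms by (simp add: transition_def regular_atlas_def)

lemma overlap_subset: "overlap \<A> i j \<subseteq> cimg \<A> i"
  by (auto simp: overlap_def cimg_def)

lemma chart_map_transition:
  assumes r: "regular_atlas \<A>" and i: "i \<in> labels \<A>" and j: "j \<in> labels \<A>"
  shows "chart_map (overlap \<A> i j) (overlap \<A> j i) (transition \<A> i j) (transition \<A> j i)"
proof
  show "open (overlap \<A> i j)" "open (overlap \<A> j i)"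
    "smooth_on (overlap \<A> i j) (transition \<A> i j)" "smooth_on (overlap \<A> j i) (transition \<A> j i)"
    using assms by (auto simp: regular_atlas_def)
  show "transition \<A> i j x \<in> overlap \<A> j i" "transition \<A> j i (transition \<A> i j x) = x"
    if "x \<in> overlap \<A> i j" for x
    using that transition_cmap[OF r i] transition_cmap[OF r j] by (auto simp: overlap_def)
  show "transition \<A> j i x \<in> overlap \<A> i j" "transition \<A> i j (transition \<A> j i x) = x"
    if "x \<in> overlap \<A> j i" for x
    using that transition_cmap[OF r i] transition_cmap[OF r j] by (auto simp: overlap_def)
qed

lemma weyl_structure_chart:
  assumes r: "regular_atlas \<A>" and w: "weyl_structure \<A> c \<Gamma>" and i: "i \<in> labels \<A>"
    and c: "\<And>x. x \<in> cimg \<A> i \<Longrightarrow> inner_form (c i x)" "\<And>u v. smooth_on (cimg \<A> i) (\<lambda>x. c i x u v)"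
  shows "weyl_chart (cimg \<A> i) (\<Gamma> i) (c i)"
proof
  show "open (cimg \<A> i)" using r i by (simp add: regular_atlas_def)
  have t: "torsion_free_connection \<A> \<Gamma>" using w by (simp add: weyl_structure_def)
  show "bilinear (\<Gamma> i x)" "\<Gamma> i x u v = \<Gamma> i x v u" if "x \<in> cimg \<A> i" for x u v
    using t i that unfolding torsion_free_connection_def by blast+
  show "smooth_on (cimg \<A> i) (\<lambda>x. \<Gamma> i x u v)" for u v
    using t i unfolding torsion_free_connection_def by blast
  show "cov_conf (\<Gamma> i) (c i) (\<lambda>_. w) (\<lambda>_. u) (\<lambda>_. v) x = 0" if "x \<in> cimg \<A> i" for x w u v
    using w i that unfolding weyl_structure_def by blast
qed (use c in auto)

lemma weyl_structure_map:
  fixes \<A> :: "('i, 'a, 'm::finite) atlas"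
  assumes r: "regular_atlas \<A>" and w: "weyl_structure \<A> c \<Gamma>" and i: "i \<in> labels \<A>" and j: "j \<in> labels \<A>"
    and ci: "weyl_chart (cimg \<A> i) (\<Gamma> i) (c i)" and cj: "weyl_chart (cimg \<A> j) (\<Gamma> j) (c j)"
    and law: "\<And>x u v. x \<in> overlap \<A> i j \<Longrightarrow>
      c j (transition \<A> i j x) (frechet_derivative (transition \<A> i j) (at x) u) (frechet_derivative (transition \<A> i j) (at x) v)
      = \<bar>det (matrix (frechet_derivative (transition \<A> i j) (at x)))\<bar> powr (2 / real CARD('m)) * c i x u v"
  shows "weyl_map (overlap \<A> i j) (overlap \<A> j i) (transition \<A> i j) (transition \<A> j i) (\<Gamma> i) (\<Gamma> j) (c i) (c j)"
proof -
  interpret C: chart_map "overlap \<A> i j" "overlap \<A> j i" "transition \<A> i j" "transition \<A> j i"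
    by (rule chart_map_transition[OF r i j])
  interpret A: weyl_chart "overlap \<A> i j" "\<Gamma> i" "c i"
    by (rule weyl_chart.restrict[OF ci C.open_V overlap_subset])
  interpret B: weyl_chart "overlap \<A> j i" "\<Gamma> j" "c j"
    by (rule weyl_chart.restrict[OF cj C.open_V' overlap_subset])
  show ?thesis
  proof
    show "\<Gamma> j (transition \<A> i j x) (C.J x u) (C.J x v) = C.J x (\<Gamma> i x u v) - C.D2 x u v"
      if "x \<in> overlap \<A> i j" for x u v
      using w i j that unfolding weyl_structure_def torsion_free_connection_def C.D2_def by (simp add: Let_def)
    show "c j (transition \<A> i j x) (C.J x u) (C.J x v) = C.factor 2 x * c i x u v"
      if "x \<in> overlap \<A> i j" for x u v
      using law[OF that] by (simp add: C.factor_def)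
  qed
qed

lemma conformal_structure_inner:
  assumes "conformal_structure \<A> c" "i \<in> labels \<A>" "x \<in> cimg \<A> i"
  shows "inner_form (c i x)"
  using assms unfolding conformal_structure_def tensor2_def inner_form_def by blast

lemma conformal_structure_smooth:
  assumes "conformal_structure \<A> c" "i \<in> labels \<A>"
  shows "smooth_on (cimg \<A> i) (\<lambda>x. c i x u v)"
  using assms unfolding conformal_structure_def tensor2_def by blast

lemma conformal_structure_law:
  fixes \<A> :: "('i, 'a, 'm::finite) atlas"
  assumes "conformal_structure \<A> c" "i \<in> labels \<A>" "j \<in> labels \<A>" "x \<in> overlap \<A> i j"
  shows "c j (transition \<A> i j x) (frechet_derivative (transition \<A> i j) (at x) u) (frechet_derivative (transition \<A> i j) (at x) v)
      = \<bar>det (matrix (frechet_derivative (transition \<A> i j) (at x)))\<bar> powr (2 / real CARD('m)) * c i x u v"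
  using assms unfolding conformal_structure_def tensor2_def Let_def by blast

lemma dens_section_smooth: "dens_section \<A> UNIV k l \<Longrightarrow> i \<in> labels \<A> \<Longrightarrow> smooth_on (cimg \<A> i) (l i)"
  unfolding dens_section_def cimg_def by simp

section \<open>The atlas of a submanifold\<close>

definition prj :: "real ^ ('n::finite + 'k::finite) \<Rightarrow> real ^ 'n" where "prj x = (\<chi> a. x $ Inl a)"

lemma prj_incl [simp]: "prj (incl y) = y"
  by (simp add: prj_def vec_eq_iff incl_nth)

lemma incl_prj: "x \<in> range incl \<Longrightarrow> incl (prj x) = x"
  by auto

lemma bounded_linear_prj: "bounded_linear prj"
proof -
  have "linear prj" by (rule linearI) (simp_all add: prj_def vec_eq_iff)
  then show ?thesis by (simp add: linear_conv_bounded_linear)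
qed

lemma sub_atlas_simps:
  "labels (sub_atlas \<A> N) = slice_labels \<A> N" "cdom (sub_atlas \<A> N) i = cdom \<A> i \<inter> N"
  "cmap (sub_atlas \<A> N) i p = prj (cmap \<A> i p)"
  by (simp_all add: sub_atlas_def prj_def)

lemma slice_label_label: "i \<in> slice_labels \<A> N \<Longrightarrow> i \<in> labels \<A>"
  by (simp add: slice_labels_def)

lemma slice_cmap_incl:
  "i \<in> slice_labels \<A> N \<Longrightarrow> p \<in> cdom \<A> i \<Longrightarrow> p \<in> N \<Longrightarrow> incl (prj (cmap \<A> i p)) = cmap \<A> i p"
  unfolding slice_labels_def by (intro incl_prj) blast

text \<open>A value of a slice chart inside the slice is already attained at a point of
  \<open>N\<close>; injectivity identifies the two points.\<close>

lemma slice_mem: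
  assumes r: "regular_atlas \<A>" and i: "i \<in> slice_labels \<A> N" and p: "p \<in> cdom \<A> i" "cmap \<A> i p = incl y"
  shows "p \<in> N"
proof -
  have "cmap \<A> i p \<in> cmap \<A> i ` cdom \<A> i" "cmap \<A> i p \<in> range incl" by (rule imageI[OF p(1)]) (simp add: p(2))
  then have "cmap \<A> i p \<in> cmap \<A> i ` (cdom \<A> i \<inter> N)"
    using i unfolding slice_labels_def cimg_def by blast
  then obtain q where q: "q \<in> cdom \<A> i" "q \<in> N" "cmap \<A> i p = cmap \<A> i q" by blast
  have "inj_on (cmap \<A> i) (cdom \<A> i)" using r slice_label_label[OF i] by (simp add: regular_atlas_def)
  then show ?thesis using q p by (metis inj_onD)
qed

lemma cimg_sub_atlas:
  assumes r: "regular_atlas \<A>" and i: "i \<in> slice_labels \<A> N"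
  shows "cimg (sub_atlas \<A> N) i = {y. incl y \<in> cimg \<A> i}"
proof (intro equalityI subsetI)
  show "y \<in> {y. incl y \<in> cimg \<A> i}" if "y \<in> cimg (sub_atlas \<A> N) i" for y
    using that slice_cmap_incl[OF i] by (auto simp: cimg_def sub_atlas_simps)
  show "y \<in> cimg (sub_atlas \<A> N) i" if "y \<in> {y. incl y \<in> cimg \<A> i}" for y
  proof -
    obtain p where p: "p \<in> cdom \<A> i" "cmap \<A> i p = incl y" using \<open>y \<in> _\<close> unfolding cimg_def by auto
    then have "y = cmap (sub_atlas \<A> N) i p" "p \<in> cdom (sub_atlas \<A> N) i"
      using slice_mem[OF r i p] by (simp_all add: sub_atlas_simps)
    then show ?thesis unfolding cimg_def by blast
  qed
qed

lemma overlap_sub_atlas: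
  assumes r: "regular_atlas \<A>" and i: "i \<in> slice_labels \<A> N"
  shows "overlap (sub_atlas \<A> N) i j = {y. incl y \<in> overlap \<A> i j}"
proof (intro equalityI subsetI)
  show "y \<in> {y. incl y \<in> overlap \<A> i j}" if y: "y \<in> overlap (sub_atlas \<A> N) i j" for y
  proof -
    obtain p where p: "p \<in> cdom \<A> i" "p \<in> cdom \<A> j" "p \<in> N" "y = prj (cmap \<A> i p)"
      using y unfolding overlap_def sub_atlas_simps by blast
    have "incl y \<in> cmap \<A> i ` (cdom \<A> i \<inter> cdom \<A> j)"
      unfolding p(4) slice_cmap_incl[OF i p(1,3)] using p by (intro imageI) simp
    then show ?thesis by (simp add: overlap_def)
  qed
  show "y \<in> overlap (sub_atlas \<A> N) i j" if "y \<in> {y. incl y \<in> overlap \<A> i j}" for y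
  proof -
    have "incl y \<in> cmap \<A> i ` (cdom \<A> i \<inter> cdom \<A> j)"
      using \<open>y \<in> _\<close> by (simp add: overlap_def)
    then obtain p where "incl y = cmap \<A> i p" "p \<in> cdom \<A> i \<inter> cdom \<A> j" by (rule imageE)
    then have p: "p \<in> cdom \<A> i" "cmap \<A> i p = incl y" "p \<in> cdom \<A> j" by (blast, metis, blast)
    then have "y = cmap (sub_atlas \<A> N) i p" "p \<in> cdom (sub_atlas \<A> N) i \<inter> cdom (sub_atlas \<A> N) j"
      using slice_mem[OF r i p(1,2)] by (simp_all add: sub_atlas_simps)
    then show ?thesis unfolding overlap_def by (rule image_eqI)
  qed
qed

lemma inj_on_sub_atlas:
  assumes r: "regular_atlas \<A>" and i: "i \<in> slice_labels \<A> N"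
  shows "inj_on (cmap (sub_atlas \<A> N) i) (cdom (sub_atlas \<A> N) i)"
proof (rule inj_onI)
  fix p q assume a: "p \<in> cdom (sub_atlas \<A> N) i" "q \<in> cdom (sub_atlas \<A> N) i"
    "cmap (sub_atlas \<A> N) i p = cmap (sub_atlas \<A> N) i q"
  then have m: "p \<in> cdom \<A> i" "p \<in> N" "q \<in> cdom \<A> i" "q \<in> N"
    and e: "prj (cmap \<A> i p) = prj (cmap \<A> i q)"
    by (simp_all add: sub_atlas_simps)
  have "cmap \<A> i p = cmap \<A> i q"
    using slice_cmap_incl[OF i m(1,2), symmetric] slice_cmap_incl[OF i m(3,4)] e by (simp only:)
  moreover have "inj_on (cmap \<A> i) (cdom \<A> i)"
    using r slice_label_label[OF i] by (simp add: regular_atlas_def)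
  ultimately show "p = q" using m by (meson inj_onD)
qed

lemma transition_sub_atlas:
  assumes r: "regular_atlas \<A>" and i: "i \<in> slice_labels \<A> N" and j: "j \<in> slice_labels \<A> N"
    and y: "incl y \<in> overlap \<A> i j"
  shows "transition \<A> i j (incl y) = incl (transition (sub_atlas \<A> N) i j y)"
    "transition (sub_atlas \<A> N) i j y = prj (transition \<A> i j (incl y))"
proof -
  obtain p where p: "p \<in> cdom \<A> i" "p \<in> cdom \<A> j" "cmap \<A> i p = incl y" using y by (auto simp: overlap_def)
  have pN: "p \<in> N" by (rule slice_mem[OF r i p(1,3)])
  have "transition (sub_atlas \<A> N) i j (cmap (sub_atlas \<A> N) i p) = cmap (sub_atlas \<A> N) j p"
    unfolding transition_def o_apply
    by (subst inv_into_f_f[OF inj_on_sub_atlas[OF r i]]) (simp_all add: sub_atlas_simps p pN)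
  then have e: "transition (sub_atlas \<A> N) i j y = prj (cmap \<A> j p)" using p by (simp add: sub_atlas_simps)
  have "transition \<A> i j (incl y) = cmap \<A> j p"
    using transition_cmap[OF r slice_label_label[OF i] p(1), of j] p by simp
  then show "transition \<A> i j (incl y) = incl (transition (sub_atlas \<A> N) i j y)"
    "transition (sub_atlas \<A> N) i j y = prj (transition \<A> i j (incl y))"
    using slice_cmap_incl[OF j p(2) pN] e by simp_all
qed

lemma open_vimage_incl: "open S \<Longrightarrow> open {y. incl y \<in> S}"
  using linear_continuous_on[OF bounded_linear_incl, of UNIV]
  by (metis continuous_open_vimage continuous_on_eq_continuous_at open_UNIV UNIV_I vimage_def)

lemma regular_sub_atlas:
  assumes r: "regular_atlas \<A>"
  shows "regular_atlas (sub_atlas \<A> N)"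
  unfolding regular_atlas_def sub_atlas_simps(1)
proof (intro conjI ballI)
  fix i assume i: "i \<in> slice_labels \<A> N"
  show "inj_on (cmap (sub_atlas \<A> N) i) (cdom (sub_atlas \<A> N) i)" by (rule inj_on_sub_atlas[OF r i])
  show "open (cimg (sub_atlas \<A> N) i)"
    unfolding cimg_sub_atlas[OF r i]
    using r slice_label_label[OF i] by (intro open_vimage_incl) (simp add: regular_atlas_def)
  fix j assume j: "j \<in> slice_labels \<A> N"
  have V: "open (overlap \<A> i j)" "smooth_on (overlap \<A> i j) (transition \<A> i j)"
    using r slice_label_label[OF i] slice_label_label[OF j] by (auto simp: regular_atlas_def)
  show o: "open (overlap (sub_atlas \<A> N) i j)"
    unfolding overlap_sub_atlas[OF r i] by (rule open_vimage_incl[OF V(1)])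
  have "smooth_on (overlap (sub_atlas \<A> N) i j) (\<lambda>y. transition \<A> i j (incl y))"
    by (rule smooth_on_compose[OF V(2) smooth_on_bounded_linear_id[OF bounded_linear_incl] o V(1)])
      (simp add: overlap_sub_atlas[OF r i])
  then have "smooth_on (overlap (sub_atlas \<A> N) i j) (\<lambda>y. prj (transition \<A> i j (incl y)))"
    by (rule smooth_on_bounded_linear[OF _ o bounded_linear_prj])
  then show "smooth_on (overlap (sub_atlas \<A> N) i j) (transition (sub_atlas \<A> N) i j)"
    by (rule smooth_on_cong[OF _ o])
      (simp add: overlap_sub_atlas[OF r i] transition_sub_atlas(2)[OF r i j])
qed

section \<open>The induced Moebius structure\<close>

lemma dens_section_law:
  fixes \<A> :: "('i, 'a, 'm::finite) atlas"
  assumes "dens_section \<A> UNIV k l" "i \<in> labels \<A>" "j \<in> labels \<A>" "x \<in> overlap \<A> i j"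
  shows "l j (transition \<A> i j x)
    = \<bar>det (matrix (frechet_derivative (transition \<A> i j) (at x)))\<bar> powr (k / real CARD('m)) * l i x"
  using assms unfolding dens_section_def overlap_def Let_def Int_UNIV_right by blast

text \<open>Of a conformal structure only the inner products and their weight are kept, so that \<open>conf_N\<close>
  can be used without checking its normalisation.\<close>

locale conformal_atlas =
  fixes \<A> :: "('i, 'a, 'm::finite) atlas"
    and c :: "'i \<Rightarrow> real ^ 'm \<Rightarrow> real ^ 'm \<Rightarrow> real ^ 'm \<Rightarrow> real"
  assumes regular: "regular_atlas \<A>"
    and c_inner: "i \<in> labels \<A> \<Longrightarrow> x \<in> cimg \<A> i \<Longrightarrow> inner_form (c i x)"
    and c_smooth: "i \<in> labels \<A> \<Longrightarrow> smooth_on (cimg \<A> i) (\<lambda>x. c i x u v)"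
    and c_law: "i \<in> labels \<A> \<Longrightarrow> j \<in> labels \<A> \<Longrightarrow> x \<in> overlap \<A> i j \<Longrightarrow>
      c j (transition \<A> i j x) (frechet_derivative (transition \<A> i j) (at x) u) (frechet_derivative (transition \<A> i j) (at x) v)
      = \<bar>det (matrix (frechet_derivative (transition \<A> i j) (at x)))\<bar> powr (2 / real CARD('m)) * c i x u v"
begin

lemma weyl_chart: "weyl_structure \<A> c \<Gamma> \<Longrightarrow> i \<in> labels \<A> \<Longrightarrow> weyl_chart (cimg \<A> i) (\<Gamma> i) (c i)"
  by (rule weyl_structure_chart[OF regular _ _ c_inner c_smooth])

lemma weyl_map:
  assumes "weyl_structure \<A> c \<Gamma>" "i \<in> labels \<A>" "j \<in> labels \<A>"
  shows "weyl_map (overlap \<A> i j) (overlap \<A> j i) (transition \<A> i j) (transition \<A> j i) (\<Gamma> i) (\<Gamma> j) (c i) (c j)"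
  using assms by (intro weyl_structure_map[OF regular] weyl_chart c_law)

lemma weyl_change:
  "weyl_structure \<A> c \<Gamma> \<Longrightarrow> weyl_structure \<A> c \<Gamma>' \<Longrightarrow> i \<in> labels \<A>
    \<Longrightarrow> weyl_change (cimg \<A> i) (\<Gamma> i) (\<Gamma>' i) (c i)"
  by (intro weyl_change.intro weyl_chart)

lemma change_map:
  assumes "weyl_structure \<A> c \<Gamma>" "weyl_structure \<A> c \<Gamma>'" "i \<in> labels \<A>" "j \<in> labels \<A>"
  shows "change_map (overlap \<A> i j) (overlap \<A> j i) (transition \<A> i j) (transition \<A> j i)
    (\<Gamma> i) (\<Gamma> j) (\<Gamma>' i) (\<Gamma>' j) (c i) (c j)"
proof -
  have o: "open (overlap \<A> i j)" "open (overlap \<A> j i)" using regular assms by (auto simp: regular_atlas_def)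
  show ?thesis
    using assms o
    by (intro change_map.intro weyl_change.intro weyl_map weyl_chart.restrict[OF weyl_chart] overlap_subset)
qed

text \<open>A Moebius structure comes with a zero-order part for one Weyl structure only, but the
  surface version of h refers to the induced one. The correction is the trace-free part of
  \<open>dzero\<close>, and the work lies in showing that it is a tensor.\<close>

lemma zero_order_part_change:
  assumes \<Gamma>: "weyl_structure \<A> c \<Gamma>" and \<Gamma>': "weyl_structure \<A> c \<Gamma>'" and A: "zero_order_part \<A> c D \<Gamma> A"
  shows "\<exists>A'. zero_order_part \<A> c D \<Gamma>' A'"
proof
  define E where "E = (\<lambda>i x. tracefree (c i x) (weyl_change.dzero (\<Gamma> i) (\<Gamma>' i) x))"
  define A' where "A' = (\<lambda>i x u v. A i x u v - E i x u v)"
  have s: "sym_tracefree_section \<A> c 0 A" using A by (simp add: zero_order_part_def)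
  then have t: "tensor2 \<A> 0 A" by (simp add: sym_tracefree_section_def)
  have E: "bilinear (E i x)" "E i x u v = E i x v u" "tr_form (c i x) (E i x) = 0"
    if i: "i \<in> labels \<A>" and x: "x \<in> cimg \<A> i" for i x u v
  proof -
    interpret W: weyl_change "cimg \<A> i" "\<Gamma> i" "\<Gamma>' i" "c i" by (rule weyl_change[OF \<Gamma> \<Gamma>' i])
    show "bilinear (E i x)" unfolding E_def by (rule bilinear_tracefree[OF W.A.g_bilinear[OF x] W.dzero_bilinear[OF x]])
    show "E i x u v = E i x v u"
      unfolding E_def tracefree_def by (simp add: W.dzero_sym[of x u v] inner_formD(2)[OF W.A.g_inner[OF x], of u v])
    show "tr_form (c i x) (E i x) = 0" unfolding E_def by (rule tr_form_tracefree[OF W.A.g_inner[OF x]])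
  qed
  have Es: "smooth_on (cimg \<A> i) (\<lambda>x. E i x u v)" if i: "i \<in> labels \<A>" for i u v
  proof -
    interpret W: weyl_change "cimg \<A> i" "\<Gamma> i" "\<Gamma>' i" "c i" by (rule weyl_change[OF \<Gamma> \<Gamma>' i])
    show ?thesis unfolding E_def by (intro smooth_on_tracefree W.A.open_S W.A.g_inner W.A.g_smooth W.dzero_smooth)
  qed
  have El: "E j (transition \<A> i j x) (frechet_derivative (transition \<A> i j) (at x) u)
      (frechet_derivative (transition \<A> i j) (at x) v) = E i x u v"
    if "i \<in> labels \<A>" "j \<in> labels \<A>" "x \<in> overlap \<A> i j" for i j x u v
    unfolding E_def by (rule change_map.tracefree_dzero_natural[OF change_map[OF \<Gamma> \<Gamma>' that(1,2)] that(3)])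
  \<comment> \<open>Since \<open>0 powr 0 = 0\<close>, weight 0 gives the factor 1 only because the
    Jacobian determinant does not vanish.\<close>
  have pz: "\<bar>det (matrix (frechet_derivative (transition \<A> i j) (at x)))\<bar> powr (0 / real CARD('m)) = 1"
    if i: "i \<in> labels \<A>" and j: "j \<in> labels \<A>" and x: "x \<in> overlap \<A> i j" for i j x
  proof -
    interpret C: chart_map "overlap \<A> i j" "overlap \<A> j i" "transition \<A> i j" "transition \<A> j i"
      by (rule chart_map_transition[OF regular i j])
    show ?thesis using C.det_J_nonzero[OF x] by simp
  qed
  have "tensor2 \<A> 0 A'"
    unfolding tensor2_def Let_def
  proof (intro conjI ballI allI)
    fix i assume i: "i \<in> labels \<A>"
    have "open (cimg \<A> i)" using regular i by (simp add: regular_atlas_def)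
    then show "smooth_on (cimg \<A> i) (\<lambda>x. A' i x u v)" for u v
      using t i Es[OF i] unfolding A'_def tensor2_def by (intro smooth_on_diff) auto
    show "bilinear (A' i x)" if x: "x \<in> cimg \<A> i" for x
    proof -
      have "bilinear (A i x)" using t i x unfolding tensor2_def by blast
      then show ?thesis using E(1)[OF i x] unfolding A'_def bilinear_def by (simp add: linear_iff algebra_simps)
    qed
    fix j x u v assume j: "j \<in> labels \<A>" and x: "x \<in> overlap \<A> i j"
    show "A' j (transition \<A> i j x) (frechet_derivative (transition \<A> i j) (at x) u) (frechet_derivative (transition \<A> i j) (at x) v)
      = \<bar>det (matrix (frechet_derivative (transition \<A> i j) (at x)))\<bar> powr (0 / real CARD('m)) * A' i x u v"
      using t i j x unfolding tensor2_def Let_def A'_def El[OF i j x] pz[OF i j x] by (simp add: pz[OF i j x, simplified])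
  qed
  then have "sym_tracefree_section \<A> c 0 A'"
    using s E(2,3) unfolding sym_tracefree_section_def A'_def by (simp add: tr_form_diff)
  moreover have "D l i x u v - hess0 (\<Gamma>' i) (c i) (l i) x u v = A' i x u v * l i x"
    if l: "dens_section \<A> UNIV 1 l" and i: "i \<in> labels \<A>" and x: "x \<in> cimg \<A> i" for l i x u v
  proof -
    interpret W: weyl_change "cimg \<A> i" "\<Gamma> i" "\<Gamma>' i" "c i" by (rule weyl_change[OF \<Gamma> \<Gamma>' i])
    have "D l i x u v - hess0 (\<Gamma> i) (c i) (l i) x u v = A i x u v * l i x"
      using A l i x unfolding zero_order_part_def by blast
    then show ?thesis
      using W.hess0_change[OF x dens_section_smooth[OF l i], of u v] by (simp add: A'_def E_def algebra_simps)
  qed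
  ultimately show "zero_order_part \<A> c D \<Gamma>' A'" by (simp add: zero_order_part_def)
qed

end

section \<open>The induced operator on the whole submanifold\<close>

locale conformal_submanifold =
  fixes X :: "'a topology"
    and \<A> :: "('i, 'a, 'n::finite + 'k::finite) atlas"
    and N :: "'a set"
    and c :: "'i \<Rightarrow> real ^ ('n + 'k) \<Rightarrow> real ^ ('n + 'k) \<Rightarrow> real ^ ('n + 'k) \<Rightarrow> real"
    and \<Gamma> :: "'i \<Rightarrow> real ^ ('n + 'k) \<Rightarrow> real ^ ('n + 'k) \<Rightarrow> real ^ ('n + 'k) \<Rightarrow> real ^ ('n + 'k)"
  assumes manifold: "smooth_manifold X \<A>"
    and conformal: "conformal_structure \<A> c"
    and submanifold: "submanifold X \<A> N"
    and dim_N: "CARD('n) \<ge> 2"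
    and weyl: "weyl_structure \<A> c \<Gamma>"
begin

abbreviation \<S> :: "('i, 'a, 'n) atlas" where "\<S> \<equiv> sub_atlas \<A> N"

lemma smooth_atlas: "smooth_atlas X \<A>" using manifold by (simp add: smooth_manifold_def)

text \<open>Types are nonempty, so the codimension is at least 1 and m - 2 is positive.\<close>

lemma dim_M: "CARD('n + 'k) \<ge> 3"
proof -
  have "CARD('k) > 0" "CARD('n + 'k) = CARD('n) + CARD('k)" by simp_all
  then show ?thesis using dim_N by linarith
qed

lemma regular: "regular_atlas \<A>" by (rule smooth_atlas_regular[OF smooth_atlas])

sublocale M: conformal_atlas \<A> c
  by unfold_locales
    (use regular conformal_structure_inner[OF conformal] conformal_structure_smooth[OF conformal]
      conformal_structure_law[OF conformal] in auto)

lemma slice_chart: "weyl_structure \<A> c G \<Longrightarrow> i \<in> slice_labels \<A> N \<Longrightarrow> slice_chart (cimg \<A> i) (G i) (c i)"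
  by (intro slice_chart.intro M.weyl_chart slice_label_label)

lemma T_eq: "i \<in> slice_labels \<A> N \<Longrightarrow> slice_chart.T (cimg \<A> i) = cimg \<S> i"
  by (simp add: slice_chart.T_def[OF slice_chart[OF weyl]] cimg_sub_atlas[OF regular])

lemma conf_N_eq: "i \<in> slice_labels \<A> N \<Longrightarrow> conf_N c i = slice_chart.gN (c i)"
  by (intro ext) (simp add: conf_N_def slice_chart.gN_def[OF slice_chart[OF weyl]])

lemma slice_map:
  assumes G: "weyl_structure \<A> c G" and i: "i \<in> slice_labels \<A> N" and j: "j \<in> slice_labels \<A> N"
  shows "slice_map (overlap \<A> i j) (overlap \<A> j i) (transition \<A> i j) (transition \<A> j i)
    (G i) (G j) (c i) (c j) (transition \<S> i j) (transition \<S> j i)"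
    "slice_chart.T (overlap \<A> i j) = overlap \<S> i j"
proof -
  note l = slice_label_label[OF i] slice_label_label[OF j]
  have o: "open (overlap \<A> i j)" "open (overlap \<A> j i)" using regular l by (auto simp: regular_atlas_def)
  have s: "slice_chart (overlap \<A> i j) (G i) (c i)" "slice_chart (overlap \<A> j i) (G j) (c j)"
    using l o G by (intro slice_chart.intro weyl_chart.restrict[OF M.weyl_chart] overlap_subset; simp)+
  show T: "slice_chart.T (overlap \<A> i j) = overlap \<S> i j"
    by (simp add: slice_chart.T_def[OF s(1)] overlap_sub_atlas[OF regular i])
  have T': "slice_chart.T (overlap \<A> j i) = overlap \<S> j i"
    by (simp add: slice_chart.T_def[OF s(2)] overlap_sub_atlas[OF regular j])
  show "slice_map (overlap \<A> i j) (overlap \<A> j i) (transition \<A> i j) (transition \<A> j i)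
    (G i) (G j) (c i) (c j) (transition \<S> i j) (transition \<S> j i)"
  proof (rule slice_map.intro[OF s M.weyl_map[OF G l]])
    show "chart_map (slice_chart.T (overlap \<A> i j)) (slice_chart.T (overlap \<A> j i)) (transition \<S> i j) (transition \<S> j i)"
      unfolding T T' using i j by (intro chart_map_transition regular_sub_atlas regular) (simp_all add: sub_atlas_simps)
    show "slice_map_axioms (overlap \<A> i j) (transition \<A> i j) (transition \<S> i j)"
      unfolding slice_map_axioms_def T
      using transition_sub_atlas(1)[OF regular i j] by (simp add: overlap_sub_atlas[OF regular i])
  qed
qed

sublocale N: conformal_atlas \<S> "conf_N c"
proof
  show "regular_atlas \<S>" by (rule regular_sub_atlas[OF regular])
  fix i assume "i \<in> labels \<S>"
  then have i: "i \<in> slice_labels \<A> N" by (simp add: sub_atlas_simps)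
  interpret SC: slice_chart "cimg \<A> i" "\<Gamma> i" "c i" by (rule slice_chart[OF weyl i])
  show "inner_form (conf_N c i x)" if "x \<in> cimg \<S> i" for x
    using SC.gN_inner that by (simp add: T_eq[OF i] conf_N_eq[OF i])
  show "smooth_on (cimg \<S> i) (\<lambda>x. conf_N c i x u v)" for u v
    using SC.gN_smooth by (simp add: T_eq[OF i] conf_N_eq[OF i])
  fix j x u v assume "j \<in> labels \<S>" and x: "x \<in> overlap \<S> i j"
  then have j: "j \<in> slice_labels \<A> N" by (simp add: sub_atlas_simps)
  interpret SM: slice_map "overlap \<A> i j" "overlap \<A> j i" "transition \<A> i j" "transition \<A> j i"
    "\<Gamma> i" "\<Gamma> j" "c i" "c j" "transition \<S> i j" "transition \<S> j i" by (rule slice_map(1)[OF weyl i j])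
  show "conf_N c j (transition \<S> i j x) (SM.N.J x u) (SM.N.J x v)
      = \<bar>det (matrix (SM.N.J x))\<bar> powr (2 / real CARD('n)) * conf_N c i x u v"
    using SM.gN_natural[of x u v] x
    by (simp add: slice_map(2)[OF weyl i j] conf_N_eq[OF i] conf_N_eq[OF j] SM.N.factor_def)
qed

lemma weyl_N: "weyl_structure \<A> c G \<Longrightarrow> weyl_structure \<S> (conf_N c) (weyl_N c G)"
  unfolding weyl_structure_def[of \<S>] torsion_free_connection_def Let_def weyl_N_def
proof (intro conjI ballI allI)
  assume G: "weyl_structure \<A> c G"
  fix i assume "i \<in> labels \<S>"
  then have i: "i \<in> slice_labels \<A> N" by (simp add: sub_atlas_simps)
  interpret SC: slice_chart "cimg \<A> i" "G i" "c i" by (rule slice_chart[OF G i])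
  show "smooth_on (cimg \<S> i) (\<lambda>x. christoffel_N (c i) (G i) x u v)" for u v
    using SC.N.G_smooth by (simp add: T_eq[OF i])
  fix x u v
  show "bilinear (christoffel_N (c i) (G i) x)" "christoffel_N (c i) (G i) x u v = christoffel_N (c i) (G i) x v u"
    "cov_conf (christoffel_N (c i) (G i)) (conf_N c i) (\<lambda>_. w) (\<lambda>_. u) (\<lambda>_. v) x = 0"
    if "x \<in> cimg \<S> i" for w
    using SC.N.G_bilinear SC.N.G_sym SC.N.compat that by (simp_all add: T_eq[OF i] conf_N_eq[OF i])
  fix j assume "j \<in> labels \<S>" and x: "x \<in> overlap \<S> i j"
  then have j: "j \<in> slice_labels \<A> N" by (simp add: sub_atlas_simps)
  interpret SM: slice_map "overlap \<A> i j" "overlap \<A> j i" "transition \<A> i j" "transition \<A> j i"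
    "G i" "G j" "c i" "c j" "transition \<S> i j" "transition \<S> j i" by (rule slice_map(1)[OF G i j])
  show "christoffel_N (c j) (G j) (transition \<S> i j x) (SM.N.J x u) (SM.N.J x v) =
      SM.N.J x (christoffel_N (c i) (G i) x u v)
      - deriv_along (\<lambda>z. SM.N.J z v) x u"
    using SM.GN_law[of x u v] x by (simp add: slice_map(2)[OF G i j] SM.N.D2_def)
qed

lemma ind_moebius_eq:
  assumes G: "weyl_structure \<A> c G" and l: "dens_section \<S> UNIV 1 l"
    and i: "i \<in> slice_labels \<A> N" and y: "y \<in> cimg \<S> i"
  shows "ind_moebius c G l i y u v
    = hess0 (weyl_N c G i) (conf_N c i) (l i) y u v + ind_zero_order (c i) (G i) y u v * l i y"
proof -
  interpret SC: slice_chart "cimg \<A> i" "G i" "c i" by (rule slice_chart[OF G i])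
  have T: "SC.T = cimg \<S> i" by (rule T_eq[OF i])
  have "smooth_on SC.T (l i)" unfolding T using l i by (intro dens_section_smooth) (simp_all add: sub_atlas_simps)
  from SC.ind_moebius_local_eq[OF _ this, of y u v] SC.w_pos[of y] show ?thesis
    using y unfolding T ind_moebius_def dens_on_N_def[abs_def] weyl_N_def conf_N_eq[OF i] by simp
qed

lemma ind_moebius_independent:
  assumes G: "weyl_structure \<A> c G" and l: "dens_section \<S> UNIV 1 l"
    and i: "i \<in> slice_labels \<A> N" and y: "y \<in> cimg \<S> i"
  shows "ind_moebius c \<Gamma> l i y u v = ind_moebius c G l i y u v"
proof -
  interpret SC: slice_change "cimg \<A> i" "\<Gamma> i" "G i" "c i"
    by (intro slice_change.intro slice_chart weyl G i)
  have T: "SC.A.T = cimg \<S> i" by (rule T_eq[OF i])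
  have "smooth_on SC.A.T (l i)" unfolding T using l i by (intro dens_section_smooth) (simp_all add: sub_atlas_simps)
  from SC.ind_moebius_local_change[OF _ this dim_M, of y u v] show ?thesis
    using y unfolding T ind_moebius_def dens_on_N_def[abs_def] by simp
qed

lemma ind_moebius_tensor2:
  assumes l: "dens_section \<S> UNIV 1 l"
  shows "tensor2 \<S> 1 (ind_moebius c \<Gamma> l)"
  unfolding tensor2_def Let_def
proof (intro conjI ballI allI)
  fix i assume iN: "i \<in> labels \<S>"
  then have i: "i \<in> slice_labels \<A> N" by (simp add: sub_atlas_simps)
  interpret SC: slice_chart "cimg \<A> i" "\<Gamma> i" "c i" by (rule slice_chart[OF weyl i])
  have T: "SC.T = cimg \<S> i" by (rule T_eq[OF i])
  have li: "smooth_on (cimg \<S> i) (l i)" by (rule dens_section_smooth[OF l iN])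
  note eq = ind_moebius_eq[OF weyl l i, unfolded weyl_N_def conf_N_eq[OF i], folded T]
  show "bilinear (ind_moebius c \<Gamma> l i y)" if y: "y \<in> cimg \<S> i" for y
  proof -
    have yT: "y \<in> SC.T" using y by (simp add: T)
    have "ind_moebius c \<Gamma> l i y = (\<lambda>u v. hess0 SC.GN SC.gN (l i) y u v + ind_zero_order (c i) (\<Gamma> i) y u v * l i y)"
      by (intro ext eq[OF yT])
    moreover have "bilinear (hess0 SC.GN SC.gN (l i) y)" using li by (intro SC.N.hess0_bilinear[OF yT]) (simp add: T)
    ultimately show ?thesis
      using SC.ind_zero_order_bilinear[OF yT] unfolding bilinear_def by (simp add: linear_iff algebra_simps)
  qed
  show "smooth_on (cimg \<S> i) (\<lambda>y. ind_moebius c \<Gamma> l i y u v)" for u v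
    unfolding T[symmetric]
    by (rule smooth_on_cong[OF _ SC.open_T eq[symmetric]])
      (use li in \<open>auto simp: T[symmetric] intro!: smooth_on_add smooth_on_mult SC.N.hess0_smooth
        SC.ind_zero_order_smooth SC.open_T\<close>)
  fix j y u v assume jN: "j \<in> labels \<S>" and y: "y \<in> overlap \<S> i j"
  then have j: "j \<in> slice_labels \<A> N" by (simp add: sub_atlas_simps)
  have lj: "smooth_on (cimg \<S> j) (l j)" by (rule dens_section_smooth[OF l jN])
  interpret SM: slice_map "overlap \<A> i j" "overlap \<A> j i" "transition \<A> i j" "transition \<A> j i"
    "\<Gamma> i" "\<Gamma> j" "c i" "c j" "transition \<S> i j" "transition \<S> j i" by (rule slice_map(1)[OF weyl i j])
  have T2: "SM.A.T = overlap \<S> i j" "SM.B.T = overlap \<S> j i"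
    using slice_map(2)[OF weyl] i j by auto
  have y': "transition \<S> i j y \<in> cimg \<S> j" "y \<in> cimg \<S> i"
    using SM.N.\<tau>_in[of y] y subsetD[OF overlap_subset[of \<S> i j]] subsetD[OF overlap_subset[of \<S> j i]]
    by (simp_all add: T2)
  have "hess0 SM.B.GN SM.B.gN (l j) (transition \<S> i j y) (SM.N.J y u) (SM.N.J y v)
      + ind_zero_order (c j) (\<Gamma> j) (transition \<S> i j y) (SM.N.J y u) (SM.N.J y v) * l j (transition \<S> i j y)
    = SM.N.factor 1 y * (hess0 SM.A.GN SM.A.gN (l i) y u v + ind_zero_order (c i) (\<Gamma> i) y u v * l i y)"
  proof (rule SM.ind_moebius_natural)
    show "y \<in> SM.A.T" "smooth_on SM.A.T (l i)" "smooth_on SM.B.T (l j)"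
      using y smooth_on_subset[OF li overlap_subset] smooth_on_subset[OF lj overlap_subset] by (simp_all add: T2)
    show "l j (transition \<S> i j z) = SM.N.factor 1 z * l i z" if "z \<in> SM.A.T" for z
      using dens_section_law[OF l iN jN, of z] that by (simp add: T2 SM.N.factor_def)
  qed
  then show "ind_moebius c \<Gamma> l j (transition \<S> i j y) (SM.N.J y u) (SM.N.J y v)
      = \<bar>det (matrix (SM.N.J y))\<bar> powr (1 / real CARD('n)) * ind_moebius c \<Gamma> l i y u v"
    unfolding ind_moebius_eq[OF weyl l i y'(2)] ind_moebius_eq[OF weyl l j y'(1)] weyl_N_def
      conf_N_eq[OF i] conf_N_eq[OF j] SM.N.factor_def by simp
qed

lemma ind_zero_order_tensor2: "tensor2 \<S> 0 (\<lambda>i. ind_zero_order (c i) (\<Gamma> i))"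
  unfolding tensor2_def Let_def
proof (intro conjI ballI allI)
  fix i assume "i \<in> labels \<S>"
  then have i: "i \<in> slice_labels \<A> N" by (simp add: sub_atlas_simps)
  interpret SC: slice_chart "cimg \<A> i" "\<Gamma> i" "c i" by (rule slice_chart[OF weyl i])
  have T: "SC.T = cimg \<S> i" by (rule T_eq[OF i])
  show "bilinear (ind_zero_order (c i) (\<Gamma> i) y)" if "y \<in> cimg \<S> i" for y
    using SC.ind_zero_order_bilinear that by (simp add: T)
  show "smooth_on (cimg \<S> i) (\<lambda>y. ind_zero_order (c i) (\<Gamma> i) y u v)" for u v
    using SC.ind_zero_order_smooth by (simp add: T)
  fix j y u v assume "j \<in> labels \<S>" and y: "y \<in> overlap \<S> i j"
  then have j: "j \<in> slice_labels \<A> N" by (simp add: sub_atlas_simps)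
  interpret SM: slice_map "overlap \<A> i j" "overlap \<A> j i" "transition \<A> i j" "transition \<A> j i"
    "\<Gamma> i" "\<Gamma> j" "c i" "c j" "transition \<S> i j" "transition \<S> j i" by (rule slice_map(1)[OF weyl i j])
  have y': "y \<in> SM.A.T" using y by (simp add: slice_map(2)[OF weyl i j])
  show "ind_zero_order (c j) (\<Gamma> j) (transition \<S> i j y) (SM.N.J y u) (SM.N.J y v)
      = \<bar>det (matrix (SM.N.J y))\<bar> powr (0 / real CARD('n)) * ind_zero_order (c i) (\<Gamma> i) y u v"
    using SM.ind_zero_order_natural[OF y'] SM.N.det_J_nonzero[OF y'] by simp
qed

lemma ind_zero_order_sym_tracefree:
  assumes i: "i \<in> slice_labels \<A> N" and y: "y \<in> cimg \<S> i"
  shows "ind_zero_order (c i) (\<Gamma> i) y u v = ind_zero_order (c i) (\<Gamma> i) y v u"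
    "tr_form (conf_N c i y) (ind_zero_order (c i) (\<Gamma> i) y) = 0"
proof -
  interpret SC: slice_chart "cimg \<A> i" "\<Gamma> i" "c i" by (rule slice_chart[OF weyl i])
  have "y \<in> SC.T" using y by (simp add: T_eq[OF i])
  then show "ind_zero_order (c i) (\<Gamma> i) y u v = ind_zero_order (c i) (\<Gamma> i) y v u"
    "tr_form (conf_N c i y) (ind_zero_order (c i) (\<Gamma> i) y) = 0"
    using SC.ind_zero_order_sym SC.ind_zero_order_tr by (simp_all add: conf_N_eq[OF i])
qed

lemma ind_moebius_zero_order_part:
  "zero_order_part \<S> (conf_N c) (ind_moebius c \<Gamma>) (weyl_N c \<Gamma>) (\<lambda>i. ind_zero_order (c i) (\<Gamma> i))"
  unfolding zero_order_part_def sym_tracefree_section_def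
  using ind_zero_order_tensor2 ind_zero_order_sym_tracefree ind_moebius_eq[OF weyl]
  by (simp add: sub_atlas_simps)

lemma ind_moebius_section:
  assumes l: "dens_section \<S> UNIV 1 l"
  shows "sym_tracefree_section \<S> (conf_N c) 1 (ind_moebius c \<Gamma> l)"
  unfolding sym_tracefree_section_def
proof (intro conjI ballI allI ind_moebius_tensor2[OF l])
  fix i y assume iN: "i \<in> labels \<S>" and y: "y \<in> cimg \<S> i"
  then have i: "i \<in> slice_labels \<A> N" by (simp add: sub_atlas_simps)
  interpret W: weyl_chart "cimg \<S> i" "weyl_N c \<Gamma> i" "conf_N c i" by (rule N.weyl_chart[OF weyl_N[OF weyl] iN])
  note eq = ind_moebius_eq[OF weyl l i y]
  show "ind_moebius c \<Gamma> l i y u v = ind_moebius c \<Gamma> l i y v u" for u v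
    by (simp add: eq W.hess0_sym[OF y, of _ u v] ind_zero_order_sym_tracefree(1)[OF i y, of u v])
  have "ind_moebius c \<Gamma> l i y = (\<lambda>u v. hess0 (weyl_N c \<Gamma> i) (conf_N c i) (l i) y u v
      + l i y * ind_zero_order (c i) (\<Gamma> i) y u v)"
    by (intro ext) (simp add: eq)
  then show "tr_form (conf_N c i y) (ind_moebius c \<Gamma> l i y) = 0"
    by (simp add: tr_form_add tr_form_mult W.hess0_tr[OF y] ind_zero_order_sym_tracefree(2)[OF i y])
qed

lemma ind_moebius_second_order: "second_order_op \<S> (ind_moebius c \<Gamma>)"
  unfolding second_order_op_def
proof (intro conjI ballI allI impI ind_moebius_tensor2)
  fix i assume iN: "i \<in> labels \<S>"
  then have i: "i \<in> slice_labels \<A> N" by (simp add: sub_atlas_simps)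
  interpret SC: slice_chart "cimg \<A> i" "\<Gamma> i" "c i" by (rule slice_chart[OF weyl i])
  interpret W: weyl_chart "cimg \<S> i" "weyl_N c \<Gamma> i" "conf_N c i" by (rule N.weyl_chart[OF weyl_N[OF weyl] iN])
  have T: "SC.T = cimg \<S> i" by (rule T_eq[OF i])
  let ?t = "\<lambda>x q. tracefree (conf_N c i x) (symm q)"
  let ?a = "\<lambda>p q x. ?t x (\<lambda>u v. u $ p * v $ q)" and ?b = "\<lambda>p x. ?t x (W.hess_first p x)"
    and ?e = "\<lambda>x u v. ?t x (W.hess_zero x) u v + ind_zero_order (c i) (\<Gamma> i) x u v"
  have "smooth_on (cimg \<S> i) (\<lambda>x. ?a p q x u v)" "smooth_on (cimg \<S> i) (\<lambda>x. ?b p x u v)"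
    "smooth_on (cimg \<S> i) (\<lambda>x. ?e x u v)" for p q u v
    using SC.ind_zero_order_smooth unfolding T
    by (intro smooth_on_add smooth_on_tracefree smooth_on_symm smooth_on_const W.hess_first_smooth
        W.hess_zero_smooth W.g_inner W.g_smooth W.open_S; simp)+
  moreover have "ind_moebius c \<Gamma> l i x u v =
      (\<Sum>p\<in>UNIV. \<Sum>q\<in>UNIV. ?a p q x u v * deriv_along (\<lambda>z. deriv_along (l i) z (axis q 1)) x (axis p 1))
      + (\<Sum>p\<in>UNIV. ?b p x u v * deriv_along (l i) x (axis p 1)) + ?e x u v * l i x"
    if "dens_section \<S> UNIV 1 l" "x \<in> cimg \<S> i" for l x u v
    unfolding ind_moebius_eq[OF weyl that(1) i that(2)] W.hess0_expand[OF that(2) dens_section_smooth[OF that(1) iN]]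
    by (simp add: distrib_right)
  ultimately show "\<exists>a b e.
        (\<forall>p q u v. smooth_on (cimg \<S> i) (\<lambda>x. a p q x u v)) \<and>
        (\<forall>p u v. smooth_on (cimg \<S> i) (\<lambda>x. b p x u v)) \<and>
        (\<forall>u v. smooth_on (cimg \<S> i) (\<lambda>x. e x u v)) \<and>
        (\<forall>l. dens_section \<S> UNIV 1 l \<longrightarrow> (\<forall>x\<in>cimg \<S> i. \<forall>u v.
           ind_moebius c \<Gamma> l i x u v =
             (\<Sum>p\<in>UNIV. \<Sum>q\<in>UNIV. (a p q x u v :: real) *
                deriv_along (\<lambda>z. deriv_along (l i) z (axis q 1)) x (axis p 1))
             + (\<Sum>p\<in>UNIV. (b p x u v :: real) * deriv_along (l i) x (axis p 1))
             + (e x u v :: real) * l i x))"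
    by (intro exI[of _ ?a] exI[of _ ?b] exI[of _ ?e]) blast
qed

lemma ind_moebius_structure: "moebius_structure \<S> (conf_N c) (ind_moebius c \<Gamma>)"
  unfolding moebius_structure_def
  using ind_moebius_second_order ind_moebius_section weyl_N[OF weyl] ind_moebius_zero_order_part by blast

section \<open>Comparison with the relative Schouten-Weyl tensor\<close>

lemma tracefree_rel_schouten_weyl_N:
  assumes i: "i \<in> slice_labels \<A> N" and y: "y \<in> cimg \<S> i"
    and A: "tr_form (conf_N c i y) A = 0"
    and h: "\<And>u v. h y u v = A u v + t * conf_N c i y u v - (1 / 2) * faraday (weyl_N c \<Gamma> i) y u v"
  shows "tracefree (conf_N c i y) (rel_schouten_weyl (c i) (\<Gamma> i) h y) u v
    = ind_zero_order (c i) (\<Gamma> i) y u v - A u v"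
proof -
  interpret SC: slice_chart "cimg \<A> i" "\<Gamma> i" "c i" by (rule slice_chart[OF weyl i])
  have "y \<in> SC.T" using y by (simp add: T_eq[OF i])
  then show ?thesis
    unfolding conf_N_eq[OF i]
    by (rule SC.tracefree_rel_schouten_weyl[where t = t])
      (use A h in \<open>simp_all add: conf_N_eq[OF i] weyl_N_def tracefree_trivial\<close>)
qed

text \<open>The canonical structure is moved from the arbitrary \<open>\<Gamma>N\<close> to the
  induced Weyl structure. There the two trace-free Hessians coincide, and only zero-order parts
  remain to be compared.\<close>

lemma ind_moebius_canonical:
  assumes n: "CARD('n) \<ge> 3" and GN: "weyl_structure \<S> (conf_N c) \<Gamma>N" and l: "dens_section \<S> UNIV 1 l"
    and i: "i \<in> slice_labels \<A> N" and y: "y \<in> cimg \<S> i"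
  shows "ind_moebius c \<Gamma> l i y u v - canonical_moebius (conf_N c) \<Gamma>N l i y u v =
    tracefree (conf_N c i y) (rho c \<Gamma> i y) u v * l i y"
proof -
  have iN: "i \<in> labels \<S>" using i by (simp add: sub_atlas_simps)
  interpret W: weyl_change "cimg \<S> i" "weyl_N c \<Gamma> i" "\<Gamma>N i" "conf_N c i"
    by (rule N.weyl_change[OF weyl_N[OF weyl] GN iN])
  define t where "t = (1 / real CARD('n)) * sigma (weyl_N c \<Gamma> i) (conf_N c i) y"
  define p where "p = 1 / (real CARD('n) - 2)"
  define A where "A = (\<lambda>u v. p * tracefree (conf_N c i y) (symm (ricci (weyl_N c \<Gamma> i) y)) u v)"
  have A: "tr_form (conf_N c i y) A = 0"
    by (simp add: A_def tr_form_mult tr_form_tracefree[OF W.A.g_inner[OF y]])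
  have "tracefree (conf_N c i y) (rho c \<Gamma> i y) u v = ind_zero_order (c i) (\<Gamma> i) y u v - A u v"
    unfolding rho_def
    by (rule tracefree_rel_schouten_weyl_N[OF i y A, of _ t]) (simp add: schouten_weyl_def A_def t_def p_def)
  moreover have "canonical_moebius (conf_N c) \<Gamma>N l i y u v
      = hess0 (weyl_N c \<Gamma> i) (conf_N c i) (l i) y u v + A u v * l i y"
    unfolding canonical_moebius_def W.canonical_moebius_change[OF y dens_section_smooth[OF l iN] n]
      W.A.tracefree_symm_schouten_weyl[OF y] by (simp add: A_def p_def)
  ultimately show ?thesis by (simp add: ind_moebius_eq[OF weyl l i y] left_diff_distrib)
qed

text \<open>The same chosen zero-order part occurs in \<open>D\<close> and in \<rho>, so all that
  matters is that the choice is made from a nonempty set; \<open>zero_order_part_change\<close>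
  provides this for the induced Weyl structure.\<close>

lemma ind_moebius_surface:
  assumes D: "moebius_structure \<S> (conf_N c) D" and l: "dens_section \<S> UNIV 1 l"
    and i: "i \<in> slice_labels \<A> N" and y: "y \<in> cimg \<S> i"
  shows "ind_moebius c \<Gamma> l i y u v - D l i y u v =
    tracefree (conf_N c i y) (rho_surface \<A> N c D \<Gamma> i y) u v * l i y"
proof -
  have iN: "i \<in> labels \<S>" using i by (simp add: sub_atlas_simps)
  obtain \<Gamma>0 A0 where "weyl_structure \<S> (conf_N c) \<Gamma>0" "zero_order_part \<S> (conf_N c) D \<Gamma>0 A0"
    using D unfolding moebius_structure_def by blast
  from N.zero_order_part_change[OF this(1) weyl_N[OF weyl] this(2)]
  have "zero_order_part \<S> (conf_N c) D (weyl_N c \<Gamma>) (SOME A. zero_order_part \<S> (conf_N c) D (weyl_N c \<Gamma>) A)"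
    by (rule someI_ex)
  moreover define A where "A = (SOME A. zero_order_part \<S> (conf_N c) D (weyl_N c \<Gamma>) A)"
  ultimately have z: "zero_order_part \<S> (conf_N c) D (weyl_N c \<Gamma>) A" by simp
  have tr: "tr_form (conf_N c i y) (A i y) = 0"
    using z iN y unfolding zero_order_part_def sym_tracefree_section_def by blast
  have "D l i y u v = hess0 (weyl_N c \<Gamma> i) (conf_N c i) (l i) y u v + A i y u v * l i y"
    using z l iN y unfolding zero_order_part_def by (simp add: algebra_simps)
  moreover have "tracefree (conf_N c i y) (rho_surface \<A> N c D \<Gamma> i y) u v
      = ind_zero_order (c i) (\<Gamma> i) y u v - A i y u v"
    unfolding rho_surface_def
    by (rule tracefree_rel_schouten_weyl_N[OF i y tr, of _ "(1 / 2) * sigma (weyl_N c \<Gamma> i) (conf_N c i) y"])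
      (simp add: schouten_weyl_surface_def A_def)
  ultimately show ?thesis by (simp add: ind_moebius_eq[OF weyl l i y] left_diff_distrib)
qed

lemma ind_moebius_ext_eq:
  assumes l: "dens_section \<S> UNIV 1 l" and l': "extends_on X \<A> N c l W l'"
    and i: "i \<in> slice_labels \<A> N" and y: "incl y \<in> cmap \<A> i ` (cdom \<A> i \<inter> W)"
  shows "ind_moebius c \<Gamma> l i y u v
    = ind_moebius_ext (c i) (\<Gamma> i) (l' i) y u v / weight_factor (c i) y"
proof -
  interpret SC: slice_chart "cimg \<A> i" "\<Gamma> i" "c i" by (rule slice_chart[OF weyl i])
  define V where "V = cmap \<A> i ` (cdom \<A> i \<inter> W)"
  have iA: "i \<in> labels \<A>" by (rule slice_label_label[OF i])
  have ch: "is_chart X (cdom \<A> i) (cmap \<A> i)" using smooth_atlas iA by (simp add: smooth_atlas_def)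
  have V: "open V" unfolding V_def
    using l' by (intro is_chart_open_image[OF ch]) (simp add: extends_on_def)
  have VS: "V \<subseteq> cimg \<A> i" by (auto simp: V_def cimg_def)
  have yV: "incl y \<in> V" using y by (simp add: V_def)
  have "ind_moebius_ext (c i) (\<Gamma> i) (l' i) y u v = ind_moebius_local (c i) (\<Gamma> i) (dens_on_N c l i) y u v"
  proof (rule SC.ind_moebius_ext_eq[OF _ V yV VS])
    show "y \<in> SC.T" using VS yV by (auto simp: SC.T_iff)
    show "smooth_on V (l' i)" using l' iA by (simp add: extends_on_def dens_section_def V_def)
    show "l' i (incl z) = dens_on_N c l i z" if "incl z \<in> V" for z
      using l' i that by (simp add: extends_on_def V_def)
  qed
  then show ?thesis by (simp add: ind_moebius_def)
qed

text \<open>The chain rule for the passage from \<open>r\<close> through \<open>i\<close> to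
  \<open>j\<close>. An extension defined by means of the chart \<open>r\<close> obeys the law
  between two arbitrary charts because of it.\<close>

lemma det_transition_cocycle:
  assumes i: "i \<in> labels \<A>" and j: "j \<in> labels \<A>" and r: "r \<in> labels \<A>"
    and q: "q \<in> cdom \<A> i" "q \<in> cdom \<A> j" "q \<in> cdom \<A> r"
  shows "det (matrix (frechet_derivative (transition \<A> r j) (at (cmap \<A> r q))))
    = det (matrix (frechet_derivative (transition \<A> i j) (at (cmap \<A> i q))))
      * det (matrix (frechet_derivative (transition \<A> r i) (at (cmap \<A> r q))))"
proof -
  interpret ri: chart_map "overlap \<A> r i" "overlap \<A> i r" "transition \<A> r i" "transition \<A> i r"
    by (rule chart_map_transition[OF regular r i])
  interpret ij: chart_map "overlap \<A> i j" "overlap \<A> j i" "transition \<A> i j" "transition \<A> j i"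
    by (rule chart_map_transition[OF regular i j])
  define V where "V = cmap \<A> r ` (cdom \<A> r \<inter> (cdom \<A> i \<inter> cdom \<A> j))"
  have ch: "is_chart X (cdom \<A> a) (cmap \<A> a)" if "a \<in> labels \<A>" for a
    using smooth_atlas that by (simp add: smooth_atlas_def)
  then have "openin X (cdom \<A> i \<inter> cdom \<A> j)" using i j by (intro openin_Int) (auto simp: is_chart_def)
  then have V: "open V" unfolding V_def by (rule is_chart_open_image[OF ch[OF r]])
  have x: "cmap \<A> r q \<in> V" "cmap \<A> r q \<in> overlap \<A> r i" "cmap \<A> i q \<in> overlap \<A> i j"
    using q by (auto simp: V_def overlap_def)
  have t: "transition \<A> r i (cmap \<A> r q) = cmap \<A> i q" by (rule transition_cmap[OF regular r q(3)])
  have "((\<lambda>x. transition \<A> i j (transition \<A> r i x)) has_derivative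
      (\<lambda>v. ij.J (cmap \<A> i q) (ri.J (cmap \<A> r q) v))) (at (cmap \<A> r q))"
    using has_derivative_compose[OF ri.has_derivative_\<tau>[OF x(2)]] ij.has_derivative_\<tau>[OF x(3)] t by auto
  moreover have "transition \<A> i j (transition \<A> r i x) = transition \<A> r j x" if "x \<in> V" for x
    using that transition_cmap[OF regular i] transition_cmap[OF regular r] by (auto simp: V_def)
  ultimately have "(transition \<A> r j has_derivative
      (\<lambda>v. ij.J (cmap \<A> i q) (ri.J (cmap \<A> r q) v))) (at (cmap \<A> r q))"
    by (rule has_derivative_transform_within_open[OF _ V x(1)])
  then have "frechet_derivative (transition \<A> r j) (at (cmap \<A> r q))
      = ij.J (cmap \<A> i q) \<circ> ri.J (cmap \<A> r q)"
    by (simp add: deriv_along_eqI o_def)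
  then show ?thesis
    using matrix_compose[OF ri.J_linear[OF x(2)] ij.J_linear[OF x(3)]] by (simp add: det_mul)
qed

text \<open>Extend constantly in the normal coordinates of one slice chart; the components in the other
  charts are then forced by the transformation law.\<close>

lemma extension_exists:
  assumes l: "dens_section \<S> UNIV 1 l" and p: "p \<in> N"
  shows "\<exists>W l'. p \<in> W \<and> extends_on X \<A> N c l W l'"
proof -
  obtain r where r: "r \<in> slice_labels \<A> N" and pr: "p \<in> cdom \<A> r"
    using submanifold p unfolding submanifold_def by blast
  have rA: "r \<in> labels \<A>" and rN: "r \<in> labels \<S>" using r by (auto simp: slice_label_label sub_atlas_simps)
  interpret SC: slice_chart "cimg \<A> r" "\<Gamma> r" "c r" by (rule slice_chart[OF weyl r])
  have T: "SC.T = cimg \<S> r" by (rule T_eq[OF r])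
  have ch: "is_chart X (cdom \<A> a) (cmap \<A> a)" if "a \<in> labels \<A>" for a
    using smooth_atlas that by (simp add: smooth_atlas_def)
  \<comment> \<open>The points whose projection to the slice lies in the image of the chart of
    \<open>N\<close>; only there does the constant extension have a smooth section to copy.\<close>
  define V0 where "V0 = cimg \<A> r \<inter> {x. prj x \<in> SC.T}"
  have "open {x :: real ^ ('n + 'k). prj x \<in> SC.T}"
    using SC.open_T linear_continuous_on[OF bounded_linear_prj, of UNIV]
    by (metis continuous_open_vimage continuous_on_eq_continuous_at open_UNIV UNIV_I vimage_def)
  then have V0: "open V0" using SC.open_S by (simp add: V0_def open_Int)
  define W where "W = {q \<in> cdom \<A> r. cmap \<A> r q \<in> V0}"
  have oW: "openin X W"
  proof -
    have U: "openin X (cdom \<A> r)" using ch[OF rA] by (simp add: is_chart_def)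
    have "continuous_map (subtopology X (cdom \<A> r)) (top_of_set (cmap \<A> r ` cdom \<A> r)) (cmap \<A> r)"
      using ch[OF rA] homeomorphic_imp_continuous_map unfolding is_chart_def by blast
    moreover have "openin (top_of_set (cmap \<A> r ` cdom \<A> r)) V0"
      using V0 by (intro open_subset) (auto simp: V0_def cimg_def)
    ultimately have "openin (subtopology X (cdom \<A> r)) {q \<in> topspace (subtopology X (cdom \<A> r)). cmap \<A> r q \<in> V0}"
      by (rule openin_continuous_map_preimage)
    moreover have "topspace (subtopology X (cdom \<A> r)) = cdom \<A> r"
      by (rule topspace_subtopology_subset[OF openin_subset[OF U]])
    ultimately have "openin (subtopology X (cdom \<A> r)) W" by (simp only: W_def)
    then show ?thesis using U by (rule openin_trans_full)
  qed
  have pW: "p \<in> W"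
  proof -
    have "incl (prj (cmap \<A> r p)) = cmap \<A> r p" by (rule slice_cmap_incl[OF r pr p])
    moreover have "cmap \<A> r p \<in> cimg \<A> r" using pr by (simp add: cimg_def)
    ultimately show ?thesis using pr by (simp add: W_def V0_def SC.T_iff)
  qed
  define L :: "real ^ ('n + 'k) \<Rightarrow> real" where "L = (\<lambda>x. dens_on_N c l r (prj x))"
  have sL: "smooth_on V0 L"
    unfolding L_def
  proof (rule smooth_on_compose[OF _ smooth_on_bounded_linear_id[OF bounded_linear_prj] V0 SC.open_T])
    show "smooth_on SC.T (dens_on_N c l r)"
      unfolding dens_on_N_def
      using dens_section_smooth[OF l rN] by (intro smooth_on_mult SC.w_smooth SC.open_T) (simp add: T)
  qed (simp add: V0_def)
  define F where "F = (\<lambda>j x. \<bar>det (matrix (frechet_derivative (transition \<A> r j) (at x)))\<bar> powr (1 / real CARD('n + 'k)))"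
  define l' where "l' = (\<lambda>j z. F j (transition \<A> j r z) * L (transition \<A> j r z))"
  have l'_eq: "l' j (cmap \<A> j q) = F j (cmap \<A> r q) * L (cmap \<A> r q)"
    if "j \<in> labels \<A>" "q \<in> cdom \<A> j" for j q
    using transition_cmap[OF regular that, of r] by (simp add: l'_def)
  have "dens_section \<A> W 1 l'"
    unfolding dens_section_def Let_def
  proof (intro conjI ballI)
    fix j assume j: "j \<in> labels \<A>"
    interpret C: chart_map "overlap \<A> r j" "overlap \<A> j r" "transition \<A> r j" "transition \<A> j r"
      by (rule chart_map_transition[OF regular rA j])
    let ?V = "cmap \<A> j ` (cdom \<A> j \<inter> W)"
    have oV: "open ?V" by (rule is_chart_open_image[OF ch[OF j] oW])
    have sub: "?V \<subseteq> overlap \<A> j r" by (auto simp: W_def overlap_def)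
    have oI: "open (overlap \<A> r j \<inter> V0)" using C.open_V V0 by (rule open_Int)
    have F: "F j = C.factor 1" by (simp add: F_def C.factor_def fun_eq_iff)
    have FL: "smooth_on (overlap \<A> r j \<inter> V0) (\<lambda>x. F j x * L x)"
      unfolding F using C.factor_smooth sL
      by (intro smooth_on_mult oI) (auto intro: smooth_on_subset)
    show "smooth_on ?V (l' j)"
      unfolding l'_def
    proof (rule smooth_on_compose[OF FL smooth_on_subset[OF C.\<sigma>_smooth sub] oV oI])
      show "transition \<A> j r x \<in> overlap \<A> r j \<inter> V0" if x: "x \<in> ?V" for x
      proof -
        obtain q where q: "x = cmap \<A> j q" "q \<in> cdom \<A> j" "q \<in> W" using x by blast
        then have "transition \<A> j r x = cmap \<A> r q" using transition_cmap[OF regular j, of q r] by simp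
        then show ?thesis using q by (auto simp: W_def overlap_def)
      qed
    qed
  next
    fix i j x assume i: "i \<in> labels \<A>" and j: "j \<in> labels \<A>" and "x \<in> cmap \<A> i ` (cdom \<A> i \<inter> cdom \<A> j \<inter> W)"
    then obtain q where q: "x = cmap \<A> i q" "q \<in> cdom \<A> i" "q \<in> cdom \<A> j" "q \<in> W" by blast
    then have qr: "q \<in> cdom \<A> r" by (simp add: W_def)
    have "F j (cmap \<A> r q) = \<bar>det (matrix (frechet_derivative (transition \<A> i j) (at x)))\<bar> powr (1 / real CARD('n + 'k))
        * F i (cmap \<A> r q)"
      unfolding F_def det_transition_cocycle[OF i j rA q(2,3) qr] q(1) by (simp add: abs_mult powr_mult)
    then show "l' j (transition \<A> i j x) = \<bar>det (matrix (frechet_derivative (transition \<A> i j) (at x)))\<bar>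
        powr (1 / real CARD('n + 'k)) * l' i x"
      unfolding q(1) transition_cmap[OF regular i q(2)] l'_eq[OF j q(3)] l'_eq[OF i q(2)] by simp
  qed
  moreover have "l' i (incl y) = dens_on_N c l i y"
    if i: "i \<in> slice_labels \<A> N" and y: "incl y \<in> cmap \<A> i ` (cdom \<A> i \<inter> W)" for i y
  proof -
    have iA: "i \<in> labels \<A>" and iN: "i \<in> labels \<S>" using i by (auto simp: slice_label_label sub_atlas_simps)
    interpret SM: slice_map "overlap \<A> r i" "overlap \<A> i r" "transition \<A> r i" "transition \<A> i r"
      "\<Gamma> r" "\<Gamma> i" "c r" "c i" "transition \<S> r i" "transition \<S> i r" by (rule slice_map(1)[OF weyl r i])
    from y obtain q where "incl y = cmap \<A> i q" "q \<in> cdom \<A> i \<inter> W" by (rule imageE)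
    then have q: "cmap \<A> i q = incl y" "q \<in> cdom \<A> i" "q \<in> cdom \<A> r" "q \<in> W" by (metis, simp_all add: W_def)
    have qN: "q \<in> N" by (rule slice_mem[OF regular i q(2,1)])
    define y0 where "y0 = prj (cmap \<A> r q)"
    have y0: "incl y0 = cmap \<A> r q" unfolding y0_def by (rule slice_cmap_incl[OF r q(3) qN])
    have ov: "incl y0 \<in> overlap \<A> r i" unfolding y0 using q by (auto simp: overlap_def)
    then have y0T: "y0 \<in> overlap \<S> r i" by (simp add: overlap_sub_atlas[OF regular r])
    then have "y0 \<in> SM.A.T" by (simp add: slice_map(2)[OF weyl r i])
    \<comment> \<open>Reconciles the two laws: the forced components use the density factor of
      \<open>M\<close>, the given section that of \<open>N\<close>.\<close>
    note wn = SM.weight_natural[OF this]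
    have "transition \<S> r i y0 = prj (transition \<A> r i (incl y0))"
      by (rule transition_sub_atlas(2)[OF regular r i ov])
    also have "\<dots> = y" unfolding y0 transition_cmap[OF regular rA q(3)] q(1) by simp
    finally have ty: "transition \<S> r i y0 = y" .
    have "l i y = SM.N.factor 1 y0 * l r y0"
      using dens_section_law[OF l rN iN y0T] by (simp add: ty SM.N.factor_def)
    then have "dens_on_N c l i y = (weight_factor (c i) y * SM.N.factor 1 y0) * l r y0"
      by (simp add: dens_on_N_def)
    also have "\<dots> = F i (incl y0) * dens_on_N c l r y0"
      using wn by (simp add: ty dens_on_N_def F_def SM.M.factor_def)
    also have "\<dots> = l' i (incl y)"
      using l'_eq[OF iA q(2)] by (simp add: q(1) y0[symmetric] L_def)
    finally show ?thesis by simp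
  qed
  ultimately have "extends_on X \<A> N c l W l'" using oW unfolding extends_on_def by blast
  then show ?thesis using pW by blast
qed

end

theorem proposition4p23:
  fixes X :: "'a topology"
    and \<A> :: "('i, 'a, 'n::finite + 'k::finite) atlas"
    and N :: "'a set"
    and c :: "'i \<Rightarrow> real ^ ('n + 'k) \<Rightarrow> real ^ ('n + 'k) \<Rightarrow> real ^ ('n + 'k) \<Rightarrow> real"
    and \<Gamma> :: "'i \<Rightarrow> real ^ ('n + 'k) \<Rightarrow> real ^ ('n + 'k) \<Rightarrow> real ^ ('n + 'k) \<Rightarrow> real ^ ('n + 'k)"
  assumes "smooth_manifold X \<A>"
    and "conformal_structure \<A> c"
    and "submanifold X \<A> N"
    and "CARD('n) \<ge> 2"
    and "weyl_structure \<A> c \<Gamma>"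
  shows
    \<comment> \<open>the two definitions agree\<close>
    "(\<forall>l. dens_section (sub_atlas \<A> N) UNIV 1 l \<longrightarrow>
        (\<forall>p\<in>N. \<exists>W l'. p \<in> W \<and> extends_on X \<A> N c l W l') \<and>
        (\<forall>W l'. extends_on X \<A> N c l W l' \<longrightarrow>
          (\<forall>i\<in>slice_labels \<A> N. \<forall>y. incl y \<in> cmap \<A> i ` (cdom \<A> i \<inter> W) \<longrightarrow>
            (\<forall>u v. ind_moebius c \<Gamma> l i y u v =
               ind_moebius_ext (c i) (\<Gamma> i) (l' i) y u v / weight_factor (c i) y))))
    \<and> \<comment> \<open>independence of the Weyl structure\<close>
     (\<forall>\<Gamma>'. weyl_structure \<A> c \<Gamma>' \<longrightarrow>
        (\<forall>l. dens_section (sub_atlas \<A> N) UNIV 1 l \<longrightarrow>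
          (\<forall>i\<in>labels (sub_atlas \<A> N). \<forall>y\<in>cimg (sub_atlas \<A> N) i. \<forall>u v.
             ind_moebius c \<Gamma> l i y u v = ind_moebius c \<Gamma>' l i y u v)))
    \<and> moebius_structure (sub_atlas \<A> N) (conf_N c) (ind_moebius c \<Gamma>)
    \<and> \<comment> \<open>comparison with the canonical Moebius structure of \<open>N\<close>\<close>
     (CARD('n) \<ge> 3 \<longrightarrow>
        (\<forall>\<Gamma>N. weyl_structure (sub_atlas \<A> N) (conf_N c) \<Gamma>N \<longrightarrow>
          (\<forall>l. dens_section (sub_atlas \<A> N) UNIV 1 l \<longrightarrow>
            (\<forall>i\<in>labels (sub_atlas \<A> N). \<forall>y\<in>cimg (sub_atlas \<A> N) i. \<forall>u v.
               ind_moebius c \<Gamma> l i y u v - canonical_moebius (conf_N c) \<Gamma>N l i y u v =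
               tracefree (conf_N c i y) (rho c \<Gamma> i y) u v * l i y))))
    \<and> \<comment> \<open>comparison with a given Moebius structure of a surface \<open>N\<close>\<close>
     (CARD('n) = 2 \<longrightarrow>
        (\<forall>D. moebius_structure (sub_atlas \<A> N) (conf_N c) D \<longrightarrow>
          (\<forall>l. dens_section (sub_atlas \<A> N) UNIV 1 l \<longrightarrow>
            (\<forall>i\<in>labels (sub_atlas \<A> N). \<forall>y\<in>cimg (sub_atlas \<A> N) i. \<forall>u v.
               ind_moebius c \<Gamma> l i y u v - D l i y u v =
               tracefree (conf_N c i y) (rho_surface \<A> N c D \<Gamma> i y) u v * l i y))))"
proof -
  interpret conformal_submanifold X \<A> N c \<Gamma>
    by (rule conformal_submanifold.intro[OF assms])
  show ?thesis
    unfolding sub_atlas_simps(1)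
    using extension_exists ind_moebius_ext_eq ind_moebius_independent ind_moebius_structure
      ind_moebius_canonical ind_moebius_surface
    by (intro conjI allI impI ballI) auto
qed

end
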